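(* Let $\mathcal{B}$ be a Birkhoff subcategory of a semi-abelian category $\mathcal{A}$. The following conditions are equivalent: (1) the reflector $I\colon\mathcal{A}\to\mathcal{B}$ is protoadditive; (2) the associated radical $[\cdot]_{\mathcal{B}}\colon\mathcal{A}\to\mathcal{A}$ is protoadditive; (3) (a) for any normal epimorphism $f\colon A\to B$ in $\mathcal{A}$, the induced monomorphism $[K[f]]_{\mathcal{B}}\to A$ is normal; and (b) the normal extensions are precisely the normal epimorphisms $f$ with $K[f]\in\mathcal{B}$; (4) (a) for any normal epimorphism $f\colon A\to B$ in $\mathcal{A}$, the induced monomorphism $[K[f]]_{\mathcal{B}}\to A$ is normal; and (b) for any normal epimorphism $f\colon A\to B$, the reflection of $f$ in $\mathrm{NExt}_{(\mathcal{B},\mathcal{N})}(\mathcal{A})$ is given by the induced morphism $\overline{f}\colon A/[K[f]]_{\mathcal{B}}\to B$.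
   Context: A semi-abelian category is a pointed, Barr-exact, protomodular category with binary coproducts (protomodular: the split short five lemma holds). $\ker(f)\colon K[f]\to A$ is the kernel of $f\colon A\to B$. Normal monomorphisms (epimorphisms) are kernels (cokernels) of some morphism; for a normal monomorphism $K\to A$, $A/K$ denotes its cokernel object. A split short exact sequence is a triple $(k,f,s)$ with $k=\ker(f)$, $f\circ s=1$; a functor between pointed protomodular categories is protoadditive if it preserves split short exact sequences. A Birkhoff subcategory $\mathcal{B}$ of $\mathcal{A}$ is a full (replete) reflective subcategory closed under subobjects and regular quotients. Write $I\colon\mathcal{A}\to\mathcal{B}$ for the reflector, $\eta_A\colon A\to I(A)$ for the unit (a normal epimorphism), $\kappa_A=\ker(\eta_A)\colon[A]_{\mathcal{B}}\to A$; this defines the radical $[\cdot]_{\mathcal{B}}\colon\mathcal{A}\to\mathcal{A}$. The induced monomorphism $[K[f]]_{\mathcal{B}}\to A$ is $\ker(f)\circ\kappa_{K[f]}$. Let $\mathcal{N}$ be the class of normal epimorphisms of $\mathcal{A}$. A normal extension is a normal epimorphism $f\colon A\to B$ such that, for the first projection $\pi_1\colon R[f]\to A$ of its kernel pair, the naturality square $\eta_A\circ\pi_1=I(\pi_1)\circ\eta_{R[f]}$ is a pullback (i.e. a normal extension with respect to the Galois structure $\Gamma_{(\mathcal{B},\mathcal{N})}$ given by the reflection $I$ and the class $\mathcal{N}$). $\mathrm{NExt}_{(\mathcal{B},\mathcal{N})}(\mathcal{A})$ is the full subcategory of the category of normal epimorphisms in $\mathcal{A}$ (a full subcategory of the arrow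 category of $\mathcal{A}$) on the normal extensions; it is known to be reflective there. *)

theory Defs
  imports Main
begin

section \<open>Categories, functors, full subcategories\<close>

text \<open>Composition is partial in spirit: \<open>g \<cdot>\<^bsub>C\<^esub> f\<close> is only meaningful when \<open>f\<close> and \<open>g\<close> are arrows
  with \<open>Cod C f = Dom C g\<close>, and every definition below is relativised to the carriers.\<close>

record ('o, 'm) cat =
  Ob  :: "'o set"
  Ar  :: "'m set"
  Dom :: "'m \<Rightarrow> 'o"
  Cod :: "'m \<Rightarrow> 'o"
  Ide :: "'o \<Rightarrow> 'm"
  Cmp :: "'m \<Rightarrow> 'm \<Rightarrow> 'm"  (infixl "\<cdot>\<index>" 70)

definition hom :: "('o, 'm) cat \<Rightarrow> 'o \<Rightarrow> 'o \<Rightarrow> 'm set" where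
  "hom C a b = {f \<in> Ar C. Dom C f = a \<and> Cod C f = b}"

locale category =
  fixes C :: "('o, 'm) cat" (structure)
  assumes Dom_in: "f \<in> Ar C \<Longrightarrow> Dom C f \<in> Ob C"
    and Cod_in: "f \<in> Ar C \<Longrightarrow> Cod C f \<in> Ob C"
    and Ide_in: "a \<in> Ob C \<Longrightarrow> Ide C a \<in> hom C a a"
    and Cmp_in: "\<lbrakk>f \<in> hom C a b; g \<in> hom C b c\<rbrakk> \<Longrightarrow> g \<cdot> f \<in> hom C a c"
    and Cmp_Ide: "f \<in> hom C a b \<Longrightarrow> f \<cdot> Ide C a = f"
    and Ide_Cmp: "f \<in> hom C a b \<Longrightarrow> Ide C b \<cdot> f = f"
    and Cmp_assoc: "\<lbrakk>f \<in> hom C a b; g \<in> hom C b c; h \<in> hom C c d\<rbrakk> \<Longrightarrow> (h \<cdot> g) \<cdot> f = h \<cdot> (g \<cdot> f)"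

record ('o, 'm, 'p, 'n) func =
  fob :: "'o \<Rightarrow> 'p"
  far :: "'m \<Rightarrow> 'n"

definition is_functor :: "('o, 'm) cat \<Rightarrow> ('p, 'n) cat \<Rightarrow> ('o, 'm, 'p, 'n) func \<Rightarrow> bool" where
  "is_functor C D F \<longleftrightarrow>
     (\<forall>a \<in> Ob C. fob F a \<in> Ob D \<and> far F (Ide C a) = Ide D (fob F a)) \<and>
     (\<forall>f \<in> Ar C. far F f \<in> hom D (fob F (Dom C f)) (fob F (Cod C f))) \<and>
     (\<forall>f \<in> Ar C. \<forall>g \<in> Ar C. Cod C f = Dom C g \<longrightarrow>
        far F (g \<cdot>\<^bsub>C\<^esub> f) = far F g \<cdot>\<^bsub>D\<^esub> far F f)"

definition full_sub :: "('o, 'm) cat \<Rightarrow> 'o set \<Rightarrow> ('o, 'm) cat" where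
  "full_sub C S = C\<lparr>Ob := Ob C \<inter> S, Ar := {f \<in> Ar C. Dom C f \<in> S \<and> Cod C f \<in> S}\<rparr>"

text \<open>An arrow \<open>f \<rightarrow> g\<close> of the arrow category is a commutative square \<open>g \<cdot> u = v \<cdot> f\<close>, recorded
  together with its source \<open>f\<close> and target \<open>g\<close> as \<open>(f, (u, v), g)\<close>.\<close>

definition arrow_cat :: "('o, 'm) cat \<Rightarrow> ('m, 'm \<times> ('m \<times> 'm) \<times> 'm) cat" where
  "arrow_cat C =
     \<lparr>Ob = Ar C,
      Ar = {(f, (u, v), g). f \<in> Ar C \<and> g \<in> Ar C \<and> u \<in> hom C (Dom C f) (Dom C g) \<and>
              v \<in> hom C (Cod C f) (Cod C g) \<and> g \<cdot>\<^bsub>C\<^esub> u = v \<cdot>\<^bsub>C\<^esub> f},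
      Dom = (\<lambda>(f, _, _). f),
      Cod = (\<lambda>(_, _, g). g),
      Ide = (\<lambda>f. (f, (Ide C (Dom C f), Ide C (Cod C f)), f)),
      Cmp = (\<lambda>(_, (u', v'), g') (f, (u, v), _). (f, (u' \<cdot>\<^bsub>C\<^esub> u, v' \<cdot>\<^bsub>C\<^esub> v), g'))\<rparr>"

lemma category_full_sub: "category C \<Longrightarrow> category (full_sub C S)"
  by (simp add: category_def full_sub_def hom_def)

lemma category_arrow_cat: assumes "category C" shows "category (arrow_cat C)"
proof -
  interpret category C by fact
  have sq: "g' \<cdot>\<^bsub>C\<^esub> (u' \<cdot>\<^bsub>C\<^esub> u) = (v' \<cdot>\<^bsub>C\<^esub> v) \<cdot>\<^bsub>C\<^esub> f"
    if "f \<in> Ar C" "g \<in> Ar C" "g' \<in> Ar C"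
      "u \<in> hom C (Dom C f) (Dom C g)" "v \<in> hom C (Cod C f) (Cod C g)"
      "u' \<in> hom C (Dom C g) (Dom C g')" "v' \<in> hom C (Cod C g) (Cod C g')"
      "g \<cdot>\<^bsub>C\<^esub> u = v \<cdot>\<^bsub>C\<^esub> f" "g' \<cdot>\<^bsub>C\<^esub> u' = v' \<cdot>\<^bsub>C\<^esub> g" for f g g' u v u' v'
  proof -
    have h: "f \<in> hom C (Dom C f) (Cod C f)" "g \<in> hom C (Dom C g) (Cod C g)"
      "g' \<in> hom C (Dom C g') (Cod C g')" using that by (auto simp: hom_def)
    show ?thesis using that h by (metis Cmp_assoc)
  qed
  have self: "f \<in> hom C (Dom C f) (Cod C f)" if "f \<in> Ar C" for f
    using that by (simp add: hom_def)
  have ids: "f \<cdot>\<^bsub>C\<^esub> Ide C (Dom C f) = f" "Ide C (Cod C f) \<cdot>\<^bsub>C\<^esub> f = f" if "f \<in> Ar C" for f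
    using self[OF that] Cmp_Ide Ide_Cmp by blast+
  show ?thesis
  proof
    fix f a b g c assume "f \<in> hom (arrow_cat C) a b" "g \<in> hom (arrow_cat C) b c"
    then show "g \<cdot>\<^bsub>arrow_cat C\<^esub> f \<in> hom (arrow_cat C) a c"
      by (cases f; cases g) (auto simp: arrow_cat_def hom_def[of "\<lparr>Ob = _, Ar = _, Dom = _, Cod = _, Ide = _, Cmp = _\<rparr>"] intro: Cmp_in sq)
  next
    fix f a b g c h d
    assume "f \<in> hom (arrow_cat C) a b" "g \<in> hom (arrow_cat C) b c" "h \<in> hom (arrow_cat C) c d"
    then show "h \<cdot>\<^bsub>arrow_cat C\<^esub> g \<cdot>\<^bsub>arrow_cat C\<^esub> f = h \<cdot>\<^bsub>arrow_cat C\<^esub> (g \<cdot>\<^bsub>arrow_cat C\<^esub> f)"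
      by (cases f; cases g; cases h) (auto simp: arrow_cat_def hom_def[of "\<lparr>Ob = _, Ar = _, Dom = _, Cod = _, Ide = _, Cmp = _\<rparr>"] intro: Cmp_assoc)
  qed (auto simp: arrow_cat_def hom_def[of "\<lparr>Ob = _, Ar = _, Dom = _, Cod = _, Ide = _, Cmp = _\<rparr>"] ids
        intro: Ide_in Dom_in Cod_in Cmp_Ide Ide_Cmp)
qed


section \<open>Limits, colimits and classes of arrows\<close>

definition iso :: "('o, 'm) cat \<Rightarrow> 'm \<Rightarrow> bool" where
  "iso C f \<longleftrightarrow> f \<in> Ar C \<and>
     (\<exists>g \<in> hom C (Cod C f) (Dom C f). g \<cdot>\<^bsub>C\<^esub> f = Ide C (Dom C f) \<and> f \<cdot>\<^bsub>C\<^esub> g = Ide C (Cod C f))"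

definition mono_ar :: "('o, 'm) cat \<Rightarrow> 'm \<Rightarrow> bool" where
  "mono_ar C m \<longleftrightarrow> m \<in> Ar C \<and>
     (\<forall>x. \<forall>g \<in> hom C x (Dom C m). \<forall>h \<in> hom C x (Dom C m). m \<cdot>\<^bsub>C\<^esub> g = m \<cdot>\<^bsub>C\<^esub> h \<longrightarrow> g = h)"

definition terminal_object :: "('o, 'm) cat \<Rightarrow> 'o \<Rightarrow> bool" where
  "terminal_object C t \<longleftrightarrow> t \<in> Ob C \<and> (\<forall>a \<in> Ob C. \<exists>!f. f \<in> hom C a t)"

definition initial_object :: "('o, 'm) cat \<Rightarrow> 'o \<Rightarrow> bool" where
  "initial_object C i \<longleftrightarrow> i \<in> Ob C \<and> (\<forall>a \<in> Ob C. \<exists>!f. f \<in> hom C i a)"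

definition zero_object :: "('o, 'm) cat \<Rightarrow> 'o \<Rightarrow> bool" where
  "zero_object C z \<longleftrightarrow> initial_object C z \<and> terminal_object C z"

definition zero_ar :: "('o, 'm) cat \<Rightarrow> 'm \<Rightarrow> bool" where
  "zero_ar C f \<longleftrightarrow> f \<in> Ar C \<and>
     (\<exists>z. zero_object C z \<and>
        (\<exists>g \<in> hom C (Dom C f) z. \<exists>h \<in> hom C z (Cod C f). f = h \<cdot>\<^bsub>C\<^esub> g))"

text \<open>Kernels, cokernels, pullbacks etc. are relations, since they are determined only up to
  isomorphism. In \<open>pullback C f g p q\<close> the square is \<open>f \<cdot> p = g \<cdot> q\<close>.\<close>

definition kernel :: "('o, 'm) cat \<Rightarrow> 'm \<Rightarrow> 'm \<Rightarrow> bool" where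
  "kernel C f k \<longleftrightarrow> f \<in> Ar C \<and> k \<in> Ar C \<and> Cod C k = Dom C f \<and> zero_ar C (f \<cdot>\<^bsub>C\<^esub> k) \<and>
     (\<forall>h \<in> Ar C. Cod C h = Dom C f \<and> zero_ar C (f \<cdot>\<^bsub>C\<^esub> h) \<longrightarrow>
        (\<exists>!u. u \<in> hom C (Dom C h) (Dom C k) \<and> k \<cdot>\<^bsub>C\<^esub> u = h))"

definition cokernel :: "('o, 'm) cat \<Rightarrow> 'm \<Rightarrow> 'm \<Rightarrow> bool" where
  "cokernel C f q \<longleftrightarrow> f \<in> Ar C \<and> q \<in> Ar C \<and> Dom C q = Cod C f \<and> zero_ar C (q \<cdot>\<^bsub>C\<^esub> f) \<and>
     (\<forall>h \<in> Ar C. Dom C h = Cod C f \<and> zero_ar C (h \<cdot>\<^bsub>C\<^esub> f) \<longrightarrow>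
        (\<exists>!u. u \<in> hom C (Cod C q) (Cod C h) \<and> u \<cdot>\<^bsub>C\<^esub> q = h))"

definition normal_mono :: "('o, 'm) cat \<Rightarrow> 'm \<Rightarrow> bool" where
  "normal_mono C m \<longleftrightarrow> (\<exists>f. kernel C f m)"

definition normal_epi :: "('o, 'm) cat \<Rightarrow> 'm \<Rightarrow> bool" where
  "normal_epi C q \<longleftrightarrow> (\<exists>f. cokernel C f q)"

definition pullback :: "('o, 'm) cat \<Rightarrow> 'm \<Rightarrow> 'm \<Rightarrow> 'm \<Rightarrow> 'm \<Rightarrow> bool" where
  "pullback C f g p q \<longleftrightarrow> f \<in> Ar C \<and> g \<in> Ar C \<and> Cod C f = Cod C g \<and>
     p \<in> Ar C \<and> q \<in> Ar C \<and> Dom C p = Dom C q \<and> Cod C p = Dom C f \<and> Cod C q = Dom C g \<and>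
     f \<cdot>\<^bsub>C\<^esub> p = g \<cdot>\<^bsub>C\<^esub> q \<and>
     (\<forall>w. \<forall>x \<in> hom C w (Dom C f). \<forall>y \<in> hom C w (Dom C g). f \<cdot>\<^bsub>C\<^esub> x = g \<cdot>\<^bsub>C\<^esub> y \<longrightarrow>
        (\<exists>!u. u \<in> hom C w (Dom C p) \<and> p \<cdot>\<^bsub>C\<^esub> u = x \<and> q \<cdot>\<^bsub>C\<^esub> u = y))"

definition kernel_pair :: "('o, 'm) cat \<Rightarrow> 'm \<Rightarrow> 'm \<Rightarrow> 'm \<Rightarrow> bool" where
  "kernel_pair C f p q \<longleftrightarrow> pullback C f f p q"

definition coequalizer :: "('o, 'm) cat \<Rightarrow> 'm \<Rightarrow> 'm \<Rightarrow> 'm \<Rightarrow> bool" where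
  "coequalizer C f g q \<longleftrightarrow> f \<in> Ar C \<and> g \<in> Ar C \<and> Dom C f = Dom C g \<and> Cod C f = Cod C g \<and>
     q \<in> Ar C \<and> Dom C q = Cod C f \<and> q \<cdot>\<^bsub>C\<^esub> f = q \<cdot>\<^bsub>C\<^esub> g \<and>
     (\<forall>h \<in> Ar C. Dom C h = Cod C f \<and> h \<cdot>\<^bsub>C\<^esub> f = h \<cdot>\<^bsub>C\<^esub> g \<longrightarrow>
        (\<exists>!u. u \<in> hom C (Cod C q) (Cod C h) \<and> u \<cdot>\<^bsub>C\<^esub> q = h))"

definition regular_epi :: "('o, 'm) cat \<Rightarrow> 'm \<Rightarrow> bool" where
  "regular_epi C q \<longleftrightarrow> (\<exists>f g. coequalizer C f g q)"

definition coproduct :: "('o, 'm) cat \<Rightarrow> 'o \<Rightarrow> 'o \<Rightarrow> 'm \<Rightarrow> 'm \<Rightarrow> bool" where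
  "coproduct C a b i j \<longleftrightarrow> i \<in> Ar C \<and> j \<in> Ar C \<and> Dom C i = a \<and> Dom C j = b \<and> Cod C i = Cod C j \<and>
     (\<forall>c. \<forall>x \<in> hom C a c. \<forall>y \<in> hom C b c.
        (\<exists>!u. u \<in> hom C (Cod C i) c \<and> u \<cdot>\<^bsub>C\<^esub> i = x \<and> u \<cdot>\<^bsub>C\<^esub> j = y))"


section \<open>Semi-abelian categories\<close>

definition pointed :: "('o, 'm) cat \<Rightarrow> bool" where
  "pointed C \<longleftrightarrow> (\<exists>z. zero_object C z)"

text \<open>Finite completeness is expressed by a terminal object and pullbacks.\<close>

definition finitely_complete :: "('o, 'm) cat \<Rightarrow> bool" where
  "finitely_complete C \<longleftrightarrow> (\<exists>t. terminal_object C t) \<and>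
     (\<forall>f \<in> Ar C. \<forall>g \<in> Ar C. Cod C f = Cod C g \<longrightarrow> (\<exists>p q. pullback C f g p q))"

definition regular_cat :: "('o, 'm) cat \<Rightarrow> bool" where
  "regular_cat C \<longleftrightarrow> finitely_complete C \<and>
     (\<forall>f p q. kernel_pair C f p q \<longrightarrow> (\<exists>e. coequalizer C p q e)) \<and>
     (\<forall>f g p q. pullback C f g p q \<and> regular_epi C f \<longrightarrow> regular_epi C q)"

text \<open>An internal equivalence relation on \<open>a\<close>, given by its two projections \<open>r\<^sub>1, r\<^sub>2 : R \<rightarrow> a\<close>.\<close>

definition equivalence_relation :: "('o, 'm) cat \<Rightarrow> 'o \<Rightarrow> 'm \<Rightarrow> 'm \<Rightarrow> bool" where
  "equivalence_relation C a r1 r2 \<longleftrightarrow>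
     r1 \<in> Ar C \<and> r2 \<in> Ar C \<and> Dom C r1 = Dom C r2 \<and> Cod C r1 = a \<and> Cod C r2 = a \<and>
     (\<forall>x. \<forall>g \<in> hom C x (Dom C r1). \<forall>h \<in> hom C x (Dom C r1).
        r1 \<cdot>\<^bsub>C\<^esub> g = r1 \<cdot>\<^bsub>C\<^esub> h \<and> r2 \<cdot>\<^bsub>C\<^esub> g = r2 \<cdot>\<^bsub>C\<^esub> h \<longrightarrow> g = h) \<and>
     (\<exists>d \<in> hom C a (Dom C r1). r1 \<cdot>\<^bsub>C\<^esub> d = Ide C a \<and> r2 \<cdot>\<^bsub>C\<^esub> d = Ide C a) \<and>
     (\<exists>s \<in> hom C (Dom C r1) (Dom C r1). r1 \<cdot>\<^bsub>C\<^esub> s = r2 \<and> r2 \<cdot>\<^bsub>C\<^esub> s = r1) \<and>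
     (\<forall>p q. pullback C r2 r1 p q \<longrightarrow>
        (\<exists>t \<in> hom C (Dom C p) (Dom C r1). r1 \<cdot>\<^bsub>C\<^esub> t = r1 \<cdot>\<^bsub>C\<^esub> p \<and> r2 \<cdot>\<^bsub>C\<^esub> t = r2 \<cdot>\<^bsub>C\<^esub> q))"

definition barr_exact :: "('o, 'm) cat \<Rightarrow> bool" where
  "barr_exact C \<longleftrightarrow> regular_cat C \<and>
     (\<forall>a r1 r2. equivalence_relation C a r1 r2 \<longrightarrow> (\<exists>f. kernel_pair C f r1 r2))"

definition split_ses :: "('o, 'm) cat \<Rightarrow> 'm \<Rightarrow> 'm \<Rightarrow> 'm \<Rightarrow> bool" where
  "split_ses C k f s \<longleftrightarrow>
     kernel C f k \<and> s \<in> hom C (Cod C f) (Dom C f) \<and> f \<cdot>\<^bsub>C\<^esub> s = Ide C (Cod C f)"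

text \<open>The split short five lemma: in a morphism \<open>(u, v, w)\<close> of split short exact sequences,
  \<open>v\<close> is an isomorphism as soon as \<open>u\<close> and \<open>w\<close> are.\<close>

definition protomodular :: "('o, 'm) cat \<Rightarrow> bool" where
  "protomodular C \<longleftrightarrow>
     (\<forall>k f s k' f' s' u v w.
        split_ses C k f s \<and> split_ses C k' f' s' \<and>
        u \<in> hom C (Dom C k) (Dom C k') \<and> v \<in> hom C (Dom C f) (Dom C f') \<and>
        w \<in> hom C (Cod C f) (Cod C f') \<and>
        v \<cdot>\<^bsub>C\<^esub> k = k' \<cdot>\<^bsub>C\<^esub> u \<and> w \<cdot>\<^bsub>C\<^esub> f = f' \<cdot>\<^bsub>C\<^esub> v \<and> v \<cdot>\<^bsub>C\<^esub> s = s' \<cdot>\<^bsub>C\<^esub> w \<and>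
        iso C u \<and> iso C w \<longrightarrow> iso C v)"

definition semi_abelian :: "('o, 'm) cat \<Rightarrow> bool" where
  "semi_abelian C \<longleftrightarrow> category C \<and> pointed C \<and> barr_exact C \<and> protomodular C \<and>
     (\<forall>a \<in> Ob C. \<forall>b \<in> Ob C. \<exists>i j. coproduct C a b i j)"

definition protoadditive :: "('o, 'm) cat \<Rightarrow> ('p, 'n) cat \<Rightarrow> ('o, 'm, 'p, 'n) func \<Rightarrow> bool" where
  "protoadditive C D F \<longleftrightarrow>
     (\<forall>k f s. split_ses C k f s \<longrightarrow> split_ses D (far F k) (far F f) (far F s))"


section \<open>Birkhoff subcategories, their reflector and radical, normal extensions\<close>

text \<open>A full subcategory is represented by its class \<open>S\<close> of objects;
  \<open>reflection_ar C S a e\<close> says that \<open>e\<close> is a universal arrow from \<open>a\<close> to it.\<close>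

definition reflection_ar :: "('o, 'm) cat \<Rightarrow> 'o set \<Rightarrow> 'o \<Rightarrow> 'm \<Rightarrow> bool" where
  "reflection_ar C S a e \<longleftrightarrow> e \<in> Ar C \<and> Dom C e = a \<and> Cod C e \<in> S \<and>
     (\<forall>h \<in> Ar C. Dom C h = a \<and> Cod C h \<in> S \<longrightarrow>
        (\<exists>!u. u \<in> hom C (Cod C e) (Cod C h) \<and> u \<cdot>\<^bsub>C\<^esub> e = h))"

definition birkhoff_subcategory :: "('o, 'm) cat \<Rightarrow> 'o set \<Rightarrow> bool" where
  "birkhoff_subcategory C S \<longleftrightarrow> S \<subseteq> Ob C \<and>
     (\<forall>f. iso C f \<and> Dom C f \<in> S \<longrightarrow> Cod C f \<in> S) \<and>
     (\<forall>a \<in> Ob C. \<exists>e. reflection_ar C S a e) \<and>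
     (\<forall>m. mono_ar C m \<and> Cod C m \<in> S \<longrightarrow> Dom C m \<in> S) \<and>
     (\<forall>q. regular_epi C q \<and> Dom C q \<in> S \<longrightarrow> Cod C q \<in> S)"

definition reflector ::
  "('o, 'm) cat \<Rightarrow> 'o set \<Rightarrow> ('o, 'm, 'o, 'm) func \<Rightarrow> ('o \<Rightarrow> 'm) \<Rightarrow> bool" where
  "reflector C S I \<eta> \<longleftrightarrow> is_functor C (full_sub C S) I \<and>
     (\<forall>a \<in> Ob C. reflection_ar C S a (\<eta> a) \<and> Cod C (\<eta> a) = fob I a) \<and>
     (\<forall>f \<in> Ar C. \<eta> (Cod C f) \<cdot>\<^bsub>C\<^esub> f = far I f \<cdot>\<^bsub>C\<^esub> \<eta> (Dom C f))"

text \<open>The radical \<open>R = [\<cdot>]\<close> is the kernel of the unit \<open>\<eta>\<close>, with inclusion \<open>\<kappa> a : R a \<rightarrow> a\<close>; naturality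
  of \<open>\<kappa>\<close> determines \<open>R\<close> on arrows.\<close>

definition radical ::
  "('o, 'm) cat \<Rightarrow> ('o \<Rightarrow> 'm) \<Rightarrow> ('o, 'm, 'o, 'm) func \<Rightarrow> ('o \<Rightarrow> 'm) \<Rightarrow> bool" where
  "radical C \<eta> R \<kappa> \<longleftrightarrow> is_functor C C R \<and>
     (\<forall>a \<in> Ob C. kernel C (\<eta> a) (\<kappa> a) \<and> Dom C (\<kappa> a) = fob R a) \<and>
     (\<forall>f \<in> Ar C. \<kappa> (Cod C f) \<cdot>\<^bsub>C\<^esub> far R f = f \<cdot>\<^bsub>C\<^esub> \<kappa> (Dom C f))"

definition normal_extension ::
  "('o, 'm) cat \<Rightarrow> ('o, 'm, 'o, 'm) func \<Rightarrow> ('o \<Rightarrow> 'm) \<Rightarrow> 'm \<Rightarrow> bool" where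
  "normal_extension C I \<eta> f \<longleftrightarrow> normal_epi C f \<and>
     (\<exists>p1 p2. kernel_pair C f p1 p2 \<and>
        pullback C (\<eta> (Dom C f)) (far I p1) p1 (\<eta> (Dom C p1)))"

definition normal_epi_cat :: "('o, 'm) cat \<Rightarrow> ('m, 'm \<times> ('m \<times> 'm) \<times> 'm) cat" where
  "normal_epi_cat C = full_sub (arrow_cat C) {f. normal_epi C f}"

end

theory Submission
  imports Defs
begin

text \<open>Everything is compared with one element-wise property: if \<open>(k, f, s)\<close> is a split short exact
  sequence and the unit kills \<open>k \<cdot> x\<close>, then it already kills \<open>x\<close>. Protoadditivity of the radical
  unwinds to this by diagram chasing. For the reflector one also needs that the kernel of \<open>I(f)\<close> is
  a regular quotient of \<open>K[f]\<close>; this holds because the comparison from the domain of \<open>f\<close> to the pullback of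
  \<open>I(f)\<close> along the unit is a regular epimorphism, by a form of the short five lemma.

  Given the property, applying \<open>I\<close> to the kernel pair of \<open>f\<close>, split by its diagonal, gives an equivalence
  relation with zero class \<open>[K[f]]\<close> (so this subobject is normal by exactness), and gives the pullback
  square of a normal extension when \<open>K[f]\<close> lies in \<open>B\<close>. Conversely, for a split epimorphism
  \<open>f\<close> the quotient \<open>A/[K[f]] \<rightarrow> B\<close> is a normal extension; embedding \<open>A/[K[f]]\<close> into its kernel pair
  by \<open>(s f, 1)\<close> and using the pullback square recovers the property.\<close>

section \<open>Pullbacks and regular epimorphisms\<close>

text \<open>A kernel of a kernel need not be a kernel: [K[f]] is normal in K[f] and K[f] is normal
  in A, yet [K[f]] may fail to be normal in A. Exactness is the way around this, since an
  equivalence relation is a kernel pair and the zero class of a kernel pair is a kernel. For the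
  relation used here, reflexivity and symmetry come from naturality of the unit alone. Transitivity
  is the delicate axiom: it needs the reflection of the object of composable pairs in R[f] to be
  separated by the reflections of its two projections, and this uses that \<open>I\<close> preserves
  split sequences.

  In the converse direction the property speaks of the unit at A, whereas the pullback square speaks
  of the unit at a kernel pair, so some arrow has to carry elements from one to the other. The pair
  (s f, 1) does this: its first component kills K[f], its second loses nothing.

  Conditions (3b) and (4b) meet at the normal epimorphisms with kernel in \<open>B\<close>: there
  the radical of the kernel is zero, so the candidate reflection of f is f itself.\<close>

context category
begin

section \<open>Composites, monomorphisms and pullbacks\<close>

lemma Cmp_Ar [simp]:
  assumes "f \<in> Ar C" "g \<in> Ar C" "Cod C f = Dom C g"
  shows "g \<cdot> f \<in> Ar C" "Dom C (g \<cdot> f) = Dom C f" "Cod C (g \<cdot> f) = Cod C g"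
  using Cmp_in[of f "Dom C f" "Cod C f" g "Cod C g"] assms by (auto simp: hom_def)

lemma Ide_Ar [simp]:
  assumes "a \<in> Ob C"
  shows "Ide C a \<in> Ar C" "Dom C (Ide C a) = a" "Cod C (Ide C a) = a"
  using Ide_in[OF assms] by (auto simp: hom_def)

lemma Dom_Cod_Ob [simp]:
  assumes "f \<in> Ar C"
  shows "Dom C f \<in> Ob C" "Cod C f \<in> Ob C"
  using assms Dom_in Cod_in by auto

lemma Cmp_Ide_simps [simp]:
  assumes "f \<in> Ar C"
  shows "Dom C f = a \<Longrightarrow> f \<cdot> Ide C a = f" "Cod C f = b \<Longrightarrow> Ide C b \<cdot> f = f"
  using Cmp_Ide[of f "Dom C f" "Cod C f"] Ide_Cmp[of f "Dom C f" "Cod C f"] assms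
  by (auto simp: hom_def)

lemma assoc [simp]:
  assumes "f \<in> Ar C" "g \<in> Ar C" "h \<in> Ar C" "Cod C f = Dom C g" "Cod C g = Dom C h"
  shows "(h \<cdot> g) \<cdot> f = h \<cdot> (g \<cdot> f)"
  using Cmp_assoc[of f "Dom C f" "Cod C f" g "Cod C g" h "Cod C h"] assms by (auto simp: hom_def)

text \<open>Simplification associates composites to the right, so a known value of
  \<open>h \<cdot> g\<close> no longer matches inside \<open>h \<cdot> (g \<cdot> f)\<close>; this
  rule restores it there.\<close>

lemma reassoc:
  assumes "h \<cdot> g = w" "f \<in> Ar C" "g \<in> Ar C" "h \<in> Ar C" "Cod C f = Dom C g" "Cod C g = Dom C h"
  shows "h \<cdot> (g \<cdot> f) = w \<cdot> f"
  using assms by auto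

lemma hom_iff: "f \<in> hom C a b \<longleftrightarrow> f \<in> Ar C \<and> Dom C f = a \<and> Cod C f = b"
  by (auto simp: hom_def)

lemma mono_arD:
  assumes "mono_ar C m"
  shows "m \<in> Ar C"
    and "\<lbrakk>g \<in> Ar C; h \<in> Ar C; Cod C g = Dom C m; Cod C h = Dom C m; m \<cdot> g = m \<cdot> h\<rbrakk> \<Longrightarrow> g = h"
proof -
  show m: "m \<in> Ar C" using assms by (simp add: mono_ar_def)
  assume gh: "g \<in> Ar C" "h \<in> Ar C" "Cod C g = Dom C m" "Cod C h = Dom C m" and e: "m \<cdot> g = m \<cdot> h"
  have "Dom C g = Dom C h" using gh m e Cmp_Ar(2) by metis
  then show "g = h"
    using assms[unfolded mono_ar_def, THEN conjunct2, rule_format, of g "Dom C g" h] gh e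
    by (simp add: hom_iff)
qed

lemma mono_arI:
  assumes "m \<in> Ar C"
    and "\<And>g h. \<lbrakk>g \<in> Ar C; h \<in> Ar C; Dom C g = Dom C h; Cod C g = Dom C m; Cod C h = Dom C m;
      m \<cdot> g = m \<cdot> h\<rbrakk> \<Longrightarrow> g = h"
  shows "mono_ar C m"
  unfolding mono_ar_def
proof (intro conjI allI ballI impI)
  fix x g h assume "g \<in> hom C x (Dom C m)" "h \<in> hom C x (Dom C m)" "m \<cdot> g = m \<cdot> h"
  then show "g = h" by - (rule assms(2), simp_all add: hom_iff)
qed (rule assms(1))

lemma pullbackD:
  assumes "pullback C f g p q"
  shows "f \<in> Ar C" "g \<in> Ar C" "Cod C g = Cod C f" "p \<in> Ar C" "q \<in> Ar C" "Dom C q = Dom C p"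
    "Cod C p = Dom C f" "Cod C q = Dom C g" "f \<cdot> p = g \<cdot> q"
  using assms by (simp_all add: pullback_def)

lemma pullback_lift:
  assumes "pullback C f g p q" "x \<in> Ar C" "y \<in> Ar C" "Dom C y = Dom C x"
    "Cod C x = Dom C f" "Cod C y = Dom C g" "f \<cdot> x = g \<cdot> y"
  obtains u where "u \<in> Ar C" "Dom C u = Dom C x" "Cod C u = Dom C p" "p \<cdot> u = x" "q \<cdot> u = y"
proof -
  have "x \<in> hom C (Dom C x) (Dom C f)" "y \<in> hom C (Dom C x) (Dom C g)"
    using assms(2-6) by (simp_all add: hom_iff)
  with assms(1,7) have "\<exists>!u. u \<in> hom C (Dom C x) (Dom C p) \<and> p \<cdot> u = x \<and> q \<cdot> u = y"
    unfolding pullback_def by blast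
  then show ?thesis using that by (auto simp: hom_iff)
qed

text \<open>No equality of domains is assumed: it can be read off from
  \<open>p \<cdot> u = p \<cdot> v\<close>, since a composite has the domain of its right
  factor.\<close>

lemma pullback_eqI:
  assumes P: "pullback C f g p q" and uv: "u \<in> Ar C" "v \<in> Ar C" "Cod C u = Dom C p" "Cod C v = Dom C p"
    and e: "p \<cdot> u = p \<cdot> v" "q \<cdot> u = q \<cdot> v"
  shows "u = v"
proof -
  note [simp] = pullbackD[OF P] uv
  have d: "Dom C u = Dom C v" using e uv Cmp_Ar(2) pullbackD(4)[OF P] by metis
  have "f \<cdot> (p \<cdot> v) = g \<cdot> (q \<cdot> v)" using reassoc[OF pullbackD(9)[OF P], of v] by simp
  moreover have "p \<cdot> v \<in> hom C (Dom C v) (Dom C f)" "q \<cdot> v \<in> hom C (Dom C v) (Dom C g)"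
    by (simp_all add: hom_iff)
  ultimately have "\<exists>!u. u \<in> hom C (Dom C v) (Dom C p) \<and> p \<cdot> u = p \<cdot> v \<and> q \<cdot> u = q \<cdot> v"
    using P unfolding pullback_def by blast
  moreover have "u \<in> hom C (Dom C v) (Dom C p)" "v \<in> hom C (Dom C v) (Dom C p)"
    using d by (simp_all add: hom_iff)
  ultimately show ?thesis using e by blast
qed

lemma pullbackI:
  assumes "f \<in> Ar C" "g \<in> Ar C" "Cod C g = Cod C f" "p \<in> Ar C" "q \<in> Ar C" "Dom C q = Dom C p"
    "Cod C p = Dom C f" "Cod C q = Dom C g" "f \<cdot> p = g \<cdot> q"
    and ex: "\<And>x y. \<lbrakk>x \<in> Ar C; y \<in> Ar C; Dom C y = Dom C x; Cod C x = Dom C f; Cod C y = Dom C g;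
      f \<cdot> x = g \<cdot> y\<rbrakk> \<Longrightarrow> \<exists>u \<in> Ar C. Dom C u = Dom C x \<and> Cod C u = Dom C p \<and> p \<cdot> u = x \<and> q \<cdot> u = y"
    and un: "\<And>u v. \<lbrakk>u \<in> Ar C; v \<in> Ar C; Dom C u = Dom C v; Cod C u = Dom C p; Cod C v = Dom C p;
      p \<cdot> u = p \<cdot> v; q \<cdot> u = q \<cdot> v\<rbrakk> \<Longrightarrow> u = v"
  shows "pullback C f g p q"
  unfolding pullback_def
proof (intro conjI allI ballI impI)
  fix w x y assume xy: "x \<in> hom C w (Dom C f)" "y \<in> hom C w (Dom C g)" and e: "f \<cdot> x = g \<cdot> y"
  from ex[OF _ _ _ _ _ e] xy obtain u where
    u: "u \<in> Ar C" "Dom C u = w" "Cod C u = Dom C p" "p \<cdot> u = x" "q \<cdot> u = y"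
    by (auto simp: hom_iff)
  show "\<exists>!u. u \<in> hom C w (Dom C p) \<and> p \<cdot> u = x \<and> q \<cdot> u = y"
  proof (rule ex1I[of _ u])
    fix v assume "v \<in> hom C w (Dom C p) \<and> p \<cdot> v = x \<and> q \<cdot> v = y"
    with u show "v = u" by - (rule un, auto simp: hom_iff)
  qed (use u in \<open>auto simp: hom_iff\<close>)
qed (use assms in auto)

lemma pullback_commute:
  assumes P: "pullback C f g p q"
  shows "pullback C g f q p"
proof (rule pullbackI)
  note [simp] = pullbackD[OF P]
  fix x y assume a: "x \<in> Ar C" "y \<in> Ar C" "Dom C y = Dom C x" "Cod C x = Dom C g"
    "Cod C y = Dom C f" "g \<cdot> x = f \<cdot> y"
  then have "Dom C x = Dom C y" "f \<cdot> y = g \<cdot> x" by simp_all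
  from pullback_lift[OF P a(2,1) this(1) a(5,4) this(2)]
  show "\<exists>u\<in>Ar C. Dom C u = Dom C x \<and> Cod C u = Dom C q \<and> q \<cdot> u = x \<and> p \<cdot> u = y"
    using a(3) by (metis pullbackD(6)[OF P])
next
  fix u v assume "u \<in> Ar C" "v \<in> Ar C" "Dom C u = Dom C v" "Cod C u = Dom C q" "Cod C v = Dom C q"
    "q \<cdot> u = q \<cdot> v" "p \<cdot> u = p \<cdot> v"
  then show "u = v" using pullback_eqI[OF P] pullbackD(6)[OF P] by simp
qed (simp_all add: pullbackD[OF P])

lemma isoE:
  assumes "iso C f"
  obtains g where "f \<in> Ar C" "g \<in> Ar C" "Dom C g = Cod C f" "Cod C g = Dom C f"
    "g \<cdot> f = Ide C (Dom C f)" "f \<cdot> g = Ide C (Cod C f)"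
  using assms unfolding iso_def by (auto simp: hom_iff)

lemma isoI:
  assumes "f \<in> Ar C" "g \<in> Ar C" "Dom C g = Cod C f" "Cod C g = Dom C f"
    "g \<cdot> f = Ide C (Dom C f)" "f \<cdot> g = Ide C (Cod C f)"
  shows "iso C f"
  using assms unfolding iso_def by (auto simp: hom_iff)

lemma iso_Ide [simp]: "a \<in> Ob C \<Longrightarrow> iso C (Ide C a)"
  by (rule isoI[of _ "Ide C a"]) auto

lemma iso_mono: assumes "iso C f" shows "mono_ar C f"
proof -
  from assms obtain g where g [simp]: "f \<in> Ar C" "g \<in> Ar C" "Dom C g = Cod C f" "Cod C g = Dom C f"
    and gf: "g \<cdot> f = Ide C (Dom C f)" by (rule isoE)
  show ?thesis
  proof (rule mono_arI)
    fix x y assume [simp]: "x \<in> Ar C" "y \<in> Ar C" "Cod C x = Dom C f" "Cod C y = Dom C f"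
      and e: "f \<cdot> x = f \<cdot> y"
    have "g \<cdot> (f \<cdot> x) = x" "g \<cdot> (f \<cdot> y) = y" using reassoc[OF gf, of x] reassoc[OF gf, of y] by simp_all
    then show "x = y" using e by metis
  qed simp
qed

lemma pullback_iso:
  assumes P: "pullback C f g p q" and w: "iso C w" "Cod C w = Dom C p"
  shows "pullback C f g (p \<cdot> w) (q \<cdot> w)"
proof -
  note [simp] = pullbackD[OF P] w(2)
  from w(1) obtain v where [simp]: "w \<in> Ar C" "v \<in> Ar C" "Dom C v = Cod C w" "Cod C v = Dom C w"
    and wv: "w \<cdot> v = Ide C (Cod C w)" by (rule isoE)
  note [simp] = wv[simplified]
  show ?thesis
  proof (rule pullbackI)
    show "f \<cdot> (p \<cdot> w) = g \<cdot> (q \<cdot> w)" using reassoc[OF pullbackD(9)[OF P], of w] by simp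
  next
    fix x y assume xy: "x \<in> Ar C" "y \<in> Ar C" "Dom C y = Dom C x" "Cod C x = Dom C f"
      "Cod C y = Dom C g" "f \<cdot> x = g \<cdot> y"
    from pullback_lift[OF P xy] obtain u where [simp]: "u \<in> Ar C" "Dom C u = Dom C x"
      "Cod C u = Dom C p" "p \<cdot> u = x" "q \<cdot> u = y" .
    have "w \<cdot> (v \<cdot> u) = u" using reassoc[OF wv, of u] by simp
    then show "\<exists>u\<in>Ar C. Dom C u = Dom C x \<and> Cod C u = Dom C (p \<cdot> w) \<and> (p \<cdot> w) \<cdot> u = x \<and> (q \<cdot> w) \<cdot> u = y"
      by (intro bexI[of _ "v \<cdot> u"]) simp_all
  next
    fix u u' assume [simp]: "u \<in> Ar C" "u' \<in> Ar C" "Cod C u = Dom C (p \<cdot> w)" "Cod C u' = Dom C (p \<cdot> w)"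
      and e: "(p \<cdot> w) \<cdot> u = (p \<cdot> w) \<cdot> u'" "(q \<cdot> w) \<cdot> u = (q \<cdot> w) \<cdot> u'"
    have "w \<cdot> u = w \<cdot> u'" using e by - (rule pullback_eqI[OF P], simp_all)
    then show "u = u'" by - (rule mono_arD(2)[OF iso_mono[OF w(1)]], simp_all)
  qed simp_all
qed

section \<open>Regular epimorphisms\<close>

lemma coequalizerD:
  assumes "coequalizer C f g q"
  shows "f \<in> Ar C" "g \<in> Ar C" "Dom C g = Dom C f" "Cod C g = Cod C f" "q \<in> Ar C"
    "Dom C q = Cod C f" "q \<cdot> f = q \<cdot> g"
  using assms by (simp_all add: coequalizer_def)

lemma coequalizer_desc:
  assumes "coequalizer C f g q" "h \<in> Ar C" "Dom C h = Cod C f" "h \<cdot> f = h \<cdot> g"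
  obtains u where "u \<in> Ar C" "Dom C u = Cod C q" "Cod C u = Cod C h" "u \<cdot> q = h"
proof -
  have "\<exists>!u. u \<in> hom C (Cod C q) (Cod C h) \<and> u \<cdot> q = h"
    using assms unfolding coequalizer_def by blast
  then show ?thesis using that by (auto simp: hom_iff)
qed

lemma regular_epi_Ar: "regular_epi C q \<Longrightarrow> q \<in> Ar C"
  by (auto simp: regular_epi_def coequalizer_def)

lemma regular_epi_cancel:
  assumes "regular_epi C q" "x \<in> Ar C" "y \<in> Ar C" "Dom C x = Cod C q" "Dom C y = Cod C q"
    "x \<cdot> q = y \<cdot> q"
  shows "x = y"
proof -
  from assms(1) obtain f g where ce: "coequalizer C f g q" by (auto simp: regular_epi_def)
  note [simp] = coequalizerD[OF ce] assms(2-5)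
  have "Cod C x = Cod C y" using assms(6) Cmp_Ar(3)[of q x] Cmp_Ar(3)[of q y] by simp
  moreover have "\<exists>!u. u \<in> hom C (Cod C q) (Cod C y) \<and> u \<cdot> q = y \<cdot> q"
  proof -
    have "\<forall>h \<in> Ar C. Dom C h = Cod C f \<and> h \<cdot> f = h \<cdot> g \<longrightarrow>
        (\<exists>!u. u \<in> hom C (Cod C q) (Cod C h) \<and> u \<cdot> q = h)"
      using ce by (simp add: coequalizer_def)
    from bspec[OF this, of "y \<cdot> q"] show ?thesis by simp
  qed
  moreover have "x \<in> hom C (Cod C q) (Cod C x)" "y \<in> hom C (Cod C q) (Cod C y)"
    by (simp_all add: hom_iff)
  ultimately show ?thesis using assms(6) by auto
qed

lemma regular_epi_iso_comp:
  assumes q: "regular_epi C q" and m: "iso C m" "Dom C m = Cod C q"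
  shows "regular_epi C (m \<cdot> q)"
proof -
  from q obtain f g where ce: "coequalizer C f g q" by (auto simp: regular_epi_def)
  note [simp] = coequalizerD[OF ce] m(2)
  from m(1) obtain n where n [simp]: "m \<in> Ar C" "n \<in> Ar C" "Dom C n = Cod C m" "Cod C n = Dom C m"
    and nm: "n \<cdot> m = Ide C (Dom C m)" and mn: "m \<cdot> n = Ide C (Cod C m)" by (rule isoE)
  note [simp] = nm[simplified] mn
  have "coequalizer C f g (m \<cdot> q)"
    unfolding coequalizer_def
  proof (intro conjI ballI impI)
    fix h assume h [simp]: "h \<in> Ar C" and "Dom C h = Cod C f \<and> h \<cdot> f = h \<cdot> g"
    then have dh [simp]: "Dom C h = Cod C f" and e: "h \<cdot> f = h \<cdot> g" by auto
    from coequalizer_desc[OF ce h dh e] obtain u where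
      [simp]: "u \<in> Ar C" "Dom C u = Cod C q" "Cod C u = Cod C h" "u \<cdot> q = h" .
    show "\<exists>!u. u \<in> hom C (Cod C (m \<cdot> q)) (Cod C h) \<and> u \<cdot> (m \<cdot> q) = h"
    proof (rule ex1I[of _ "u \<cdot> n"])
      have "n \<cdot> (m \<cdot> q) = q" using reassoc[OF nm, of q] by simp
      then show "u \<cdot> n \<in> hom C (Cod C (m \<cdot> q)) (Cod C h) \<and> (u \<cdot> n) \<cdot> (m \<cdot> q) = h"
        by (simp add: hom_iff)
    next
      fix v assume "v \<in> hom C (Cod C (m \<cdot> q)) (Cod C h) \<and> v \<cdot> (m \<cdot> q) = h"
      then have [simp]: "v \<in> Ar C" "Dom C v = Cod C m" and v: "v \<cdot> (m \<cdot> q) = h"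
        by (auto simp: hom_iff)
      have "v \<cdot> m = u" by (rule regular_epi_cancel[OF q]) (use v in simp_all)
      then have "(v \<cdot> m) \<cdot> n = u \<cdot> n" by simp
      then show "v = u \<cdot> n" by simp
    qed
  qed simp_all
  then show ?thesis by (auto simp: regular_epi_def)
qed

text \<open>Whatever pair \<open>m \<cdot> w\<close> coequalizes is already coequalized by
  \<open>w\<close>, because \<open>m\<close> is monic. So \<open>w\<close> factors through
  \<open>m \<cdot> w\<close>, and the factor inverts \<open>m\<close>.\<close>

lemma mono_regular_epi_iso:
  assumes m: "mono_ar C m" and r: "regular_epi C (m \<cdot> w)" and w: "w \<in> Ar C" "Cod C w = Dom C m"
  shows "iso C m"
proof -
  note [simp] = w mono_arD(1)[OF m]
  from r obtain f g where ce: "coequalizer C f g (m \<cdot> w)" by (auto simp: regular_epi_def)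
  note [simp] = coequalizerD(1-4)[OF ce] 
  have [simp]: "Dom C w = Cod C f" using coequalizerD(6)[OF ce] by simp
  have "w \<cdot> f = w \<cdot> g" by (rule mono_arD(2)[OF m]) (use coequalizerD(7)[OF ce] in simp_all)
  with coequalizer_desc[OF ce, of w] obtain u where
    [simp]: "u \<in> Ar C" "Dom C u = Cod C (m \<cdot> w)" "Cod C u = Cod C w" and u: "u \<cdot> (m \<cdot> w) = w" by auto
  have mu: "m \<cdot> u = Ide C (Cod C m)"
    by (rule regular_epi_cancel[OF r]) (use u in simp_all)
  have "u \<cdot> m = Ide C (Dom C m)"
    by (rule mono_arD(2)[OF m]) (use reassoc[OF mu, of m] in simp_all)
  with mu show ?thesis by (intro isoI[of m u]) simp_all
qed

text \<open>A split epimorphism is the coequalizer of the identity and the idempotent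
  \<open>s \<cdot> f\<close>.\<close>

lemma split_epi_regular:
  assumes [simp]: "f \<in> Ar C" "s \<in> Ar C" "Dom C s = Cod C f" "Cod C s = Dom C f"
    and fs: "f \<cdot> s = Ide C (Cod C f)"
  shows "regular_epi C f"
proof -
  note [simp] = fs
  have "coequalizer C (Ide C (Dom C f)) (s \<cdot> f) f"
    unfolding coequalizer_def
  proof (intro conjI ballI impI)
    show "f \<cdot> Ide C (Dom C f) = f \<cdot> (s \<cdot> f)" using reassoc[OF fs, of f] by simp
  next
    fix h assume [simp]: "h \<in> Ar C" and "Dom C h = Cod C (Ide C (Dom C f)) \<and> h \<cdot> Ide C (Dom C f) = h \<cdot> (s \<cdot> f)"
    then have [simp]: "Dom C h = Dom C f" and h: "h = h \<cdot> (s \<cdot> f)" by auto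
    show "\<exists>!u. u \<in> hom C (Cod C f) (Cod C h) \<and> u \<cdot> f = h"
    proof (rule ex1I[of _ "h \<cdot> s"])
      fix u assume "u \<in> hom C (Cod C f) (Cod C h) \<and> u \<cdot> f = h"
      then have [simp]: "u \<in> Ar C" "Dom C u = Cod C f" and u: "u \<cdot> f = h" by (auto simp: hom_iff)
      show "u = h \<cdot> s" using reassoc[OF u, of s] by simp
    qed (use h in \<open>simp add: hom_iff\<close>)
  qed simp_all
  then show ?thesis by (auto simp: regular_epi_def)
qed

end

section \<open>Kernels and split short exact sequences\<close>

locale semi_abelian_category = category C for C :: "('o, 'm) cat" (structure) +
  assumes semi_abelian: "semi_abelian C"
begin

definition zero_obj :: 'o where
  "zero_obj = (SOME z. zero_object C z)"

text \<open>The predicate \<open>zero_ar\<close> allows a factorization through any zero object.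
  Routing everything through one chosen zero object makes zero arrows terms, so that their equations
  can be used for rewriting.\<close>

definition zero :: "'o \<Rightarrow> 'o \<Rightarrow> 'm" where
  "zero a b = (THE h. h \<in> hom C zero_obj b) \<cdot> (THE g. g \<in> hom C a zero_obj)"

lemma zero_object_zero_obj: "zero_object C zero_obj"
  using semi_abelian unfolding semi_abelian_def pointed_def zero_obj_def by (auto intro: someI)

lemma zero_objectD:
  assumes "zero_object C z" "a \<in> Ob C"
  shows "z \<in> Ob C" "\<exists>!f. f \<in> hom C a z" "\<exists>!f. f \<in> hom C z a"
  using assms by (auto simp: zero_object_def initial_object_def terminal_object_def)

lemma zero_obj_Ob [simp]: "zero_obj \<in> Ob C"
  using zero_object_zero_obj by (auto simp: zero_object_def initial_object_def)

lemma zero_factor: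
  assumes "g \<in> hom C a zero_obj" "h \<in> hom C zero_obj b"
  shows "h \<cdot> g = zero a b"
proof -
  have ab: "a \<in> Ob C" "b \<in> Ob C" using assms by (auto simp: hom_iff)
  have "(THE h. h \<in> hom C zero_obj b) = h" "(THE g. g \<in> hom C a zero_obj) = g"
    using zero_objectD[OF zero_object_zero_obj] ab assms by (blast intro: the1_equality)+
  then show ?thesis by (simp add: zero_def)
qed

lemma zero_Ar [simp]:
  assumes "a \<in> Ob C" "b \<in> Ob C"
  shows "zero a b \<in> Ar C" "Dom C (zero a b) = a" "Cod C (zero a b) = b"
proof -
  from zero_objectD(2)[OF zero_object_zero_obj assms(1)] zero_objectD(3)[OF zero_object_zero_obj assms(2)]
  obtain g h where gh: "g \<in> hom C a zero_obj" "h \<in> hom C zero_obj b" by blast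
  then have "h \<cdot> g \<in> hom C a b" by (rule Cmp_in)
  then show "zero a b \<in> Ar C" "Dom C (zero a b) = a" "Cod C (zero a b) = b"
    unfolding zero_factor[OF gh] by (auto simp: hom_iff)
qed

text \<open>An arbitrary zero object \<open>z\<close> maps to the chosen one and back, and the round
  trip is the identity of \<open>z\<close> by uniqueness; inserting it reroutes any factorization
  through \<open>z\<close>.\<close>

lemma zero_ar_iff: "zero_ar C f \<longleftrightarrow> f \<in> Ar C \<and> f = zero (Dom C f) (Cod C f)"
proof
  assume "zero_ar C f"
  then obtain z g h where f: "f \<in> Ar C" "f = h \<cdot> g" and z: "zero_object C z"
    and g: "g \<in> hom C (Dom C f) z" and h: "h \<in> hom C z (Cod C f)"
    by (auto simp: zero_ar_def)
  have zO: "z \<in> Ob C" using z zero_objectD(1)[OF z zero_obj_Ob] by simp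
  obtain u where u: "u \<in> hom C z zero_obj" using zero_objectD(2)[OF zero_object_zero_obj zO] by blast
  obtain v where v: "v \<in> hom C zero_obj z" using zero_objectD(3)[OF zero_object_zero_obj zO] by blast
  have vu: "v \<cdot> u = Ide C z"
    using zero_objectD(2)[OF z zO] Cmp_in[OF u v] Ide_in[OF zO] by blast
  note [simp] = u[unfolded hom_iff] v[unfolded hom_iff] g[unfolded hom_iff] h[unfolded hom_iff]
  have "(h \<cdot> v) \<cdot> (u \<cdot> g) = zero (Dom C f) (Cod C f)"
    by (rule zero_factor) (rule Cmp_in, use u v g h in auto)+
  moreover have "(h \<cdot> v) \<cdot> (u \<cdot> g) = h \<cdot> g" using reassoc[OF vu, of g] by simp
  ultimately have "f = zero (Dom C f) (Cod C f)" using f(2) by metis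
  with f(1) show "f \<in> Ar C \<and> f = zero (Dom C f) (Cod C f)" by blast
next
  assume f: "f \<in> Ar C \<and> f = zero (Dom C f) (Cod C f)"
  then have "Dom C f \<in> Ob C" "Cod C f \<in> Ob C" by auto
  then obtain g h where gh: "g \<in> hom C (Dom C f) zero_obj" "h \<in> hom C zero_obj (Cod C f)"
    using zero_objectD(2,3)[OF zero_object_zero_obj] by blast
  with f zero_factor[OF gh] zero_object_zero_obj show "zero_ar C f"
    unfolding zero_ar_def by metis
qed

lemma zero_cmp [simp]:
  assumes "f \<in> Ar C"
  shows "\<lbrakk>a \<in> Ob C; Dom C f = b\<rbrakk> \<Longrightarrow> f \<cdot> zero a b = zero a (Cod C f)"
    and "\<lbrakk>c \<in> Ob C; Cod C f = b\<rbrakk> \<Longrightarrow> zero b c \<cdot> f = zero (Dom C f) c"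
proof -
  assume a: "a \<in> Ob C" "Dom C f = b"
  have "b \<in> Ob C" using assms a by auto
  from zero_objectD(2)[OF zero_object_zero_obj a(1)] zero_objectD(3)[OF zero_object_zero_obj this]
  obtain g h where gh: "g \<in> hom C a zero_obj" "h \<in> hom C zero_obj b" by blast
  have "f \<cdot> (h \<cdot> g) = (f \<cdot> h) \<cdot> g" using gh assms a by (auto simp: hom_iff)
  also have "\<dots> = zero a (Cod C f)" by (rule zero_factor) (use gh assms a in \<open>auto simp: hom_iff\<close>)
  finally show "f \<cdot> zero a b = zero a (Cod C f)" by (simp add: zero_factor[OF gh])
next
  assume a: "c \<in> Ob C" "Cod C f = b"
  have "b \<in> Ob C" using assms a by auto
  from zero_objectD(3)[OF zero_object_zero_obj a(1)] zero_objectD(2)[OF zero_object_zero_obj this]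
  obtain g h where gh: "g \<in> hom C b zero_obj" "h \<in> hom C zero_obj c" by blast
  have "(h \<cdot> g) \<cdot> f = h \<cdot> (g \<cdot> f)" using gh assms a by (auto simp: hom_iff)
  also have "\<dots> = zero (Dom C f) c" by (rule zero_factor) (use gh assms a in \<open>auto simp: hom_iff\<close>)
  finally show "zero b c \<cdot> f = zero (Dom C f) c" by (simp add: zero_factor[OF gh])
qed

lemma into_zero_obj:
  assumes "f \<in> Ar C" "g \<in> Ar C" "Dom C f = Dom C g" "Cod C f = zero_obj" "Cod C g = zero_obj"
  shows "f = g"
  using zero_objectD(2)[OF zero_object_zero_obj, of "Dom C g"] assms by (auto simp: hom_iff)

section \<open>Kernels and equalizers\<close>

lemma kernelD:
  assumes "kernel C f k"
  shows "f \<in> Ar C" "k \<in> Ar C" "Cod C k = Dom C f" "f \<cdot> k = zero (Dom C k) (Cod C f)"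
proof -
  show *: "f \<in> Ar C" "k \<in> Ar C" "Cod C k = Dom C f" using assms by (simp_all add: kernel_def)
  have "zero_ar C (f \<cdot> k)" using assms by (simp add: kernel_def)
  then show "f \<cdot> k = zero (Dom C k) (Cod C f)" using * by (simp add: zero_ar_iff)
qed

lemma kernel_ex1:
  assumes "kernel C f k" "h \<in> Ar C" "Cod C h = Dom C f" "f \<cdot> h = zero (Dom C h) (Cod C f)"
  shows "\<exists>!u. u \<in> hom C (Dom C h) (Dom C k) \<and> k \<cdot> u = h"
proof -
  note [simp] = kernelD[OF assms(1)] assms(2-4)
  have "zero_ar C (f \<cdot> h)" by (simp add: zero_ar_iff)
  then show ?thesis using assms unfolding kernel_def by blast
qed

lemma kernel_lift:
  assumes "kernel C f k" "h \<in> Ar C" "Cod C h = Dom C f" "f \<cdot> h = zero (Dom C h) (Cod C f)"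
  obtains u where "u \<in> Ar C" "Dom C u = Dom C h" "Cod C u = Dom C k" "k \<cdot> u = h"
proof -
  from kernel_ex1[OF assms] obtain u where "u \<in> hom C (Dom C h) (Dom C k)" "k \<cdot> u = h" by blast
  then show ?thesis by (intro that) (simp_all add: hom_iff)
qed

lemma kernel_mono: assumes K: "kernel C f k" shows "mono_ar C k"
proof (rule mono_arI)
  note [simp] = kernelD[OF K]
  fix g h assume gh [simp]: "g \<in> Ar C" "h \<in> Ar C" "Dom C g = Dom C h" "Cod C g = Dom C k"
    "Cod C h = Dom C k" and e: "k \<cdot> g = k \<cdot> h"
  have "f \<cdot> (k \<cdot> h) = zero (Dom C h) (Cod C f)" using reassoc[OF kernelD(4)[OF K], of h] by simp
  then have "\<exists>!u. u \<in> hom C (Dom C h) (Dom C k) \<and> k \<cdot> u = k \<cdot> h"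
    using kernel_ex1[OF K, of "k \<cdot> h"] by simp
  moreover have "g \<in> hom C (Dom C h) (Dom C k)" "h \<in> hom C (Dom C h) (Dom C k)"
    by (simp_all add: hom_iff)
  ultimately show "g = h" using e by blast
qed (rule kernelD(2)[OF K])

lemma kernel_cancel:
  assumes "kernel C f k" "g \<in> Ar C" "h \<in> Ar C" "Cod C g = Dom C k" "Cod C h = Dom C k" "k \<cdot> g = k \<cdot> h"
  shows "g = h"
  using mono_arD(2)[OF kernel_mono] assms by blast

lemma kernelI:
  assumes [simp]: "f \<in> Ar C" "k \<in> Ar C" "Cod C k = Dom C f" "f \<cdot> k = zero (Dom C k) (Cod C f)"
    and ex: "\<And>h. \<lbrakk>h \<in> Ar C; Cod C h = Dom C f; f \<cdot> h = zero (Dom C h) (Cod C f)\<rbrakk> \<Longrightarrow>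
      \<exists>u \<in> Ar C. Dom C u = Dom C h \<and> Cod C u = Dom C k \<and> k \<cdot> u = h"
    and m: "mono_ar C k"
  shows "kernel C f k"
  unfolding kernel_def
proof (intro conjI ballI impI)
  fix h assume "h \<in> Ar C" "Cod C h = Dom C f \<and> zero_ar C (f \<cdot> h)"
  then have [simp]: "h \<in> Ar C" "Cod C h = Dom C f" and z: "zero_ar C (f \<cdot> h)" by auto
  have "f \<cdot> h = zero (Dom C h) (Cod C f)" using z by (simp add: zero_ar_iff)
  then obtain u where u [simp]: "u \<in> Ar C" "Dom C u = Dom C h" "Cod C u = Dom C k" and ku: "k \<cdot> u = h"
    using ex[of h] by auto
  show "\<exists>!u. u \<in> hom C (Dom C h) (Dom C k) \<and> k \<cdot> u = h"
  proof (rule ex1I[of _ u])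
    fix v assume "v \<in> hom C (Dom C h) (Dom C k) \<and> k \<cdot> v = h"
    then show "v = u" using mono_arD(2)[OF m, of v u] ku by (simp add: hom_iff)
  qed (simp add: hom_iff ku)
qed (simp_all add: zero_ar_iff)

lemma kernel_iso:
  assumes K: "kernel C f k" and u: "iso C u" "Cod C u = Dom C k"
  shows "kernel C f (k \<cdot> u)"
proof -
  note [simp] = kernelD[OF K] u(2)
  from u(1) obtain v where [simp]: "u \<in> Ar C" "v \<in> Ar C" "Dom C v = Cod C u" "Cod C v = Dom C u"
    and vu: "v \<cdot> u = Ide C (Dom C u)" and uv: "u \<cdot> v = Ide C (Cod C u)" by (rule isoE)
  show ?thesis
  proof (rule kernelI)
    show "f \<cdot> (k \<cdot> u) = zero (Dom C (k \<cdot> u)) (Cod C f)" using reassoc[OF kernelD(4)[OF K], of u] by simp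
  next
    fix h assume [simp]: "h \<in> Ar C" "Cod C h = Dom C f" "f \<cdot> h = zero (Dom C h) (Cod C f)"
    obtain t where [simp]: "t \<in> Ar C" "Dom C t = Dom C h" "Cod C t = Dom C k" and t: "k \<cdot> t = h"
      by (rule kernel_lift[OF K, of h]) auto
    show "\<exists>t \<in> Ar C. Dom C t = Dom C h \<and> Cod C t = Dom C (k \<cdot> u) \<and> (k \<cdot> u) \<cdot> t = h"
      using reassoc[OF uv, of t] t by (intro bexI[of _ "v \<cdot> t"]) simp_all
  next
    show "mono_ar C (k \<cdot> u)"
    proof (rule mono_arI)
      fix x y assume [simp]: "x \<in> Ar C" "y \<in> Ar C"
        and "Cod C x = Dom C (k \<cdot> u)" "Cod C y = Dom C (k \<cdot> u)" and e: "(k \<cdot> u) \<cdot> x = (k \<cdot> u) \<cdot> y"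
      then have [simp]: "Cod C x = Dom C u" "Cod C y = Dom C u" by simp_all
      have "u \<cdot> x = u \<cdot> y" by (rule kernel_cancel[OF K]) (use e in simp_all)
      then show "x = y" by - (rule mono_arD(2)[OF iso_mono[OF u(1)]], simp_all)
    qed simp
  qed simp_all
qed

lemma pullback_ex:
  assumes "f \<in> Ar C" "g \<in> Ar C" "Cod C f = Cod C g"
  obtains p q where "pullback C f g p q"
  using semi_abelian assms
  unfolding semi_abelian_def barr_exact_def regular_cat_def finitely_complete_def by blast

lemma regular_epi_pullback:
  assumes "pullback C f g p q"
  shows "regular_epi C f \<Longrightarrow> regular_epi C q" "regular_epi C g \<Longrightarrow> regular_epi C p"
  using semi_abelian assms pullback_commute[OF assms]
  unfolding semi_abelian_def barr_exact_def regular_cat_def by blast+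

text \<open>The kernel is the pullback of \<open>f\<close> along the zero arrow out of the zero
  object.\<close>

lemma kernel_ex:
  assumes [simp]: "f \<in> Ar C"
  obtains k where "kernel C f k"
proof -
  obtain k q where P: "pullback C f (zero zero_obj (Cod C f)) k q"
    by (rule pullback_ex[of f "zero zero_obj (Cod C f)"]) auto
  note [simp] = pullbackD[OF P]
  have q [simp]: "Cod C q = zero_obj" using pullbackD(8)[OF P] by simp
  have "kernel C f k"
  proof (rule kernelI)
    fix h assume [simp]: "h \<in> Ar C" "Cod C h = Dom C f" "f \<cdot> h = zero (Dom C h) (Cod C f)"
    obtain u where "u \<in> Ar C" "Dom C u = Dom C h" "Cod C u = Dom C k" "k \<cdot> u = h"
      by (rule pullback_lift[OF P, of h "zero (Dom C h) zero_obj"]) auto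
    then show "\<exists>u\<in>Ar C. Dom C u = Dom C h \<and> Cod C u = Dom C k \<and> k \<cdot> u = h" by blast
  next
    show "mono_ar C k"
    proof (rule mono_arI)
      fix u v assume [simp]: "u \<in> Ar C" "v \<in> Ar C" "Dom C u = Dom C v" "Cod C u = Dom C k" "Cod C v = Dom C k"
        and e: "k \<cdot> u = k \<cdot> v"
      have "q \<cdot> u = q \<cdot> v" by (rule into_zero_obj) simp_all
      with e show "u = v" by - (rule pullback_eqI[OF P], simp_all)
    qed simp
  qed simp_all
  then show ?thesis by (rule that)
qed

text \<open>Products are pullbacks over the zero object, which is terminal. The equalizer is then
  the pullback of the arrow \<open>(x, y)\<close> into the product along the diagonal
  \<open>dl\<close>.\<close>

lemma equalizer_ex:
  assumes [simp]: "x \<in> Ar C" "y \<in> Ar C" "Dom C y = Dom C x" "Cod C y = Cod C x"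
  obtains e where "mono_ar C e" "Cod C e = Dom C x" "x \<cdot> e = y \<cdot> e"
    "\<And>h. \<lbrakk>h \<in> Ar C; Cod C h = Dom C x; x \<cdot> h = y \<cdot> h\<rbrakk> \<Longrightarrow>
      \<exists>u \<in> Ar C. Dom C u = Dom C h \<and> Cod C u = Dom C e \<and> e \<cdot> u = h"
proof -
  let ?z = "zero (Cod C x) zero_obj"
  obtain p q where P: "pullback C ?z ?z p q" by (rule pullback_ex[of ?z ?z]) auto
  note [simp] = pullbackD(4-6)[OF P]
  have [simp]: "Cod C p = Cod C x" "Cod C q = Cod C x" using pullbackD(7,8)[OF P] by simp_all
  obtain xy where [simp]: "xy \<in> Ar C" "Dom C xy = Dom C x" "Cod C xy = Dom C p"
    and xy: "p \<cdot> xy = x" "q \<cdot> xy = y"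
    by (rule pullback_lift[OF P, of x y]) auto
  obtain dl where [simp]: "dl \<in> Ar C" "Dom C dl = Cod C x" "Cod C dl = Dom C p"
    and dl: "p \<cdot> dl = Ide C (Cod C x)" "q \<cdot> dl = Ide C (Cod C x)"
    by (rule pullback_lift[OF P, of "Ide C (Cod C x)" "Ide C (Cod C x)"]) auto
  note [simp] = xy dl reassoc[OF xy(1)] reassoc[OF xy(2)] reassoc[OF dl(1)] reassoc[OF dl(2)]
  obtain e d where Q: "pullback C xy dl e d" by (rule pullback_ex[of xy dl]) auto
  note [simp] = pullbackD(4-6)[OF Q]
  have [simp]: "Cod C e = Dom C x" "Cod C d = Cod C x" using pullbackD(7,8)[OF Q] by simp_all
  have "p \<cdot> (xy \<cdot> e) = p \<cdot> (dl \<cdot> d)" "q \<cdot> (xy \<cdot> e) = q \<cdot> (dl \<cdot> d)" using pullbackD(9)[OF Q] by simp_all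
  then have xe: "x \<cdot> e = d" "y \<cdot> e = d" by simp_all
  show ?thesis
  proof (rule that)
    show "mono_ar C e"
    proof (rule mono_arI)
      fix u v assume [simp]: "u \<in> Ar C" "v \<in> Ar C" "Dom C u = Dom C v" "Cod C u = Dom C e" "Cod C v = Dom C e"
        and e: "e \<cdot> u = e \<cdot> v"
      have "x \<cdot> (e \<cdot> u) = x \<cdot> (e \<cdot> v)" using e by simp
      then have "d \<cdot> u = d \<cdot> v" using reassoc[OF xe(1), of u] reassoc[OF xe(1), of v] by simp
      with e show "u = v" by - (rule pullback_eqI[OF Q], simp_all)
    qed simp
    show "x \<cdot> e = y \<cdot> e" using xe by simp
    fix h assume [simp]: "h \<in> Ar C" "Cod C h = Dom C x" and e: "x \<cdot> h = y \<cdot> h"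
    have "xy \<cdot> h = dl \<cdot> (x \<cdot> h)" by (rule pullback_eqI[OF P]) (use e in simp_all)
    then obtain u where "u \<in> Ar C" "Dom C u = Dom C h" "Cod C u = Dom C e" "e \<cdot> u = h"
      by - (rule pullback_lift[OF Q, of h "x \<cdot> h"], auto)
    then show "\<exists>u \<in> Ar C. Dom C u = Dom C h \<and> Cod C u = Dom C e \<and> e \<cdot> u = h" by blast
  qed simp
qed

section \<open>Consequences of the split short five lemma\<close>

lemma split_sesD:
  assumes "split_ses C k f s"
  shows "kernel C f k" "f \<in> Ar C" "k \<in> Ar C" "s \<in> Ar C" "Cod C k = Dom C f" "Dom C s = Cod C f"
    "Cod C s = Dom C f" "f \<cdot> s = Ide C (Cod C f)" "f \<cdot> k = zero (Dom C k) (Cod C f)"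
  using assms kernelD[of f k] by (auto simp: split_ses_def hom_iff)

lemma split_short_five:
  assumes "split_ses C k f s" "split_ses C k' f' s'"
    and "v \<in> Ar C" "Dom C v = Dom C f" "Cod C v = Dom C f'"
    and "v \<cdot> k = k' \<cdot> u" "w \<cdot> f = f' \<cdot> v" "v \<cdot> s = s' \<cdot> w"
    and "iso C u" "Dom C u = Dom C k" "Cod C u = Dom C k'"
    and "iso C w" "Dom C w = Cod C f" "Cod C w = Cod C f'"
  shows "iso C v"
proof -
  have "u \<in> Ar C" "w \<in> Ar C" using assms by (auto elim: isoE)
  then have "u \<in> hom C (Dom C k) (Dom C k')" "v \<in> hom C (Dom C f) (Dom C f')"
    "w \<in> hom C (Cod C f) (Cod C f')" using assms by (simp_all add: hom_iff)
  moreover have "protomodular C" using semi_abelian by (simp add: semi_abelian_def)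
  ultimately show ?thesis using assms unfolding protomodular_def by blast
qed

text \<open>Both \<open>k\<close> and \<open>s\<close> factor through the equalizer \<open>i\<close>
  of \<open>x\<close> and \<open>y\<close>. Restricting the sequence to that equalizer leaves the
  two ends unchanged, so the split short five lemma makes \<open>i\<close> invertible.\<close>

lemma split_ses_jointly_epic:
  assumes S: "split_ses C k f s" and xy [simp]: "x \<in> Ar C" "y \<in> Ar C" "Dom C x = Dom C f" "Dom C y = Dom C f"
    and cod: "Cod C y = Cod C x" and e: "x \<cdot> k = y \<cdot> k" "x \<cdot> s = y \<cdot> s"
  shows "x = y"
proof -
  note [simp] = split_sesD[OF S]
  obtain i where i: "mono_ar C i" "Cod C i = Dom C x" "x \<cdot> i = y \<cdot> i" and
    fac: "\<And>h. \<lbrakk>h \<in> Ar C; Cod C h = Dom C x; x \<cdot> h = y \<cdot> h\<rbrakk> \<Longrightarrow>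
      \<exists>u \<in> Ar C. Dom C u = Dom C h \<and> Cod C u = Dom C i \<and> i \<cdot> u = h"
    by (rule equalizer_ex[of x y]) (use cod in simp_all)
  note [simp] = mono_arD(1)[OF i(1)]
  have [simp]: "Cod C i = Dom C f" using i(2) by simp
  obtain k' where [simp]: "k' \<in> Ar C" "Dom C k' = Dom C k" "Cod C k' = Dom C i" and k': "i \<cdot> k' = k"
    using fac[of k] e by auto
  obtain s' where [simp]: "s' \<in> Ar C" "Dom C s' = Dom C s" "Cod C s' = Dom C i" and s': "i \<cdot> s' = s"
    using fac[of s] e by auto
  note [simp] = k' s'
  have "kernel C (f \<cdot> i) k'"
  proof (rule kernelI)
    fix h assume [simp]: "h \<in> Ar C" and "Cod C h = Dom C (f \<cdot> i)" and z: "(f \<cdot> i) \<cdot> h = zero (Dom C h) (Cod C (f \<cdot> i))"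
    then have [simp]: "Cod C h = Dom C i" by simp
    obtain u where [simp]: "u \<in> Ar C" "Dom C u = Dom C h" "Cod C u = Dom C k" and u: "k \<cdot> u = i \<cdot> h"
      by (rule kernel_lift[OF split_sesD(1)[OF S], of "i \<cdot> h"]) (use z in simp_all)
    have "k' \<cdot> u = h" by (rule mono_arD(2)[OF i(1)]) (use u reassoc[OF k', of u] in simp_all)
    then show "\<exists>u\<in>Ar C. Dom C u = Dom C h \<and> Cod C u = Dom C k' \<and> k' \<cdot> u = h" by (intro bexI[of _ u]) simp_all
  next
    show "mono_ar C k'"
    proof (rule mono_arI)
      fix u v assume [simp]: "u \<in> Ar C" "v \<in> Ar C" "Dom C u = Dom C v" "Cod C u = Dom C k'" "Cod C v = Dom C k'"
        and "k' \<cdot> u = k' \<cdot> v"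
      then have "i \<cdot> (k' \<cdot> u) = i \<cdot> (k' \<cdot> v)" by simp
      then have "k \<cdot> u = k \<cdot> v" using reassoc[OF k', of u] reassoc[OF k', of v] by simp
      then show "u = v" by - (rule kernel_cancel[OF split_sesD(1)[OF S]], simp_all)
    qed simp
  qed simp_all
  then have S': "split_ses C k' (f \<cdot> i) s'" by (simp add: split_ses_def hom_iff)
  have "iso C i"
    by (rule split_short_five[OF S' S, where u = "Ide C (Dom C k)" and w = "Ide C (Cod C f)"]) simp_all
  then obtain j where [simp]: "j \<in> Ar C" "Dom C j = Cod C i" "Cod C j = Dom C i" and ij: "i \<cdot> j = Ide C (Cod C i)"
    by (rule isoE)
  have "(x \<cdot> i) \<cdot> j = (y \<cdot> i) \<cdot> j" using i(3) by simp
  then show ?thesis using ij by simp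
qed

text \<open>The diagonal splits the first projection, and the kernel of that projection is the pair
  (0, k), a copy of K[f]. This is how a split short exact sequence is attached to an
  \<open>f\<close> that need not be split.\<close>

lemma split_kernel_pair:
  assumes KP: "kernel_pair C f p1 p2" and K: "kernel C f k"
  obtains j d where "split_ses C j p1 d" "p2 \<cdot> d = Ide C (Dom C f)" "p2 \<cdot> j = k" "Dom C j = Dom C k"
proof -
  have P: "pullback C f f p1 p2" using KP by (simp add: kernel_pair_def)
  note [simp] = pullbackD(1,4-8)[OF P] kernelD[OF K]
  obtain d where [simp]: "d \<in> Ar C" "Dom C d = Dom C f" "Cod C d = Dom C p1" and d: "p1 \<cdot> d = Ide C (Dom C f)" "p2 \<cdot> d = Ide C (Dom C f)"
    by (rule pullback_lift[OF P, of "Ide C (Dom C f)" "Ide C (Dom C f)"]) auto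
  obtain j where [simp]: "j \<in> Ar C" "Dom C j = Dom C k" "Cod C j = Dom C p1" and j: "p1 \<cdot> j = zero (Dom C k) (Dom C f)" "p2 \<cdot> j = k"
    by (rule pullback_lift[OF P, of "zero (Dom C k) (Dom C f)" k]) auto
  have "kernel C p1 j"
  proof (rule kernelI)
    fix h assume [simp]: "h \<in> Ar C" "Cod C h = Dom C p1" and z: "p1 \<cdot> h = zero (Dom C h) (Cod C p1)"
    have "f \<cdot> (p2 \<cdot> h) = zero (Dom C h) (Cod C f)"
      using reassoc[OF pullbackD(9)[OF P], of h] z by simp
    then obtain u where [simp]: "u \<in> Ar C" "Dom C u = Dom C h" "Cod C u = Dom C k" and u: "k \<cdot> u = p2 \<cdot> h"
      by - (rule kernel_lift[OF K, of "p2 \<cdot> h"], simp_all)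
    have "j \<cdot> u = h"
      by (rule pullback_eqI[OF P]) (use u z reassoc[OF j(1), of u] reassoc[OF j(2), of u] in simp_all)
    then show "\<exists>u\<in>Ar C. Dom C u = Dom C h \<and> Cod C u = Dom C j \<and> j \<cdot> u = h" by (intro bexI[of _ u]) simp_all
  next
    show "mono_ar C j"
    proof (rule mono_arI)
      fix u v assume [simp]: "u \<in> Ar C" "v \<in> Ar C" "Dom C u = Dom C v" "Cod C u = Dom C j" "Cod C v = Dom C j"
        and "j \<cdot> u = j \<cdot> v"
      then have "p2 \<cdot> (j \<cdot> u) = p2 \<cdot> (j \<cdot> v)" by simp
      then have "k \<cdot> u = k \<cdot> v" using reassoc[OF j(2), of u] reassoc[OF j(2), of v] by simp
      then show "u = v" by - (rule kernel_cancel[OF K], simp_all)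
    qed simp
  qed (simp_all add: j)
  then have "split_ses C j p1 d" by (simp add: split_ses_def hom_iff d)
  then show ?thesis using d j by - (rule that[of j d], simp_all)
qed

text \<open>The two projections of the kernel pair of \<open>m\<close> agree on the diagonal. On the
  kernel (0, k) of the first one they agree as well, because k is zero. Since the diagonal and this
  kernel are jointly epic, the projections coincide.\<close>

lemma trivial_kernel_mono:
  assumes [simp]: "m \<in> Ar C"
    and triv: "\<And>x. \<lbrakk>x \<in> Ar C; Cod C x = Dom C m; m \<cdot> x = zero (Dom C x) (Cod C m)\<rbrakk> \<Longrightarrow>
      x = zero (Dom C x) (Dom C m)"
  shows "mono_ar C m"
proof -
  obtain p1 p2 where P: "pullback C m m p1 p2" by (rule pullback_ex[of m m]) auto
  note [simp] = pullbackD(4-8)[OF P]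
  obtain k where K: "kernel C m k" by (rule kernel_ex[of m]) simp
  note [simp] = kernelD(2,3)[OF K]
  obtain j d where S: "split_ses C j p1 d" and jd: "p2 \<cdot> d = Ide C (Dom C m)" "p2 \<cdot> j = k" "Dom C j = Dom C k"
    by (rule split_kernel_pair[OF _ K]) (use P in \<open>simp add: kernel_pair_def\<close>)
  note [simp] = split_sesD[OF S]
  have "k = zero (Dom C k) (Dom C m)" by (rule triv) (simp_all add: kernelD[OF K])
  then have eq: "p1 = p2" by - (rule split_ses_jointly_epic[OF S], simp_all add: jd)
  show ?thesis
  proof (rule mono_arI)
    fix u v assume [simp]: "u \<in> Ar C" "v \<in> Ar C" "Dom C u = Dom C v" "Cod C u = Dom C m" "Cod C v = Dom C m"
      and e: "m \<cdot> u = m \<cdot> v"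
    obtain t where "p1 \<cdot> t = u" "p2 \<cdot> t = v" by (rule pullback_lift[OF P, of u v]) (use e in simp_all)
    with eq show "u = v" by simp
  qed simp
qed

text \<open>This is the criterion for a single arrow, applied to \<open>(a, b)\<close> into the
  product of the two codomains.\<close>

lemma trivial_kernels_jointly_monic:
  assumes [simp]: "a \<in> Ar C" "b \<in> Ar C" "Dom C b = Dom C a"
    and triv: "\<And>x. \<lbrakk>x \<in> Ar C; Cod C x = Dom C a; a \<cdot> x = zero (Dom C x) (Cod C a);
      b \<cdot> x = zero (Dom C x) (Cod C b)\<rbrakk> \<Longrightarrow> x = zero (Dom C x) (Dom C a)"
    and [simp]: "u \<in> Ar C" "v \<in> Ar C" "Cod C u = Dom C a" "Cod C v = Dom C a"
    and e: "a \<cdot> u = a \<cdot> v" "b \<cdot> u = b \<cdot> v"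
  shows "u = v"
proof -
  obtain p q where P: "pullback C (zero (Cod C a) zero_obj) (zero (Cod C b) zero_obj) p q"
    by (rule pullback_ex[of "zero (Cod C a) zero_obj" "zero (Cod C b) zero_obj"]) auto
  note [simp] = pullbackD(4-6)[OF P]
  have [simp]: "Cod C p = Cod C a" "Cod C q = Cod C b" using pullbackD(7,8)[OF P] by simp_all
  obtain m where [simp]: "m \<in> Ar C" "Dom C m = Dom C a" "Cod C m = Dom C p"
    and m: "p \<cdot> m = a" "q \<cdot> m = b"
    by (rule pullback_lift[OF P, of a b]) auto
  note [simp] = m reassoc[OF m(1)] reassoc[OF m(2)]
  have "mono_ar C m"
  proof (rule trivial_kernel_mono)
    fix x assume [simp]: "x \<in> Ar C" "Cod C x = Dom C m" and z: "m \<cdot> x = zero (Dom C x) (Cod C m)"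
    have "p \<cdot> (m \<cdot> x) = p \<cdot> zero (Dom C x) (Cod C m)" "q \<cdot> (m \<cdot> x) = q \<cdot> zero (Dom C x) (Cod C m)"
      using z by simp_all
    then show "x = zero (Dom C x) (Dom C m)" using triv[of x] by simp
  qed simp
  moreover have "m \<cdot> u = m \<cdot> v" by (rule pullback_eqI[OF P]) (use e in simp_all)
  ultimately show ?thesis by - (rule mono_arD(2), simp_all)
qed

end

section \<open>Images and normal epimorphisms\<close>

context semi_abelian_category
begin

lemma kernel_pair_coequalizer:
  assumes "kernel_pair C f p q"
  obtains e where "coequalizer C p q e"
  using semi_abelian assms unfolding semi_abelian_def barr_exact_def regular_cat_def by blast

text \<open>The regular part is the coequalizer of the kernel pair of \<open>w\<close>; that the
  rest is monic is checked on elements of its kernel.\<close>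

lemma image_factorization:
  assumes [simp]: "w \<in> Ar C"
  obtains e m where "regular_epi C e" "mono_ar C m" "Dom C e = Dom C w" "Cod C m = Cod C w"
    "Cod C e = Dom C m" "m \<cdot> e = w"
proof -
  obtain p1 p2 where P: "pullback C w w p1 p2" by (rule pullback_ex[of w w]) auto
  note [simp] = pullbackD(4-8)[OF P]
  obtain e where ce: "coequalizer C p1 p2 e"
    by (rule kernel_pair_coequalizer[of w p1 p2]) (use P in \<open>simp add: kernel_pair_def\<close>)
  note [simp] = coequalizerD(5)[OF ce]
  have [simp]: "Dom C e = Dom C w" using coequalizerD(6)[OF ce] by simp
  have e: "regular_epi C e" using ce by (auto simp: regular_epi_def)
  obtain m where [simp]: "m \<in> Ar C" "Dom C m = Cod C e" "Cod C m = Cod C w" and me: "m \<cdot> e = w"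
    by (rule coequalizer_desc[OF ce, of w]) (use pullbackD(9)[OF P] in simp_all)
  have "mono_ar C m"
  proof (rule trivial_kernel_mono)
    fix x assume [simp]: "x \<in> Ar C" "Cod C x = Dom C m" and z: "m \<cdot> x = zero (Dom C x) (Cod C m)"
    \<comment> \<open>The element \<open>x\<close> need not lift along \<open>e\<close>; it does so
      over the cover \<open>e'\<close>, which can be cancelled in the end because it is a regular
      epimorphism.\<close>
    obtain e' x' where Q: "pullback C x e e' x'" by (rule pullback_ex[of x e]) auto
    note [simp] = pullbackD(4-6)[OF Q]
    have [simp]: "Cod C e' = Dom C x" "Cod C x' = Dom C w" using pullbackD(7,8)[OF Q] by simp_all
    have e': "regular_epi C e'" using regular_epi_pullback(2)[OF Q e] .
    have "w \<cdot> x' = m \<cdot> (x \<cdot> e')" using reassoc[OF me, of x'] pullbackD(9)[OF Q] by simp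
    also have "\<dots> = zero (Dom C e') (Cod C w)" using reassoc[OF z, of e'] by simp
    finally have wx: "w \<cdot> x' = zero (Dom C e') (Cod C w)" .
    \<comment> \<open>Since \<open>w\<close> kills \<open>x'\<close>, the pair (x', 0) lies in the
      kernel pair of \<open>w\<close>, so \<open>e\<close> does not distinguish \<open>x'\<close>
      from zero.\<close>
    obtain t where [simp]: "t \<in> Ar C" "Dom C t = Dom C e'" "Cod C t = Dom C p1" and
      t: "p1 \<cdot> t = x'" "p2 \<cdot> t = zero (Dom C e') (Dom C w)"
      by (rule pullback_lift[OF P, of x' "zero (Dom C e') (Dom C w)"]) (use wx in simp_all)
    have "e \<cdot> (p1 \<cdot> t) = e \<cdot> (p2 \<cdot> t)" using reassoc[OF coequalizerD(7)[OF ce], of t] by simp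
    then have "x \<cdot> e' = zero (Dom C x) (Dom C m) \<cdot> e'"
      using t pullbackD(9)[OF Q] by simp
    then show "x = zero (Dom C x) (Dom C m)" by - (rule regular_epi_cancel[OF e'], simp_all)
  qed simp
  with e show ?thesis by (rule that) (simp_all add: me)
qed

text \<open>An arrow killing the kernel of \<open>e\<close> identifies the two projections of the
  kernel pair of \<open>e\<close>, because it does so on the diagonal and on (0, k). The pair
  coequalized by \<open>e\<close> factors through that kernel pair, so \<open>h\<close> coequalizes
  it too.\<close>

lemma regular_epi_desc:
  assumes e: "regular_epi C e" and K: "kernel C e k"
    and h [simp]: "h \<in> Ar C" "Dom C h = Dom C e" and hk: "h \<cdot> k = zero (Dom C k) (Cod C h)"
  obtains u where "u \<in> Ar C" "Dom C u = Cod C e" "Cod C u = Cod C h" "u \<cdot> e = h"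
proof -
  note [simp] = kernelD[OF K]
  from e obtain f g where ce: "coequalizer C f g e" by (auto simp: regular_epi_def)
  note [simp] = coequalizerD(1-3)[OF ce]
  have [simp]: "Cod C f = Dom C e" "Cod C g = Dom C e" using coequalizerD(4,6)[OF ce] by simp_all
  obtain p1 p2 where P: "pullback C e e p1 p2" by (rule pullback_ex[of e e]) auto
  note [simp] = pullbackD(4-8)[OF P]
  obtain j d where S: "split_ses C j p1 d" and jd: "p2 \<cdot> d = Ide C (Dom C e)" "p2 \<cdot> j = k" "Dom C j = Dom C k"
    by (rule split_kernel_pair[OF _ K]) (use P in \<open>simp add: kernel_pair_def\<close>)
  note [simp] = split_sesD[OF S]
  have "h \<cdot> p1 = h \<cdot> p2"
    by (rule split_ses_jointly_epic[OF S]) (simp_all add: jd hk)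
  moreover obtain t where [simp]: "t \<in> Ar C" "Dom C t = Dom C f" "Cod C t = Dom C p1"
    and t: "p1 \<cdot> t = f" "p2 \<cdot> t = g"
    by (rule pullback_lift[OF P, of f g]) (use coequalizerD(7)[OF ce] in simp_all)
  ultimately have "h \<cdot> f = h \<cdot> g"
    using reassoc[of h p1 "h \<cdot> p2" t] by simp
  then show ?thesis using that by - (rule coequalizer_desc[OF ce, of h], simp_all)
qed

section \<open>Cokernels and normal epimorphisms\<close>

lemma cokernelD:
  assumes "cokernel C f q"
  shows "f \<in> Ar C" "q \<in> Ar C" "Dom C q = Cod C f" "q \<cdot> f = zero (Dom C f) (Cod C q)"
proof -
  show *: "f \<in> Ar C" "q \<in> Ar C" "Dom C q = Cod C f" using assms by (simp_all add: cokernel_def)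
  have "zero_ar C (q \<cdot> f)" using assms by (simp add: cokernel_def)
  then show "q \<cdot> f = zero (Dom C f) (Cod C q)" using * by (simp add: zero_ar_iff)
qed

lemma cokernel_desc:
  assumes Q: "cokernel C f q" and h: "h \<in> Ar C" "Dom C h = Cod C f" "h \<cdot> f = zero (Dom C f) (Cod C h)"
  obtains u where "u \<in> Ar C" "Dom C u = Cod C q" "Cod C u = Cod C h" "u \<cdot> q = h"
proof -
  note [simp] = cokernelD[OF Q] h
  have "zero_ar C (h \<cdot> f)" by (simp add: zero_ar_iff)
  then have "\<exists>!u. u \<in> hom C (Cod C q) (Cod C h) \<and> u \<cdot> q = h"
    using Q h unfolding cokernel_def by blast
  then obtain u where "u \<in> hom C (Cod C q) (Cod C h)" "u \<cdot> q = h" by blast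
  then show ?thesis by (intro that) (simp_all add: hom_iff)
qed

lemma cokernelI:
  assumes f [simp]: "f \<in> Ar C" and qf: "Dom C q = Cod C f" "q \<cdot> f = zero (Dom C f) (Cod C q)"
    and q: "regular_epi C q"
    and ex: "\<And>h. \<lbrakk>h \<in> Ar C; Dom C h = Cod C f; h \<cdot> f = zero (Dom C f) (Cod C h)\<rbrakk> \<Longrightarrow>
      \<exists>u \<in> Ar C. Dom C u = Cod C q \<and> Cod C u = Cod C h \<and> u \<cdot> q = h"
  shows "cokernel C f q"
  unfolding cokernel_def
proof (intro conjI ballI impI)
  note [simp] = qf
  show [simp]: "q \<in> Ar C" using q by (rule regular_epi_Ar)
  show "zero_ar C (q \<cdot> f)" by (simp add: zero_ar_iff)
  fix h assume "h \<in> Ar C" "Dom C h = Cod C f \<and> zero_ar C (h \<cdot> f)"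
  then have [simp]: "h \<in> Ar C" "Dom C h = Cod C f" and z: "zero_ar C (h \<cdot> f)" by auto
  have "h \<cdot> f = zero (Dom C f) (Cod C h)" using z by (simp add: zero_ar_iff)
  then obtain u where [simp]: "u \<in> Ar C" "Dom C u = Cod C q" "Cod C u = Cod C h" and u: "u \<cdot> q = h"
    using ex[of h] by auto
  show "\<exists>!u. u \<in> hom C (Cod C q) (Cod C h) \<and> u \<cdot> q = h"
  proof (rule ex1I[of _ u])
    fix v assume "v \<in> hom C (Cod C q) (Cod C h) \<and> v \<cdot> q = h"
    then show "v = u" using regular_epi_cancel[OF q, of v u] u by (simp add: hom_iff)
  qed (simp add: hom_iff u)
qed (simp_all add: qf)

lemma cokernel_kernel:
  assumes e: "regular_epi C e" and K: "kernel C e k"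
  shows "cokernel C k e"
proof (rule cokernelI[OF _ _ _ e])
  note [simp] = kernelD[OF K]
  fix h assume h: "h \<in> Ar C" "Dom C h = Cod C k" "h \<cdot> k = zero (Dom C k) (Cod C h)"
  then have "Dom C h = Dom C e" by simp
  then show "\<exists>u\<in>Ar C. Dom C u = Cod C e \<and> Cod C u = Cod C h \<and> u \<cdot> e = h"
    using h by - (rule regular_epi_desc[OF e K, of h], auto)
qed (simp_all add: kernelD[OF K])

lemma cokernel_regular_epi:
  assumes Q: "cokernel C f q" shows "regular_epi C q"
proof -
  note [simp] = cokernelD[OF Q]
  have "coequalizer C f (zero (Dom C f) (Cod C f)) q"
    unfolding coequalizer_def
  proof (intro conjI ballI impI)
    fix h assume [simp]: "h \<in> Ar C"
      and "Dom C h = Cod C f \<and> h \<cdot> f = h \<cdot> zero (Dom C f) (Cod C f)"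
    then have [simp]: "Dom C h = Cod C f" and e: "h \<cdot> f = h \<cdot> zero (Dom C f) (Cod C f)" by auto
    have "h \<cdot> f = zero (Dom C f) (Cod C h)" using e by simp
    then have "zero_ar C (h \<cdot> f)" by (simp add: zero_ar_iff)
    then show "\<exists>!u. u \<in> hom C (Cod C q) (Cod C h) \<and> u \<cdot> q = h"
      using Q unfolding cokernel_def by simp
  qed simp_all
  then show ?thesis by (auto simp: regular_epi_def)
qed

lemma normal_epi_iff_regular_epi: "normal_epi C q \<longleftrightarrow> regular_epi C q"
proof
  assume "normal_epi C q" then show "regular_epi C q"
    by (auto simp: normal_epi_def intro: cokernel_regular_epi)
next
  assume q: "regular_epi C q"
  obtain k where "kernel C q k" by (rule kernel_ex[OF regular_epi_Ar[OF q]])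
  with q show "normal_epi C q" unfolding normal_epi_def by (blast intro: cokernel_kernel)
qed

text \<open>The monic part of \<open>g\<close> is the last factor of the regular epimorphism
  \<open>g \<cdot> f\<close>, hence invertible.\<close>

lemma regular_epi_second_factor:
  assumes [simp]: "f \<in> Ar C" "g \<in> Ar C" "Cod C f = Dom C g" and r: "regular_epi C (g \<cdot> f)"
  shows "regular_epi C g"
proof -
  obtain e m where e: "regular_epi C e" and m: "mono_ar C m" and
    [simp]: "Dom C e = Dom C g" "Cod C m = Cod C g" "Cod C e = Dom C m" and me: "m \<cdot> e = g"
    by (rule image_factorization[of g]) auto
  note [simp] = regular_epi_Ar[OF e] mono_arD(1)[OF m]
  have "m \<cdot> (e \<cdot> f) = g \<cdot> f" using reassoc[OF me, of f] by simp
  then have "iso C m" using r by - (rule mono_regular_epi_iso[OF m, of "e \<cdot> f"], simp_all)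
  then have "regular_epi C (m \<cdot> e)" by - (rule regular_epi_iso_comp[OF e], simp_all)
  then show ?thesis by (simp add: me)
qed

text \<open>A form of the short five lemma: pulling back along \<open>p \<cdot> m\<close> turns \<open>m\<close> into a morphism of split
  short exact sequences with the same kernel.\<close>

lemma mono_over_regular_epi_iso:
  assumes m: "mono_ar C m" and p [simp]: "p \<in> Ar C" "Cod C m = Dom C p"
    and g: "regular_epi C (p \<cdot> m)"
    and fac: "\<And>x. \<lbrakk>x \<in> Ar C; Cod C x = Dom C p; p \<cdot> x = zero (Dom C x) (Cod C p)\<rbrakk> \<Longrightarrow>
      \<exists>y \<in> Ar C. Dom C y = Dom C x \<and> Cod C y = Dom C m \<and> m \<cdot> y = x"
  shows "iso C m"
proof -
  note [simp] = mono_arD(1)[OF m]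
  let ?g = "p \<cdot> m"
  obtain p1 p2 where P: "pullback C ?g ?g p1 p2" by (rule pullback_ex[of ?g ?g]) auto
  note [simp] = pullbackD(4-6)[OF P]
  have [simp]: "Cod C p1 = Dom C m" "Cod C p2 = Dom C m" using pullbackD(7,8)[OF P] by simp_all
  obtain q1 q2 where Q: "pullback C ?g p q1 q2" by (rule pullback_ex[of ?g p]) auto
  note [simp] = pullbackD(4-6)[OF Q]
  have [simp]: "Cod C q1 = Dom C m" "Cod C q2 = Dom C p" using pullbackD(7,8)[OF Q] by simp_all
  obtain k where K: "kernel C ?g k" by (rule kernel_ex[of ?g]) auto
  note [simp] = kernelD(2)[OF K]
  have [simp]: "Cod C k = Dom C m" using kernelD(3)[OF K] by simp
  obtain j d where S: "split_ses C j p1 d" and jd: "p2 \<cdot> d = Ide C (Dom C ?g)" "p2 \<cdot> j = k" "Dom C j = Dom C k"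
    by (rule split_kernel_pair[OF _ K]) (use P in \<open>simp add: kernel_pair_def\<close>)
  note [simp] = split_sesD(3-4)[OF S]
  have [simp]: "Cod C j = Dom C p1" "Dom C d = Dom C m" "Cod C d = Dom C p1" using split_sesD[OF S] by simp_all
  have jd': "p1 \<cdot> d = Ide C (Dom C m)" "p1 \<cdot> j = zero (Dom C k) (Dom C m)" "p2 \<cdot> d = Ide C (Dom C m)"
    using split_sesD[OF S] jd by simp_all
  \<comment> \<open>The arrow \<open>w\<close> sends (x, y) to (x, m y), from the kernel pair of
    \<open>p \<cdot> m\<close> to the pullback of \<open>p \<cdot> m\<close> and
    \<open>p\<close>.\<close>
  obtain w where [simp]: "w \<in> Ar C" "Dom C w = Dom C p1" "Cod C w = Dom C q1"
    and w: "q1 \<cdot> w = p1" "q2 \<cdot> w = m \<cdot> p2"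
    by (rule pullback_lift[OF Q, of p1 "m \<cdot> p2"]) (use pullbackD(9)[OF P] in simp_all)
  have wq: "q1 \<cdot> (w \<cdot> x) = p1 \<cdot> x" "q2 \<cdot> (w \<cdot> x) = m \<cdot> (p2 \<cdot> x)" if "x \<in> Ar C" "Cod C x = Dom C p1" for x
    using reassoc[OF w(1), of x] reassoc[OF w(2), of x] that by simp_all
  \<comment> \<open>An element of the kernel of \<open>q1\<close> is a pair (0, x) with
    \<open>p\<close> killing x. By \<open>fac\<close> such an x has the form m y, with y in the
    kernel of \<open>p \<cdot> m\<close>, so \<open>w\<close> is an identity on kernels.\<close>
  have "kernel C q1 (w \<cdot> j)"
  proof (rule kernelI)
    show "q1 \<cdot> (w \<cdot> j) = zero (Dom C (w \<cdot> j)) (Cod C q1)" using wq(1)[of j] jd jd' by simp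
  next
    fix h assume [simp]: "h \<in> Ar C" "Cod C h = Dom C q1" and z: "q1 \<cdot> h = zero (Dom C h) (Cod C q1)"
    have "p \<cdot> (q2 \<cdot> h) = zero (Dom C h) (Cod C p)"
      using reassoc[OF pullbackD(9)[OF Q], of h] reassoc[of ?g q1 "?g \<cdot> q1" h] z by simp
    then obtain y where [simp]: "y \<in> Ar C" "Dom C y = Dom C h" "Cod C y = Dom C m" and y: "m \<cdot> y = q2 \<cdot> h"
      using fac[of "q2 \<cdot> h"] by auto
    have "?g \<cdot> y = zero (Dom C y) (Cod C ?g)"
      using y \<open>p \<cdot> (q2 \<cdot> h) = _\<close> by simp
    then obtain u where [simp]: "u \<in> Ar C" "Dom C u = Dom C y" "Cod C u = Dom C k" and u: "k \<cdot> u = y"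
      by - (rule kernel_lift[OF K, of y], simp_all)
    have "q1 \<cdot> (w \<cdot> (j \<cdot> u)) = q1 \<cdot> h" "q2 \<cdot> (w \<cdot> (j \<cdot> u)) = q2 \<cdot> h"
      using wq[of "j \<cdot> u"] reassoc[OF jd'(2), of u] reassoc[OF jd(2), of u] u y z by (simp_all add: jd(3))
    then have "w \<cdot> (j \<cdot> u) = h" by - (rule pullback_eqI[OF Q], simp_all add: jd(3))
    then show "\<exists>u\<in>Ar C. Dom C u = Dom C h \<and> Cod C u = Dom C (w \<cdot> j) \<and> (w \<cdot> j) \<cdot> u = h"
      by (intro bexI[of _ u]) (simp_all add: jd(3))
  next
    show "mono_ar C (w \<cdot> j)"
    proof (rule mono_arI)
      fix u v assume [simp]: "u \<in> Ar C" "v \<in> Ar C" "Dom C u = Dom C v"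
        and "Cod C u = Dom C (w \<cdot> j)" "Cod C v = Dom C (w \<cdot> j)"
        and e: "(w \<cdot> j) \<cdot> u = (w \<cdot> j) \<cdot> v"
      then have [simp]: "Cod C u = Dom C k" "Cod C v = Dom C k" by (simp_all add: jd(3))
      have "q2 \<cdot> (w \<cdot> (j \<cdot> u)) = q2 \<cdot> (w \<cdot> (j \<cdot> v))" using e by (simp add: jd(3))
      then have "m \<cdot> (k \<cdot> u) = m \<cdot> (k \<cdot> v)"
        using wq(2)[of "j \<cdot> u"] wq(2)[of "j \<cdot> v"] reassoc[OF jd(2), of u] reassoc[OF jd(2), of v]
        by (simp add: jd(3))
      then have "k \<cdot> u = k \<cdot> v" by - (rule mono_arD(2)[OF m], simp_all)
      then show "u = v" by - (rule kernel_cancel[OF K], simp_all)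
    qed simp
  qed simp_all
  then have S': "split_ses C (w \<cdot> j) q1 (w \<cdot> d)"
    using wq(1)[of d] jd' by (simp add: split_ses_def hom_iff)
  have iw: "iso C w"
    by (rule split_short_five[OF S S', where u = "Ide C (Dom C k)" and w = "Ide C (Dom C m)"])
      (simp_all add: w jd(3))
  then obtain v where [simp]: "v \<in> Ar C" "Dom C v = Cod C w" "Cod C v = Dom C w" and wv: "w \<cdot> v = Ide C (Cod C w)"
    by (rule isoE)
  \<comment> \<open>As \<open>w\<close> is invertible, \<open>q2\<close> factors through
    \<open>m\<close>; as a pullback of \<open>p \<cdot> m\<close> it is a regular epimorphism, which
    forces the monomorphism \<open>m\<close> to be invertible.\<close>
  have q2: "regular_epi C q2" by (rule regular_epi_pullback(1)[OF Q g])
  have "q2 = q2 \<cdot> (w \<cdot> v)" using wv by simp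
  also have "\<dots> = m \<cdot> (p2 \<cdot> v)" using wq(2)[of v] by simp
  finally have "regular_epi C (m \<cdot> (p2 \<cdot> v))" using q2 by simp
  then show ?thesis by (rule mono_regular_epi_iso[OF m]) simp_all
qed

text \<open>The monic part of the image of \<open>w\<close> inherits both hypotheses and is
  therefore invertible.\<close>

lemma regular_epi_over_regular_epi:
  assumes w [simp]: "w \<in> Ar C" and p [simp]: "p \<in> Ar C" "Cod C w = Dom C p"
    and g: "regular_epi C (p \<cdot> w)"
    and fac: "\<And>x. \<lbrakk>x \<in> Ar C; Cod C x = Dom C p; p \<cdot> x = zero (Dom C x) (Cod C p)\<rbrakk> \<Longrightarrow>
      \<exists>y \<in> Ar C. Dom C y = Dom C x \<and> Cod C y = Dom C w \<and> w \<cdot> y = x"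
  shows "regular_epi C w"
proof -
  obtain e m where e: "regular_epi C e" and m: "mono_ar C m" and
    [simp]: "Dom C e = Dom C w" "Cod C m = Dom C p" "Cod C e = Dom C m" and me: "m \<cdot> e = w"
    by (rule image_factorization[of w]) auto
  note [simp] = regular_epi_Ar[OF e] mono_arD(1)[OF m]
  have "iso C m"
  proof (rule mono_over_regular_epi_iso[OF m p(1)])
    show "regular_epi C (p \<cdot> m)" using g me by - (rule regular_epi_second_factor[of e], simp_all)
    fix x assume "x \<in> Ar C" "Cod C x = Dom C p" "p \<cdot> x = zero (Dom C x) (Cod C p)"
    from fac[OF this] obtain y where [simp]: "y \<in> Ar C" "Dom C y = Dom C x" "Cod C y = Dom C w" and y: "w \<cdot> y = x"
      by blast
    show "\<exists>y \<in> Ar C. Dom C y = Dom C x \<and> Cod C y = Dom C m \<and> m \<cdot> y = x"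
      using reassoc[OF me, of y] y by (intro bexI[of _ "e \<cdot> y"]) simp_all
  qed simp
  then have "regular_epi C (m \<cdot> e)" by - (rule regular_epi_iso_comp[OF e], simp_all)
  then show ?thesis by (simp add: me)
qed

text \<open>The square formed by \<open>l\<close>, \<open>c\<close>, \<open>q\<close> and
  \<open>k\<close> is a pullback, so the restriction \<open>c\<close> of \<open>q\<close> to the
  kernels is a regular epimorphism along with \<open>q\<close>.\<close>

lemma kernel_comp_regular_epi:
  assumes q: "regular_epi C q" and qg [simp]: "Cod C q = Dom C g"
    and K: "kernel C (g \<cdot> q) k" and L: "kernel C g l"
  obtains c where "regular_epi C c" "Dom C c = Dom C k" "Cod C c = Dom C l" "l \<cdot> c = q \<cdot> k"
proof -
  note [simp] = regular_epi_Ar[OF q] kernelD[OF L] kernelD(2)[OF K]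
  have [simp]: "Cod C k = Dom C q" using kernelD(3)[OF K] by simp
  have z: "g \<cdot> (q \<cdot> k) = zero (Dom C k) (Cod C g)" using kernelD(4)[OF K] by simp
  then obtain c where [simp]: "c \<in> Ar C" "Dom C c = Dom C k" "Cod C c = Dom C l" and c: "l \<cdot> c = q \<cdot> k"
    by - (rule kernel_lift[OF L, of "q \<cdot> k"], simp_all)
  have "pullback C q l k c"
  proof (rule pullbackI)
    fix x y assume [simp]: "x \<in> Ar C" "y \<in> Ar C" "Dom C y = Dom C x" "Cod C x = Dom C q" "Cod C y = Dom C l"
      and e: "q \<cdot> x = l \<cdot> y"
    have "(g \<cdot> q) \<cdot> x = zero (Dom C x) (Cod C (g \<cdot> q))"
      using e reassoc[OF kernelD(4)[OF L], of y] by simp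
    then obtain u where [simp]: "u \<in> Ar C" "Dom C u = Dom C x" "Cod C u = Dom C k" and u: "k \<cdot> u = x"
      by - (rule kernel_lift[OF K, of x], simp_all)
    have "l \<cdot> (c \<cdot> u) = l \<cdot> y" using reassoc[OF c, of u] u e by simp
    then have "c \<cdot> u = y" by - (rule kernel_cancel[OF L], simp_all)
    with u show "\<exists>u\<in>Ar C. Dom C u = Dom C x \<and> Cod C u = Dom C k \<and> k \<cdot> u = x \<and> c \<cdot> u = y"
      by (intro bexI[of _ u]) simp_all
  next
    fix u v assume "u \<in> Ar C" "v \<in> Ar C" "Cod C u = Dom C k" "Cod C v = Dom C k" "k \<cdot> u = k \<cdot> v"
    then show "u = v" by (rule kernel_cancel[OF K])
  qed (simp_all add: c)
  then have "regular_epi C c" by (rule regular_epi_pullback(1)) (rule q)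
  then show ?thesis by (rule that) (simp_all add: c)
qed

text \<open>The new section is (1, s f) and the new kernel is (0, l): pulling back a split sequence
  does not change its kernel object.\<close>

lemma pullback_split_ses:
  assumes P: "pullback C f g p q" and S: "split_ses C l g s"
  obtains j t where "split_ses C j p t" "Dom C j = Dom C l" "q \<cdot> j = l" "q \<cdot> t = s \<cdot> f"
proof -
  note [simp] = pullbackD(1,4-6)[OF P] split_sesD[OF S]
  have [simp]: "Cod C f = Cod C g" "Cod C p = Dom C f" "Cod C q = Dom C g" using pullbackD[OF P] by simp_all
  obtain t where [simp]: "t \<in> Ar C" "Dom C t = Dom C f" "Cod C t = Dom C p"
    and t: "p \<cdot> t = Ide C (Dom C f)" "q \<cdot> t = s \<cdot> f"
    by (rule pullback_lift[OF P, of "Ide C (Dom C f)" "s \<cdot> f"])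
      (use reassoc[OF split_sesD(8)[OF S], of f] in simp_all)
  obtain j where [simp]: "j \<in> Ar C" "Dom C j = Dom C l" "Cod C j = Dom C p"
    and j: "p \<cdot> j = zero (Dom C l) (Dom C f)" "q \<cdot> j = l"
    by (rule pullback_lift[OF P, of "zero (Dom C l) (Dom C f)" l]) simp_all
  have "kernel C p j"
  proof (rule kernelI)
    fix h assume [simp]: "h \<in> Ar C" "Cod C h = Dom C p" and z: "p \<cdot> h = zero (Dom C h) (Cod C p)"
    have "g \<cdot> (q \<cdot> h) = zero (Dom C h) (Cod C g)"
      using reassoc[OF pullbackD(9)[OF P], of h] z by simp
    then obtain u where [simp]: "u \<in> Ar C" "Dom C u = Dom C h" "Cod C u = Dom C l" and u: "l \<cdot> u = q \<cdot> h"
      by - (rule kernel_lift[OF split_sesD(1)[OF S], of "q \<cdot> h"], simp_all)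
    have "j \<cdot> u = h"
      by (rule pullback_eqI[OF P]) (use u z reassoc[OF j(1), of u] reassoc[OF j(2), of u] in simp_all)
    then show "\<exists>u\<in>Ar C. Dom C u = Dom C h \<and> Cod C u = Dom C j \<and> j \<cdot> u = h" by (intro bexI[of _ u]) simp_all
  next
    show "mono_ar C j"
    proof (rule mono_arI)
      fix u v assume [simp]: "u \<in> Ar C" "v \<in> Ar C" "Dom C u = Dom C v" "Cod C u = Dom C j" "Cod C v = Dom C j"
        and "j \<cdot> u = j \<cdot> v"
      then have "q \<cdot> (j \<cdot> u) = q \<cdot> (j \<cdot> v)" by simp
      then have "l \<cdot> u = l \<cdot> v" using reassoc[OF j(2), of u] reassoc[OF j(2), of v] by simp
      then show "u = v" by - (rule kernel_cancel[OF split_sesD(1)[OF S]], simp_all)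
    qed simp
  qed (simp_all add: j)
  then have "split_ses C j p t" by (simp add: split_ses_def hom_iff t)
  then show ?thesis using t j by - (rule that[of j t], simp_all)
qed

text \<open>If \<open>n\<close> is the kernel of some arrow, it is also the kernel of the regular
  part of that arrow, since the monic part reflects zero; and a regular epimorphism is the cokernel
  of its kernel.\<close>

lemma normal_mono_cokernel:
  assumes N: "normal_mono C n"
  obtains q where "regular_epi C q" "kernel C q n" "cokernel C n q"
proof -
  from N obtain g where G: "kernel C g n" by (auto simp: normal_mono_def)
  note [simp] = kernelD[OF G]
  obtain e m where e: "regular_epi C e" and m: "mono_ar C m" and
    [simp]: "Dom C e = Dom C g" "Cod C m = Cod C g" "Cod C e = Dom C m" and me: "m \<cdot> e = g"
    by (rule image_factorization[of g]) auto
  note [simp] = regular_epi_Ar[OF e] mono_arD(1)[OF m]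
  have "kernel C e n"
  proof (rule kernelI)
    have "m \<cdot> (e \<cdot> n) = m \<cdot> zero (Dom C n) (Dom C m)" using reassoc[OF me, of n] by simp
    then show "e \<cdot> n = zero (Dom C n) (Cod C e)" by - (rule mono_arD(2)[OF m], simp_all)
  next
    fix h assume [simp]: "h \<in> Ar C" "Cod C h = Dom C e" "e \<cdot> h = zero (Dom C h) (Cod C e)"
    have "g \<cdot> h = zero (Dom C h) (Cod C g)" using reassoc[OF me, of h] by simp
    then show "\<exists>u\<in>Ar C. Dom C u = Dom C h \<and> Cod C u = Dom C n \<and> n \<cdot> u = h"
      by - (rule kernel_lift[OF G, of h], auto)
  qed (simp_all add: kernel_mono[OF G])
  with e show ?thesis by (intro that cokernel_kernel)
qed

lemma cokernel_unique:
  assumes Q: "cokernel C f q" and Q': "cokernel C f q'"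
  obtains u where "iso C u" "Dom C u = Cod C q" "Cod C u = Cod C q'" "u \<cdot> q = q'"
proof -
  note [simp] = cokernelD[OF Q] cokernelD[OF Q']
  obtain u where [simp]: "u \<in> Ar C" "Dom C u = Cod C q" "Cod C u = Cod C q'" and u: "u \<cdot> q = q'"
    by (rule cokernel_desc[OF Q, of q']) auto
  obtain v where [simp]: "v \<in> Ar C" "Dom C v = Cod C q'" "Cod C v = Cod C q" and v: "v \<cdot> q' = q"
    by (rule cokernel_desc[OF Q', of q]) auto
  have "v \<cdot> u = Ide C (Cod C q)"
    by (rule regular_epi_cancel[OF cokernel_regular_epi[OF Q]]) (simp_all add: u v)
  moreover have "u \<cdot> v = Ide C (Cod C q')"
    by (rule regular_epi_cancel[OF cokernel_regular_epi[OF Q']]) (simp_all add: u v)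
  ultimately have "iso C u" by - (rule isoI[of u v], simp_all)
  then show ?thesis by (rule that) (simp_all add: u)
qed

end

section \<open>Birkhoff reflections\<close>

locale birkhoff_reflection = semi_abelian_category C
  for C :: "('o, 'm) cat" (structure) +
  fixes B :: "'o set" and I R :: "('o, 'm, 'o, 'm) func" and \<eta> \<kappa> :: "'o \<Rightarrow> 'm"
  assumes birkhoff: "birkhoff_subcategory C B"
    and reflector: "reflector C B I \<eta>"
    and radical: "radical C \<eta> R \<kappa>"
begin

lemma B_Ob: "a \<in> B \<Longrightarrow> a \<in> Ob C"
  using birkhoff unfolding birkhoff_subcategory_def by blast

lemma mono_B: "\<lbrakk>mono_ar C m; Cod C m \<in> B\<rbrakk> \<Longrightarrow> Dom C m \<in> B"
  using birkhoff unfolding birkhoff_subcategory_def by blast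

lemma regular_epi_B: "\<lbrakk>regular_epi C q; Dom C q \<in> B\<rbrakk> \<Longrightarrow> Cod C q \<in> B"
  using birkhoff unfolding birkhoff_subcategory_def by blast

lemma unit_reflection: "a \<in> Ob C \<Longrightarrow> reflection_ar C B a (\<eta> a)"
  using reflector by (simp add: reflector_def)

lemma unit_Ar [simp]:
  assumes "a \<in> Ob C"
  shows "\<eta> a \<in> Ar C" "Dom C (\<eta> a) = a" "Cod C (\<eta> a) = fob I a" "fob I a \<in> B"
proof -
  have "reflection_ar C B a (\<eta> a)" "Cod C (\<eta> a) = fob I a" using reflector assms by (simp_all add: reflector_def)
  then show "\<eta> a \<in> Ar C" "Dom C (\<eta> a) = a" "Cod C (\<eta> a) = fob I a" "fob I a \<in> B"
    by (simp_all add: reflection_ar_def)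
qed

lemma reflector_Ob [simp]: "a \<in> Ob C \<Longrightarrow> fob I a \<in> Ob C"
  by (rule B_Ob) simp

lemma full_sub_simps:
  "Ob (full_sub C B) = B" "Ar (full_sub C B) = {f \<in> Ar C. Dom C f \<in> B \<and> Cod C f \<in> B}"
  "Dom (full_sub C B) = Dom C" "Cod (full_sub C B) = Cod C" "Ide (full_sub C B) = Ide C"
  "Cmp (full_sub C B) = Cmp C"
  using B_Ob by (auto simp: full_sub_def)

lemma reflector_functor: "is_functor C (full_sub C B) I"
  using reflector by (simp add: reflector_def)

lemma reflector_Ar [simp]:
  assumes "f \<in> Ar C"
  shows "far I f \<in> Ar C" "Dom C (far I f) = fob I (Dom C f)" "Cod C (far I f) = fob I (Cod C f)"
proof -
  have "far I f \<in> hom (full_sub C B) (fob I (Dom C f)) (fob I (Cod C f))"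
    using reflector_functor assms unfolding is_functor_def by blast
  then show "far I f \<in> Ar C" "Dom C (far I f) = fob I (Dom C f)" "Cod C (far I f) = fob I (Cod C f)"
    by (simp_all add: hom_def full_sub_simps)
qed

lemma reflector_Ide [simp]: "a \<in> Ob C \<Longrightarrow> far I (Ide C a) = Ide C (fob I a)"
  using reflector_functor unfolding is_functor_def full_sub_simps by blast

lemma reflector_Cmp:
  "\<lbrakk>f \<in> Ar C; g \<in> Ar C; Cod C f = Dom C g\<rbrakk> \<Longrightarrow> far I (g \<cdot> f) = far I g \<cdot> far I f"
  using reflector_functor unfolding is_functor_def full_sub_simps by blast

lemma unit_natural: "f \<in> Ar C \<Longrightarrow> \<eta> (Cod C f) \<cdot> f = far I f \<cdot> \<eta> (Dom C f)"
  using reflector by (simp add: reflector_def)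

lemma unit_natural_assoc:
  assumes "f \<in> Ar C" "x \<in> Ar C" "Cod C x = Dom C f"
  shows "\<eta> (Cod C f) \<cdot> (f \<cdot> x) = far I f \<cdot> (\<eta> (Dom C f) \<cdot> x)"
  using reassoc[OF unit_natural, of f x] assms by simp

text \<open>Every arrow respects the relation of being identified by the unit. This form of
  naturality is what the equivalence relation on the domain of a normal epimorphism rests
  on.\<close>

lemma unit_cong:
  assumes [simp]: "h \<in> Ar C" "x \<in> Ar C" "y \<in> Ar C" "Cod C x = Dom C h" "Cod C y = Dom C h"
    and e: "\<eta> (Dom C h) \<cdot> x = \<eta> (Dom C h) \<cdot> y"
  shows "\<eta> (Cod C h) \<cdot> (h \<cdot> x) = \<eta> (Cod C h) \<cdot> (h \<cdot> y)"
  by (simp add: unit_natural_assoc e)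

lemma unit_desc:
  assumes a: "a \<in> Ob C" and h: "h \<in> Ar C" "Dom C h = a" "Cod C h \<in> B"
  obtains u where "u \<in> Ar C" "Dom C u = fob I a" "Cod C u = Cod C h" "u \<cdot> \<eta> a = h"
proof -
  have "\<exists>!u. u \<in> hom C (Cod C (\<eta> a)) (Cod C h) \<and> u \<cdot> \<eta> a = h"
    using unit_reflection[OF a] h unfolding reflection_ar_def by blast
  then obtain u where "u \<in> hom C (Cod C (\<eta> a)) (Cod C h)" "u \<cdot> \<eta> a = h" by blast
  then show ?thesis using a by (intro that) (simp_all add: hom_iff)
qed

lemma unit_cancel:
  assumes a: "a \<in> Ob C" and xy: "x \<in> Ar C" "y \<in> Ar C" "Dom C x = fob I a" "Dom C y = fob I a"
    "Cod C x \<in> B" "Cod C y = Cod C x" and e: "x \<cdot> \<eta> a = y \<cdot> \<eta> a"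
  shows "x = y"
proof -
  have h: "y \<cdot> \<eta> a \<in> Ar C" "Dom C (y \<cdot> \<eta> a) = a" "Cod C (y \<cdot> \<eta> a) \<in> B" "Cod C (y \<cdot> \<eta> a) = Cod C x"
    using a xy by simp_all
  have "\<exists>!u. u \<in> hom C (Cod C (\<eta> a)) (Cod C (y \<cdot> \<eta> a)) \<and> u \<cdot> \<eta> a = y \<cdot> \<eta> a"
    using unit_reflection[OF a] h unfolding reflection_ar_def by blast
  moreover have "x \<in> hom C (Cod C (\<eta> a)) (Cod C (y \<cdot> \<eta> a))" "y \<in> hom C (Cod C (\<eta> a)) (Cod C (y \<cdot> \<eta> a))"
    using a xy by (simp_all add: hom_iff)
  ultimately show ?thesis using e by blast
qed

text \<open>The image of the unit is a subobject of \<open>fob I a\<close>, hence in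
  \<open>B\<close>. The regular part therefore extends along the unit, and this extension inverts
  the monic part.\<close>

lemma unit_regular_epi:
  assumes a [simp]: "a \<in> Ob C" shows "regular_epi C (\<eta> a)"
proof -
  obtain e m where e: "regular_epi C e" and m: "mono_ar C m" and
    [simp]: "Dom C e = a" "Cod C m = fob I a" "Cod C e = Dom C m" and me: "m \<cdot> e = \<eta> a"
    by (rule image_factorization[of "\<eta> a"]) auto
  note [simp] = regular_epi_Ar[OF e] mono_arD(1)[OF m]
  have "Dom C m \<in> B" by (rule mono_B[OF m]) simp
  then obtain t where [simp]: "t \<in> Ar C" "Dom C t = fob I a" "Cod C t = Dom C m" and t: "t \<cdot> \<eta> a = e"
    by - (rule unit_desc[OF a, of e], simp_all)
  have mt: "m \<cdot> t = Ide C (fob I a)" by (rule unit_cancel[OF a]) (simp_all add: t me)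
  have "t \<cdot> m = Ide C (Dom C m)"
    by (rule mono_arD(2)[OF m]) (use reassoc[OF mt, of m] in simp_all)
  with mt have "iso C m" by - (rule isoI[of m t], simp_all)
  then have "regular_epi C (m \<cdot> e)" by - (rule regular_epi_iso_comp[OF e], simp_all)
  then show ?thesis by (simp add: me)
qed

lemma unit_iso:
  assumes a: "a \<in> B" shows "iso C (\<eta> a)"
proof -
  have [simp]: "a \<in> Ob C" using a by (rule B_Ob)
  obtain u where [simp]: "u \<in> Ar C" "Dom C u = fob I a" "Cod C u = a" and u: "u \<cdot> \<eta> a = Ide C a"
    by (rule unit_desc[of a "Ide C a"]) (use a in simp_all)
  have "\<eta> a \<cdot> u = Ide C (fob I a)" by (rule unit_cancel[of a]) (simp_all add: u)
  then show ?thesis using u by - (rule isoI[of _ u], simp_all)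
qed

lemma zero_obj_B: "zero_obj \<in> B"
proof -
  have "mono_ar C (zero zero_obj (fob I zero_obj))"
    by (rule mono_arI) (auto intro: into_zero_obj)
  from mono_B[OF this] show ?thesis by simp
qed

section \<open>The radical\<close>

lemma radical_kernel: "a \<in> Ob C \<Longrightarrow> kernel C (\<eta> a) (\<kappa> a)"
  using radical by (simp add: radical_def)

lemma radical_functor: "is_functor C C R"
  using radical by (simp add: radical_def)

lemma radical_Ob [simp]: "a \<in> Ob C \<Longrightarrow> fob R a \<in> Ob C"
  using radical_functor unfolding is_functor_def by blast

lemma counit_Ar [simp]:
  assumes "a \<in> Ob C"
  shows "\<kappa> a \<in> Ar C" "Dom C (\<kappa> a) = fob R a" "Cod C (\<kappa> a) = a" "\<eta> a \<cdot> \<kappa> a = zero (fob R a) (fob I a)"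
  using radical kernelD[OF radical_kernel[OF assms]] assms by (simp_all add: radical_def)

lemma radical_Ar [simp]:
  assumes "f \<in> Ar C"
  shows "far R f \<in> Ar C" "Dom C (far R f) = fob R (Dom C f)" "Cod C (far R f) = fob R (Cod C f)"
proof -
  have "far R f \<in> hom C (fob R (Dom C f)) (fob R (Cod C f))"
    using radical_functor assms unfolding is_functor_def by blast
  then show "far R f \<in> Ar C" "Dom C (far R f) = fob R (Dom C f)" "Cod C (far R f) = fob R (Cod C f)"
    by (simp_all add: hom_def)
qed

lemma radical_Cmp:
  "\<lbrakk>f \<in> Ar C; g \<in> Ar C; Cod C f = Dom C g\<rbrakk> \<Longrightarrow> far R (g \<cdot> f) = far R g \<cdot> far R f"
  using radical_functor unfolding is_functor_def by blast

lemma radical_Ide [simp]: "a \<in> Ob C \<Longrightarrow> far R (Ide C a) = Ide C (fob R a)"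
  using radical_functor unfolding is_functor_def by blast

lemma counit_natural: "f \<in> Ar C \<Longrightarrow> \<kappa> (Cod C f) \<cdot> far R f = f \<cdot> \<kappa> (Dom C f)"
  using radical by (simp add: radical_def)

lemma counit_natural_assoc:
  assumes "f \<in> Ar C" "x \<in> Ar C" "Cod C x = fob R (Dom C f)"
  shows "\<kappa> (Cod C f) \<cdot> (far R f \<cdot> x) = f \<cdot> (\<kappa> (Dom C f) \<cdot> x)"
  using reassoc[OF counit_natural, of f x] assms by simp

lemma counit_cancel:
  assumes "a \<in> Ob C" "x \<in> Ar C" "y \<in> Ar C" "Cod C x = fob R a" "Cod C y = fob R a" "\<kappa> a \<cdot> x = \<kappa> a \<cdot> y"
  shows "x = y"
  using kernel_cancel[OF radical_kernel[OF assms(1)], of x y] assms by simp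

lemma counit_lift:
  assumes "a \<in> Ob C" "x \<in> Ar C" "Cod C x = a" "\<eta> a \<cdot> x = zero (Dom C x) (fob I a)"
  obtains u where "u \<in> Ar C" "Dom C u = Dom C x" "Cod C u = fob R a" "\<kappa> a \<cdot> u = x"
  using assms by - (rule kernel_lift[OF radical_kernel[OF assms(1)], of x], simp_all)

section \<open>Zero arrows and kernels in the subcategory\<close>

lemma hom_full_sub: "\<lbrakk>a \<in> B; b \<in> B\<rbrakk> \<Longrightarrow> hom (full_sub C B) a b = hom C a b"
  by (auto simp: hom_def full_sub_simps)

text \<open>A zero object of the subcategory has a single endomorphism, so its identity is a zero
  arrow of \<open>C\<close>, and whatever factors through it is zero in \<open>C\<close>.
  Conversely, the chosen zero object lies in \<open>B\<close>.\<close>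

lemma zero_ar_full_sub:
  "zero_ar (full_sub C B) f \<longleftrightarrow> zero_ar C f \<and> Dom C f \<in> B \<and> Cod C f \<in> B"
proof
  assume "zero_ar (full_sub C B) f"
  then obtain z g h where f: "f \<in> Ar C" "Dom C f \<in> B" "Cod C f \<in> B" "f = h \<cdot> g"
    and z: "zero_object (full_sub C B) z"
    and gh: "g \<in> hom (full_sub C B) (Dom C f) z" "h \<in> hom (full_sub C B) z (Cod C f)"
    by (auto simp: zero_ar_def full_sub_simps)
  have zB: "z \<in> B" using z by (auto simp: zero_object_def initial_object_def full_sub_simps)
  then have zO [simp]: "z \<in> Ob C" by (rule B_Ob)
  have "\<exists>!i. i \<in> hom C z z"
    using z zB by (auto simp: zero_object_def initial_object_def full_sub_simps hom_full_sub)
  then have zz: "zero z z = Ide C z" using Ide_in[OF zO] by (auto simp: hom_iff)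
  have g [simp]: "g \<in> Ar C" "Dom C g = Dom C f" "Cod C g = z" and h [simp]: "h \<in> Ar C" "Dom C h = z" "Cod C h = Cod C f"
    using gh by (auto simp: hom_def full_sub_simps)
  have "g = zero (Dom C f) z" using arg_cong[OF zz, of "\<lambda>i. i \<cdot> g"] f(1) by simp
  then have "h \<cdot> g = zero (Dom C f) (Cod C f)" using f(1) by simp
  then show "zero_ar C f \<and> Dom C f \<in> B \<and> Cod C f \<in> B" using f(1-3) f(4)[symmetric] by (simp add: zero_ar_iff)
next
  assume f: "zero_ar C f \<and> Dom C f \<in> B \<and> Cod C f \<in> B"
  then have fA: "f \<in> Ar C" and fz: "f = zero (Dom C f) (Cod C f)" by (auto simp: zero_ar_iff)
  have "zero_object (full_sub C B) zero_obj"
    using zero_object_zero_obj zero_obj_B B_Ob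
    by (auto simp: zero_object_def initial_object_def terminal_object_def full_sub_simps hom_full_sub)
  moreover have "zero (Dom C f) zero_obj \<in> hom (full_sub C B) (Dom C f) zero_obj"
    "zero zero_obj (Cod C f) \<in> hom (full_sub C B) zero_obj (Cod C f)"
    "f = zero zero_obj (Cod C f) \<cdot> zero (Dom C f) zero_obj"
    using f fA fz zero_obj_B by (simp_all add: hom_full_sub hom_iff)
  ultimately show "zero_ar (full_sub C B) f"
    using f fA unfolding zero_ar_def full_sub_simps by blast
qed

lemma kernel_full_sub:
  assumes K: "kernel C f k" and fk: "Dom C f \<in> B" "Cod C f \<in> B" "Dom C k \<in> B"
  shows "kernel (full_sub C B) f k"
proof -
  note [simp] = kernelD[OF K] fk
  show ?thesis
    unfolding kernel_def full_sub_simps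
  proof (intro conjI ballI impI)
    show "zero_ar (full_sub C B) (f \<cdot> k)" by (simp add: zero_ar_full_sub zero_ar_iff)
    fix h assume "h \<in> {h \<in> Ar C. Dom C h \<in> B \<and> Cod C h \<in> B}"
      "Cod C h = Dom C f \<and> zero_ar (full_sub C B) (f \<cdot> h)"
    then show "\<exists>!u. u \<in> hom (full_sub C B) (Dom C h) (Dom C k) \<and> k \<cdot> u = h"
      using K by (simp add: zero_ar_full_sub hom_full_sub kernel_def)
  qed simp_all
qed

text \<open>Since a morphism with zero kernel is monic, this says
  that \<open>I\<close> sends the kernel of a split epimorphism to a monomorphism.\<close>

definition reflects_split_kernels :: bool where
  "reflects_split_kernels \<longleftrightarrow> (\<forall>k f s x. split_ses C k f s \<and> x \<in> Ar C \<and> Cod C x = Dom C k \<and>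
     \<eta> (Dom C f) \<cdot> (k \<cdot> x) = zero (Dom C x) (fob I (Dom C f)) \<longrightarrow>
     \<eta> (Dom C k) \<cdot> x = zero (Dom C x) (fob I (Dom C k)))"

lemma reflects_split_kernelsD:
  assumes "reflects_split_kernels" "split_ses C k f s" "x \<in> Ar C" "Cod C x = Dom C k"
    "\<eta> (Dom C f) \<cdot> (k \<cdot> x) = zero (Dom C x) (fob I (Dom C f))"
  shows "\<eta> (Dom C k) \<cdot> x = zero (Dom C x) (fob I (Dom C k))"
  using assms unfolding reflects_split_kernels_def by blast

text \<open>Protoadditivity makes \<open>far I k\<close> a kernel within the subcategory only. The
  kernel \<open>n\<close> of \<open>far I k\<close> in \<open>C\<close> has its domain in
  \<open>B\<close>, as a subobject of an object of \<open>B\<close>, so uniqueness in the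
  subcategory applies to it and shows it to be zero. The unit at K[f] composed with \<open>x\<close>
  factors through \<open>n\<close>.\<close>

lemma reflects_split_kernels_if_protoadditive:
  assumes "protoadditive C (full_sub C B) I"
  shows reflects_split_kernels
  unfolding reflects_split_kernels_def
proof (intro allI impI, elim conjE)
  fix k f s x assume S: "split_ses C k f s" and [simp]: "x \<in> Ar C" "Cod C x = Dom C k"
    and z: "\<eta> (Dom C f) \<cdot> (k \<cdot> x) = zero (Dom C x) (fob I (Dom C f))"
  note [simp] = split_sesD[OF S]
  have IS: "kernel (full_sub C B) (far I f) (far I k)"
    using assms S unfolding protoadditive_def split_ses_def by blast
  obtain n where N: "kernel C (far I k) n" by (rule kernel_ex[of "far I k"]) simp
  note [simp] = kernelD(2)[OF N]
  have [simp]: "Cod C n = fob I (Dom C k)" using kernelD(3)[OF N] by simp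
  have nB [simp]: "Dom C n \<in> B" by (rule mono_B[OF kernel_mono[OF N]]) simp
  have [simp]: "Dom C n \<in> Ob C" by (rule B_Ob) simp
  let ?h = "far I k \<cdot> n"
  have h: "?h = zero (Dom C n) (fob I (Dom C f))" using kernelD(4)[OF N] by simp
  have "?h \<in> Ar (full_sub C B)" "Cod C ?h = Dom C (far I f)" "zero_ar (full_sub C B) (far I f \<cdot> ?h)"
    by (simp_all add: full_sub_simps zero_ar_full_sub zero_ar_iff h)
  then have "\<exists>!u. u \<in> hom (full_sub C B) (Dom C ?h) (Dom C (far I k)) \<and> far I k \<cdot> u = ?h"
    using IS unfolding kernel_def full_sub_simps by blast
  moreover have "n \<in> hom (full_sub C B) (Dom C ?h) (Dom C (far I k))"
    "zero (Dom C n) (fob I (Dom C k)) \<in> hom (full_sub C B) (Dom C ?h) (Dom C (far I k))"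
    by (simp_all add: hom_full_sub hom_iff)
  moreover have "far I k \<cdot> zero (Dom C n) (fob I (Dom C k)) = ?h" by (simp add: h)
  ultimately have n: "n = zero (Dom C n) (fob I (Dom C k))" by blast
  have "far I k \<cdot> (\<eta> (Dom C k) \<cdot> x) = zero (Dom C x) (fob I (Dom C f))"
    using z unit_natural_assoc[of k x] by simp
  then obtain u where [simp]: "u \<in> Ar C" "Dom C u = Dom C x" "Cod C u = Dom C n" and u: "n \<cdot> u = \<eta> (Dom C k) \<cdot> x"
    by - (rule kernel_lift[OF N, of "\<eta> (Dom C k) \<cdot> x"], simp_all)
  have "n \<cdot> u = zero (Dom C x) (fob I (Dom C k))" by (subst n) simp
  with u show "\<eta> (Dom C k) \<cdot> x = zero (Dom C x) (fob I (Dom C k))" by simp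
qed

text \<open>By naturality of \<open>\<kappa>\<close>, the elements of [A] killed by
  \<open>far R f\<close> are those of the intersection of K[f] with [A]. Both sides say that this
  intersection is [K[f]].\<close>

lemma reflects_split_kernels_iff_radical_protoadditive:
  "reflects_split_kernels \<longleftrightarrow> protoadditive C C R"
proof
  assume core: reflects_split_kernels
  show "protoadditive C C R"
    unfolding protoadditive_def
  proof (intro allI impI)
    fix k f s assume S: "split_ses C k f s"
    note [simp] = split_sesD[OF S]
    have "kernel C (far R f) (far R k)"
    proof (rule kernelI)
      have "\<kappa> (Cod C f) \<cdot> (far R f \<cdot> far R k) = \<kappa> (Cod C f) \<cdot> zero (fob R (Dom C k)) (fob R (Cod C f))"
        using counit_natural_assoc[of f "far R k"] counit_natural[of k]
          reassoc[OF split_sesD(9)[OF S], of "\<kappa> (Dom C k)"] by simp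
      then show "far R f \<cdot> far R k = zero (Dom C (far R k)) (Cod C (far R f))"
        by - (rule counit_cancel[of "Cod C f"], simp_all)
    next
      fix h assume [simp]: "h \<in> Ar C" and "Cod C h = Dom C (far R f)"
        and z: "far R f \<cdot> h = zero (Dom C h) (Cod C (far R f))"
      then have [simp]: "Cod C h = fob R (Dom C f)" by simp
      have "f \<cdot> (\<kappa> (Dom C f) \<cdot> h) = zero (Dom C h) (Cod C f)"
        using counit_natural_assoc[of f h] z by simp
      then obtain y where [simp]: "y \<in> Ar C" "Dom C y = Dom C h" "Cod C y = Dom C k" and y: "k \<cdot> y = \<kappa> (Dom C f) \<cdot> h"
        by - (rule kernel_lift[OF split_sesD(1)[OF S], of "\<kappa> (Dom C f) \<cdot> h"], simp_all)
      have "\<eta> (Dom C f) \<cdot> (k \<cdot> y) = zero (Dom C y) (fob I (Dom C f))"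
        using y reassoc[OF counit_Ar(4)[of "Dom C f"], of h] by simp
      then have "\<eta> (Dom C k) \<cdot> y = zero (Dom C y) (fob I (Dom C k))"
        by - (rule reflects_split_kernelsD[OF core S], simp_all)
      then obtain u where [simp]: "u \<in> Ar C" "Dom C u = Dom C y" "Cod C u = fob R (Dom C k)" and u: "\<kappa> (Dom C k) \<cdot> u = y"
        by - (rule counit_lift[of "Dom C k" y], simp_all)
      have "\<kappa> (Dom C f) \<cdot> (far R k \<cdot> u) = \<kappa> (Dom C f) \<cdot> h"
        using counit_natural_assoc[of k u] u y by simp
      then have "far R k \<cdot> u = h" by - (rule counit_cancel[of "Dom C f"], simp_all)
      then show "\<exists>u\<in>Ar C. Dom C u = Dom C h \<and> Cod C u = Dom C (far R k) \<and> far R k \<cdot> u = h"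
        by (intro bexI[of _ u]) simp_all
    next
      show "mono_ar C (far R k)"
      proof (rule mono_arI)
        fix u v assume [simp]: "u \<in> Ar C" "v \<in> Ar C" and "Cod C u = Dom C (far R k)" "Cod C v = Dom C (far R k)"
          and e: "far R k \<cdot> u = far R k \<cdot> v"
        then have [simp]: "Cod C u = fob R (Dom C k)" "Cod C v = fob R (Dom C k)" by simp_all
        have "k \<cdot> (\<kappa> (Dom C k) \<cdot> u) = k \<cdot> (\<kappa> (Dom C k) \<cdot> v)"
          using counit_natural_assoc[of k u] counit_natural_assoc[of k v] e by simp
        then have "\<kappa> (Dom C k) \<cdot> u = \<kappa> (Dom C k) \<cdot> v"
          by - (rule kernel_cancel[OF split_sesD(1)[OF S]], simp_all)
        then show "u = v" by - (rule counit_cancel[of "Dom C k"], simp_all)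
      qed simp
    qed simp_all
    moreover have "far R f \<cdot> far R s = Ide C (fob R (Cod C f))"
      using radical_Cmp[of s f] by simp
    ultimately show "split_ses C (far R k) (far R f) (far R s)"
      by (simp add: split_ses_def hom_iff)
  qed
next
  assume pa: "protoadditive C C R"
  show reflects_split_kernels
    unfolding reflects_split_kernels_def
  proof (intro allI impI, elim conjE)
    fix k f s x assume S: "split_ses C k f s" and [simp]: "x \<in> Ar C" "Cod C x = Dom C k"
      and z: "\<eta> (Dom C f) \<cdot> (k \<cdot> x) = zero (Dom C x) (fob I (Dom C f))"
    note [simp] = split_sesD[OF S]
    have RS: "kernel C (far R f) (far R k)"
      using pa S unfolding protoadditive_def split_ses_def by blast
    obtain y where [simp]: "y \<in> Ar C" "Dom C y = Dom C x" "Cod C y = fob R (Dom C f)" and y: "\<kappa> (Dom C f) \<cdot> y = k \<cdot> x"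
      by (rule counit_lift[of "Dom C f" "k \<cdot> x"]) (use z in simp_all)
    have "\<kappa> (Cod C f) \<cdot> (far R f \<cdot> y) = \<kappa> (Cod C f) \<cdot> zero (Dom C x) (fob R (Cod C f))"
      using counit_natural_assoc[of f y] y reassoc[OF split_sesD(9)[OF S], of x] by simp
    then have "far R f \<cdot> y = zero (Dom C x) (fob R (Cod C f))"
      by - (rule counit_cancel[of "Cod C f"], simp_all)
    then obtain t where [simp]: "t \<in> Ar C" "Dom C t = Dom C y" "Cod C t = fob R (Dom C k)" and t: "far R k \<cdot> t = y"
      by - (rule kernel_lift[OF RS, of y], simp_all)
    have "k \<cdot> (\<kappa> (Dom C k) \<cdot> t) = k \<cdot> x" using counit_natural_assoc[of k t] t y by simp
    then have "\<kappa> (Dom C k) \<cdot> t = x" by - (rule kernel_cancel[OF split_sesD(1)[OF S]], simp_all)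
    then show "\<eta> (Dom C k) \<cdot> x = zero (Dom C x) (fob I (Dom C k))"
      using reassoc[OF counit_Ar(4)[of "Dom C k"], of t] by simp
  qed
qed

text \<open>The regular quotient \<open>c\<close> of K[f] onto the kernel of \<open>far I f\<close>
  has the same kernel as the unit at K[f]. The two are then cokernels of the same arrow, hence
  isomorphic quotients, and the isomorphism carries the kernel \<open>k'\<close> of
  \<open>far I f\<close> to \<open>far I k\<close>.\<close>

lemma reflector_split_ses:
  assumes core: reflects_split_kernels and S: "split_ses C k f s"
  shows "split_ses C (far I k) (far I f) (far I s)"
proof -
  note [simp] = split_sesD[OF S]
  let ?A = "Dom C f" and ?K = "Dom C k"
  have fs: "far I f \<cdot> far I s = Ide C (fob I (Cod C f))" using reflector_Cmp[of s f] by simp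
  obtain \<alpha> \<beta> where P: "pullback C (far I f) (\<eta> (Cod C f)) \<alpha> \<beta>"
    by (rule pullback_ex[of "far I f" "\<eta> (Cod C f)"]) auto
  note [simp] = pullbackD(4-6)[OF P]
  have [simp]: "Cod C \<alpha> = fob I ?A" "Cod C \<beta> = Cod C f" using pullbackD(7,8)[OF P] by simp_all
  obtain w where [simp]: "w \<in> Ar C" "Dom C w = ?A" "Cod C w = Dom C \<alpha>"
    and w: "\<alpha> \<cdot> w = \<eta> ?A" "\<beta> \<cdot> w = f"
    by (rule pullback_lift[OF P, of "\<eta> ?A" f]) (use unit_natural[of f] in simp_all)
  have wr: "regular_epi C w"
  proof (rule regular_epi_over_regular_epi[of w \<alpha>])
    show "regular_epi C (\<alpha> \<cdot> w)" by (simp add: w unit_regular_epi)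
    fix x assume [simp]: "x \<in> Ar C" "Cod C x = Dom C \<alpha>" and z: "\<alpha> \<cdot> x = zero (Dom C x) (Cod C \<alpha>)"
    \<comment> \<open>An element \<open>x\<close> killed by \<open>\<alpha>\<close> is determined by
      \<open>\<beta> \<cdot> x\<close>, which the unit at the codomain of \<open>f\<close> kills.
      The section lifts it to the domain of \<open>f\<close>, and naturality of the unit along
      \<open>s\<close> keeps the lift killed, so its image under \<open>w\<close> is
      \<open>x\<close>.\<close>
    let ?y = "s \<cdot> (\<beta> \<cdot> x)"
    have "far I f \<cdot> (\<alpha> \<cdot> x) = \<eta> (Cod C f) \<cdot> (\<beta> \<cdot> x)" using reassoc[OF pullbackD(9)[OF P], of x] by simp
    then have "\<eta> (Cod C f) \<cdot> (\<beta> \<cdot> x) = zero (Dom C x) (fob I (Cod C f))" using z by simp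
    then have "\<alpha> \<cdot> (w \<cdot> ?y) = \<alpha> \<cdot> x"
      using reassoc[OF w(1), of ?y] unit_natural_assoc[of s "\<beta> \<cdot> x"] z by simp
    moreover have "\<beta> \<cdot> (w \<cdot> ?y) = \<beta> \<cdot> x"
      using reassoc[OF w(2), of ?y] reassoc[OF split_sesD(8)[OF S], of "\<beta> \<cdot> x"] by simp
    ultimately have "w \<cdot> ?y = x" by - (rule pullback_eqI[OF P], simp_all)
    then show "\<exists>y \<in> Ar C. Dom C y = Dom C x \<and> Cod C y = Dom C w \<and> w \<cdot> y = x"
      by (intro bexI[of _ ?y]) simp_all
  qed simp_all
  obtain k' where K': "kernel C (far I f) k'" by (rule kernel_ex[of "far I f"]) simp
  note [simp] = kernelD(2)[OF K']
  have [simp]: "Cod C k' = fob I ?A" using kernelD(3)[OF K'] by simp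
  have S': "split_ses C k' (far I f) (far I s)" using K' fs by (simp add: split_ses_def hom_iff)
  \<comment> \<open>Pulling back along the unit leaves the kernel of \<open>far I f\<close>
    unchanged, so the kernel of \<open>\<beta>\<close> is \<open>l\<close>, a copy of
    \<open>k'\<close>, and \<open>w\<close> restricts to a regular epimorphism from K[f] onto
    it.\<close>
  obtain l t where L: "split_ses C l \<beta> t" "Dom C l = Dom C k'" and l: "\<alpha> \<cdot> l = k'"
    by (rule pullback_split_ses[OF pullback_commute[OF P] S'])
  note [simp] = split_sesD(3)[OF L(1)] L(2)
  have [simp]: "Cod C l = Dom C \<alpha>" using split_sesD(5)[OF L(1)] by simp
  obtain c where c: "regular_epi C c" and [simp]: "Dom C c = ?K" "Cod C c = Dom C k'" and lc: "l \<cdot> c = w \<cdot> k"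
    by (rule kernel_comp_regular_epi[OF wr _ _ split_sesD(1)[OF L(1)], of k]) (simp_all add: w)
  note [simp] = regular_epi_Ar[OF c]
  have k'c: "k' \<cdot> c = \<eta> ?A \<cdot> k"
    using reassoc[OF l, of c] reassoc[OF w(1), of k] lc by simp
  \<comment> \<open>Here the property enters: \<open>c\<close> kills those elements of K[f] that the
    unit at the domain of \<open>f\<close> kills, and these are no more than what the unit at K[f]
    kills.\<close>
  have "kernel C c (\<kappa> ?K)"
  proof (rule kernelI)
    have "k' \<cdot> (c \<cdot> \<kappa> ?K) = k' \<cdot> zero (fob R ?K) (Dom C k')"
      using reassoc[OF k'c, of "\<kappa> ?K"] unit_natural_assoc[of k "\<kappa> ?K"] by simp
    then show "c \<cdot> \<kappa> ?K = zero (Dom C (\<kappa> ?K)) (Cod C c)"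
      by - (rule kernel_cancel[OF K'], simp_all)
  next
    fix h assume [simp]: "h \<in> Ar C" and "Cod C h = Dom C c" and z: "c \<cdot> h = zero (Dom C h) (Cod C c)"
    then have [simp]: "Cod C h = ?K" by simp
    have "\<eta> ?A \<cdot> (k \<cdot> h) = zero (Dom C h) (fob I ?A)" using reassoc[OF k'c, of h] z by simp
    then have "\<eta> ?K \<cdot> h = zero (Dom C h) (fob I ?K)"
      by - (rule reflects_split_kernelsD[OF core S], simp_all)
    then show "\<exists>u\<in>Ar C. Dom C u = Dom C h \<and> Cod C u = Dom C (\<kappa> ?K) \<and> \<kappa> ?K \<cdot> u = h"
      by - (rule counit_lift[of ?K h], auto)
  qed (simp_all add: kernel_mono[OF radical_kernel])
  then obtain u where iu: "iso C u" and "Dom C u = Cod C (\<eta> ?K)" "Cod C u = Cod C c" and u: "u \<cdot> \<eta> ?K = c"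
    by - (rule cokernel_unique[OF cokernel_kernel[OF unit_regular_epi radical_kernel] cokernel_kernel[OF c]], auto)
  then have [simp]: "u \<in> Ar C" "Dom C u = fob I ?K" "Cod C u = Dom C k'" by (auto elim: isoE)
  have "k' \<cdot> u = far I k"
    by (rule unit_cancel[of ?K]) (simp_all add: u k'c unit_natural[of k, simplified])
  then have "kernel C (far I f) (far I k)" using kernel_iso[OF K' iu] by simp
  then show ?thesis using fs by (simp add: split_ses_def hom_iff)
qed

lemma protoadditive_iff_reflects_split_kernels:
  "protoadditive C (full_sub C B) I \<longleftrightarrow> reflects_split_kernels"
proof
  assume core: reflects_split_kernels
  show "protoadditive C (full_sub C B) I"
    unfolding protoadditive_def
  proof (intro allI impI)
    fix k f s assume S: "split_ses C k f s"
    note [simp] = split_sesD[OF S] 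
    have IS: "split_ses C (far I k) (far I f) (far I s)" by (rule reflector_split_ses[OF core S])
    have "kernel (full_sub C B) (far I f) (far I k)"
      by (rule kernel_full_sub[OF split_sesD(1)[OF IS]]) simp_all
    with IS show "split_ses (full_sub C B) (far I k) (far I f) (far I s)"
      by (simp add: split_ses_def full_sub_simps hom_full_sub)
  qed
qed (rule reflects_split_kernels_if_protoadditive)

end

section \<open>Normal extensions\<close>

context birkhoff_reflection
begin

text \<open>The pullback square makes the first projection and the unit at the kernel pair jointly
  monic. On the copy (0, k) of K[f] the projection is zero, so the unit alone is monic there and
  embeds K[f] into an object of \<open>B\<close>.\<close>

lemma normal_extension_kernel_B:
  assumes N: "normal_extension C I \<eta> f" and K: "kernel C f k"
  shows "Dom C k \<in> B"
proof -
  from N obtain p1 p2 where KP: "kernel_pair C f p1 p2"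
    and Q: "pullback C (\<eta> (Dom C f)) (far I p1) p1 (\<eta> (Dom C p1))"
    by (auto simp: normal_extension_def)
  obtain j d where S: "split_ses C j p1 d" and [simp]: "Dom C j = Dom C k"
    by (rule split_kernel_pair[OF KP K]) auto
  note [simp] = split_sesD[OF S] kernelD(2)[OF K]
  have "mono_ar C (\<eta> (Dom C p1) \<cdot> j)"
  proof (rule trivial_kernel_mono)
    fix x assume [simp]: "x \<in> Ar C" and "Cod C x = Dom C (\<eta> (Dom C p1) \<cdot> j)"
      and z: "(\<eta> (Dom C p1) \<cdot> j) \<cdot> x = zero (Dom C x) (Cod C (\<eta> (Dom C p1) \<cdot> j))"
    then have [simp]: "Cod C x = Dom C k" by simp
    have "p1 \<cdot> (j \<cdot> x) = p1 \<cdot> zero (Dom C x) (Dom C p1)"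
      using reassoc[OF split_sesD(9)[OF S], of x] by simp
    moreover have "\<eta> (Dom C p1) \<cdot> (j \<cdot> x) = \<eta> (Dom C p1) \<cdot> zero (Dom C x) (Dom C p1)" using z by simp
    ultimately have "j \<cdot> x = j \<cdot> zero (Dom C x) (Dom C k)" by - (rule pullback_eqI[OF Q], simp_all)
    then have "x = zero (Dom C x) (Dom C k)" by - (rule kernel_cancel[OF split_sesD(1)[OF S]], simp_all)
    then show "x = zero (Dom C x) (Dom C (\<eta> (Dom C p1) \<cdot> j))" by simp
  qed simp
  from mono_B[OF this] show ?thesis by simp
qed

text \<open>The comparison \<open>w\<close> from the kernel pair to the pullback is a morphism of
  split short exact sequences over the domain of \<open>f\<close>. On kernels it is the unit at
  K[f], an isomorphism because K[f] lies in \<open>B\<close>, so the split short five lemma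
  applies.\<close>

lemma kernel_B_normal_extension:
  assumes core: reflects_split_kernels
    and f: "normal_epi C f" and K: "kernel C f k" and kB: "Dom C k \<in> B"
  shows "normal_extension C I \<eta> f"
proof -
  let ?A = "Dom C f" and ?K = "Dom C k"
  note [simp] = kernelD(1,2)[OF K]
  obtain p1 p2 where P: "pullback C f f p1 p2" by (rule pullback_ex[of f f]) auto
  then have KP: "kernel_pair C f p1 p2" by (simp add: kernel_pair_def)
  obtain j d where S: "split_ses C j p1 d" and [simp]: "Dom C j = ?K"
    by (rule split_kernel_pair[OF KP K]) auto
  have IS: "split_ses C (far I j) (far I p1) (far I d)" by (rule reflector_split_ses[OF core S])
  have [simp]: "Cod C p1 = ?A" by (rule pullbackD(7)[OF P])
  note [simp] = split_sesD(2-5)[OF S]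
  have [simp]: "Dom C d = ?A" "Cod C d = Dom C p1" using split_sesD(6,7)[OF S] by simp_all
  have S1: "p1 \<cdot> d = Ide C ?A" "p1 \<cdot> j = zero ?K ?A" using split_sesD(8,9)[OF S] by simp_all
  obtain a b where Q: "pullback C (\<eta> ?A) (far I p1) a b"
    by (rule pullback_ex[of "\<eta> ?A" "far I p1"]) auto
  note [simp] = pullbackD(4-6)[OF Q]
  have [simp]: "Cod C a = ?A" "Cod C b = fob I (Dom C p1)" using pullbackD(7,8)[OF Q] by simp_all
  obtain j' t where S': "split_ses C j' a t" and "Dom C j' = Dom C (far I j)"
    and bj: "b \<cdot> j' = far I j" and bt: "b \<cdot> t = far I d \<cdot> \<eta> ?A"
    by (rule pullback_split_ses[OF Q IS])
  then have [simp]: "Dom C j' = fob I ?K" by simp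
  note [simp] = split_sesD(3-5)[OF S']
  have [simp]: "Dom C t = ?A" "Cod C t = Dom C a" using split_sesD(6,7)[OF S'] by simp_all
  have S'1: "a \<cdot> t = Ide C ?A" "a \<cdot> j' = zero (fob I ?K) ?A" using split_sesD(8,9)[OF S'] by simp_all
  obtain w where [simp]: "w \<in> Ar C" "Dom C w = Dom C p1" "Cod C w = Dom C a"
    and w: "a \<cdot> w = p1" "b \<cdot> w = \<eta> (Dom C p1)"
    by (rule pullback_lift[OF Q, of p1 "\<eta> (Dom C p1)"]) (use unit_natural[of p1] in simp_all)
  have wx: "a \<cdot> (w \<cdot> x) = p1 \<cdot> x" "b \<cdot> (w \<cdot> x) = \<eta> (Dom C p1) \<cdot> x" if "x \<in> Ar C" "Cod C x = Dom C p1" for x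
    using reassoc[OF w(1), of x] reassoc[OF w(2), of x] that by simp_all
  have "w \<cdot> j = j' \<cdot> \<eta> ?K"
  proof (rule pullback_eqI[OF Q])
    show "a \<cdot> (w \<cdot> j) = a \<cdot> (j' \<cdot> \<eta> ?K)"
      using reassoc[OF S'1(2), of "\<eta> ?K"] by (simp add: wx S1)
    show "b \<cdot> (w \<cdot> j) = b \<cdot> (j' \<cdot> \<eta> ?K)"
      using reassoc[OF bj, of "\<eta> ?K"] unit_natural[of j] by (simp add: wx)
  qed simp_all
  moreover have "w \<cdot> d = t \<cdot> Ide C ?A"
    by (rule pullback_eqI[OF Q]) (use unit_natural[of d] in \<open>simp_all add: wx S1 S'1 bt\<close>)
  ultimately have "iso C w"
    by - (rule split_short_five[OF S S', where u = "\<eta> ?K" and w = "Ide C ?A"], simp_all add: w unit_iso[OF kB])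
  from pullback_iso[OF Q this] have "pullback C (\<eta> ?A) (far I p1) p1 (\<eta> (Dom C p1))" by (simp add: w)
  with f KP show ?thesis unfolding normal_extension_def by blast
qed

text \<open>In the object of composable pairs, \<open>u\<close> is the pair formed by
  \<open>x\<close> and \<open>y\<close>, and \<open>v\<close> is the pair whose components are both
  the diagonal at \<open>p1 \<cdot> x\<close>. The unit identifies \<open>u\<close> with
  \<open>v\<close> after each projection; joint monicity of the reflected projections lifts this to
  the pairs themselves, and the composition \<open>m\<close> transports it to the kernel
  pair.\<close>

lemma unit_diagonal_relation_transitive:
  assumes core: reflects_split_kernels and P: "pullback C f f p1 p2"
    and d: "split_ses C j p1 d" "p2 \<cdot> d = Ide C (Dom C f)"
    and x: "x \<in> Ar C" "Cod C x = Dom C p1" "\<eta> (Dom C p1) \<cdot> x = \<eta> (Dom C p1) \<cdot> (d \<cdot> (p1 \<cdot> x))"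
    and y: "y \<in> Ar C" "Cod C y = Dom C p1" "\<eta> (Dom C p1) \<cdot> y = \<eta> (Dom C p1) \<cdot> (d \<cdot> (p1 \<cdot> y))"
    and xy: "Dom C y = Dom C x" "p2 \<cdot> x = p1 \<cdot> y"
  obtains z where "z \<in> Ar C" "Dom C z = Dom C x" "Cod C z = Dom C p1" "p1 \<cdot> z = p1 \<cdot> x" "p2 \<cdot> z = p2 \<cdot> y"
    "\<eta> (Dom C p1) \<cdot> z = \<eta> (Dom C p1) \<cdot> (d \<cdot> (p1 \<cdot> z))"
proof -
  let ?A = "Dom C f" and ?R = "Dom C p1"
  note [simp] = pullbackD(1,4-8)[OF P] split_sesD(3-5)[OF d(1)] x(1,2) y(1,2) xy(1)
  have [simp]: "Dom C d = ?A" "Cod C d = ?R" using split_sesD(6,7)[OF d(1)] by simp_all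
  have pd: "p1 \<cdot> d = Ide C ?A" using split_sesD(8)[OF d(1)] by simp
  have pdx [simp]: "p1 \<cdot> (d \<cdot> u) = u" "p2 \<cdot> (d \<cdot> u) = u" if "u \<in> Ar C" "Cod C u = ?A" for u
    using reassoc[OF pd, of u] reassoc[OF d(2), of u] that by simp_all
  have fp [simp]: "f \<cdot> (p2 \<cdot> u) = f \<cdot> (p1 \<cdot> u)" if "u \<in> Ar C" "Cod C u = ?R" for u
    using reassoc[OF pullbackD(9)[OF P], of u] that by simp
  obtain a b where T: "pullback C p2 p1 a b" by (rule pullback_ex[of p2 p1]) auto
  note [simp] = pullbackD(4-6)[OF T]
  have [simp]: "Cod C a = ?R" "Cod C b = ?R" using pullbackD(7,8)[OF T] by simp_all
  have ab: "p2 \<cdot> (a \<cdot> u) = p1 \<cdot> (b \<cdot> u)" if "u \<in> Ar C" "Cod C u = Dom C a" for u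
    using reassoc[OF pullbackD(9)[OF T], of u] that by simp
  obtain l t where L: "split_ses C l a t" and bl: "b \<cdot> l = j" and [simp]: "Dom C l = Dom C j"
    by (rule pullback_split_ses[OF T d(1)])
  note [simp] = split_sesD(3-5)[OF L]
  have IL: "kernel C (far I a) (far I l)" by (rule split_sesD(1)[OF reflector_split_ses[OF core L]])
  have IJ: "kernel C (far I p1) (far I j)" by (rule split_sesD(1)[OF reflector_split_ses[OF core d(1)]])
  obtain u where [simp]: "u \<in> Ar C" "Dom C u = Dom C x" "Cod C u = Dom C a" and u: "a \<cdot> u = x" "b \<cdot> u = y"
    by (rule pullback_lift[OF T, of x y]) (use xy in simp_all)
  obtain v where [simp]: "v \<in> Ar C" "Dom C v = Dom C x" "Cod C v = Dom C a"
    and v: "a \<cdot> v = d \<cdot> (p1 \<cdot> x)" "b \<cdot> v = d \<cdot> (p1 \<cdot> x)"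
    by (rule pullback_lift[OF T, of "d \<cdot> (p1 \<cdot> x)" "d \<cdot> (p1 \<cdot> x)"]) simp_all
  \<comment> \<open>The hypothesis on \<open>y\<close> compares it with the diagonal at
    \<open>p1 \<cdot> y\<close>, which is \<open>p2 \<cdot> x\<close>. Applying
    \<open>d \<cdot> p2\<close> to the hypothesis on \<open>x\<close> replaces this by the diagonal
    at \<open>p1 \<cdot> x\<close>, the common base point of both components of
    \<open>v\<close>.\<close>
  have "\<eta> ?R \<cdot> y = \<eta> ?R \<cdot> ((d \<cdot> p2) \<cdot> x)" using y(3) xy(2) by simp
  also have "\<dots> = \<eta> ?R \<cdot> ((d \<cdot> p2) \<cdot> (d \<cdot> (p1 \<cdot> x)))"
    using unit_cong[of "d \<cdot> p2" x "d \<cdot> (p1 \<cdot> x)"] x(3) by simp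
  finally have y': "\<eta> ?R \<cdot> y = \<eta> ?R \<cdot> (d \<cdot> (p1 \<cdot> x))" by simp
  have uv: "\<eta> (Dom C a) \<cdot> u = \<eta> (Dom C a) \<cdot> v"
  proof (rule trivial_kernels_jointly_monic[of "far I a" "far I b"])
    show "far I a \<cdot> (\<eta> (Dom C a) \<cdot> u) = far I a \<cdot> (\<eta> (Dom C a) \<cdot> v)"
      using unit_natural_assoc[of a u] unit_natural_assoc[of a v] x(3) u v by simp
    show "far I b \<cdot> (\<eta> (Dom C a) \<cdot> u) = far I b \<cdot> (\<eta> (Dom C a) \<cdot> v)"
      using unit_natural_assoc[of b u] unit_natural_assoc[of b v] y' u v by simp
  next
    \<comment> \<open>The kernel of \<open>far I a\<close> is \<open>far I l\<close>, and
      \<open>far I b\<close> restricted to it is \<open>far I j\<close>, again a kernel and so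
      monic. Hence an element killed by both reflected projections is zero.\<close>
    fix z assume [simp]: "z \<in> Ar C" and "Cod C z = Dom C (far I a)"
      and z: "far I a \<cdot> z = zero (Dom C z) (Cod C (far I a))" "far I b \<cdot> z = zero (Dom C z) (Cod C (far I b))"
    then have [simp]: "Cod C z = fob I (Dom C a)" by simp
    obtain c where [simp]: "c \<in> Ar C" "Dom C c = Dom C z" "Cod C c = fob I (Dom C j)" and c: "far I l \<cdot> c = z"
      by (rule kernel_lift[OF IL, of z]) (use z in simp_all)
    have "far I j = far I b \<cdot> far I l" using reflector_Cmp[of l b] bl by simp
    then have "far I j \<cdot> c = far I j \<cdot> zero (Dom C z) (fob I (Dom C j))" using z(2) c by simp
    then have "c = zero (Dom C z) (fob I (Dom C j))" by - (rule kernel_cancel[OF IJ], simp_all)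
    with c show "z = zero (Dom C z) (Dom C (far I a))" by simp
  qed simp_all
  obtain m where [simp]: "m \<in> Ar C" "Dom C m = Dom C a" "Cod C m = ?R" and m: "p1 \<cdot> m = p1 \<cdot> a" "p2 \<cdot> m = p2 \<cdot> b"
    by (rule pullback_lift[OF P, of "p1 \<cdot> a" "p2 \<cdot> b"]) (use pullbackD(9)[OF T] fp[of a] in simp_all)
  have mx: "p1 \<cdot> (m \<cdot> r) = p1 \<cdot> (a \<cdot> r)" "p2 \<cdot> (m \<cdot> r) = p2 \<cdot> (b \<cdot> r)" if "r \<in> Ar C" "Cod C r = Dom C a" for r
    using reassoc[OF m(1), of r] reassoc[OF m(2), of r] that by simp_all
  have mv: "m \<cdot> v = d \<cdot> (p1 \<cdot> x)" by (rule pullback_eqI[OF P]) (simp_all add: mx v)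
  have "\<eta> ?R \<cdot> (m \<cdot> u) = \<eta> ?R \<cdot> (m \<cdot> v)" using unit_cong[of m u v] uv by simp
  then show ?thesis using mx[of u] u mv by (intro that[of "m \<cdot> u"]) simp_all
qed

text \<open>With \<open>R\<^sub>f\<close> the kernel pair of \<open>f\<close> and \<open>d\<close> its diagonal, the pairs that the unit
  identifies with their diagonal form an equivalence relation; its zero class is \<open>[K[f]]\<close>.\<close>

lemma radical_kernel_normal:
  assumes core: reflects_split_kernels and K: "kernel C f k"
  shows "normal_mono C (k \<cdot> \<kappa> (Dom C k))"
proof -
  let ?A = "Dom C f" and ?K = "Dom C k"
  note [simp] = kernelD(1-3)[OF K]
  obtain p1 p2 where P: "pullback C f f p1 p2" by (rule pullback_ex[of f f]) auto
  then have KP: "kernel_pair C f p1 p2" by (simp add: kernel_pair_def)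
  obtain j d where S: "split_ses C j p1 d" and pd2: "p2 \<cdot> d = Ide C ?A" and pj2: "p2 \<cdot> j = k" and [simp]: "Dom C j = ?K"
    by (rule split_kernel_pair[OF KP K]) auto
  let ?R = "Dom C p1"
  note [simp] = pullbackD(4-8)[OF P] split_sesD(3-5)[OF S]
  have [simp]: "Dom C d = ?A" "Cod C d = ?R" using split_sesD(6,7)[OF S] by simp_all
  have pd1: "p1 \<cdot> d = Ide C ?A" and pj1: "p1 \<cdot> j = zero ?K ?A" using split_sesD(8,9)[OF S] by simp_all
  have pdx [simp]: "p1 \<cdot> (d \<cdot> u) = u" "p2 \<cdot> (d \<cdot> u) = u" if "u \<in> Ar C" "Cod C u = ?A" for u
    using reassoc[OF pd1, of u] reassoc[OF pd2, of u] that by simp_all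
  have fp: "f \<cdot> (p2 \<cdot> u) = f \<cdot> (p1 \<cdot> u)" if "u \<in> Ar C" "Cod C u = ?R" for u
    using reassoc[OF pullbackD(9)[OF P], of u] that by simp
  obtain e where me: "mono_ar C e" and "Cod C e = Dom C (\<eta> ?R)" and eq: "\<eta> ?R \<cdot> e = (\<eta> ?R \<cdot> (d \<cdot> p1)) \<cdot> e" and
    fac: "\<And>h. \<lbrakk>h \<in> Ar C; Cod C h = Dom C (\<eta> ?R); \<eta> ?R \<cdot> h = (\<eta> ?R \<cdot> (d \<cdot> p1)) \<cdot> h\<rbrakk> \<Longrightarrow>
      \<exists>u \<in> Ar C. Dom C u = Dom C h \<and> Cod C u = Dom C e \<and> e \<cdot> u = h"
    by (rule equalizer_ex[of "\<eta> ?R" "\<eta> ?R \<cdot> (d \<cdot> p1)"]) simp_all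
  note [simp] = mono_arD(1)[OF me]
  have [simp]: "Cod C e = ?R" using \<open>Cod C e = _\<close> by simp
  have eqx: "\<eta> ?R \<cdot> (e \<cdot> u) = \<eta> ?R \<cdot> (d \<cdot> (p1 \<cdot> (e \<cdot> u)))" if "u \<in> Ar C" "Cod C u = Dom C e" for u
    using reassoc[OF eq, of u] that by simp
  have facx: "\<exists>u \<in> Ar C. Dom C u = Dom C h \<and> Cod C u = Dom C e \<and> e \<cdot> u = h"
    if "h \<in> Ar C" "Cod C h = ?R" "\<eta> ?R \<cdot> h = \<eta> ?R \<cdot> (d \<cdot> (p1 \<cdot> h))" for h
    using fac[of h] that by simp
  let ?r1 = "p1 \<cdot> e" and ?r2 = "p2 \<cdot> e"
  have "equivalence_relation C ?A ?r1 ?r2"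
    unfolding equivalence_relation_def
  proof (intro conjI allI ballI impI)
    fix x g h assume g: "g \<in> hom C x (Dom C ?r1)" and h: "h \<in> hom C x (Dom C ?r1)"
      and gh: "?r1 \<cdot> g = ?r1 \<cdot> h \<and> ?r2 \<cdot> g = ?r2 \<cdot> h"
    then have [simp]: "g \<in> Ar C" "h \<in> Ar C" "Cod C g = Dom C e" "Cod C h = Dom C e" by (simp_all add: hom_iff)
    have "e \<cdot> g = e \<cdot> h" by (rule pullback_eqI[OF P]) (use gh in simp_all)
    then show "g = h" by - (rule mono_arD(2)[OF me], simp_all)
  next
    obtain u where "u \<in> Ar C" "Dom C u = ?A" "Cod C u = Dom C e" "e \<cdot> u = d"
      using facx[of d] pd1 by auto
    then show "\<exists>d\<in>hom C ?A (Dom C ?r1). ?r1 \<cdot> d = Ide C ?A \<and> ?r2 \<cdot> d = Ide C ?A"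
      using pd1 pd2 by (intro bexI[of _ u]) (simp_all add: hom_iff)
  next
    obtain \<sigma> where [simp]: "\<sigma> \<in> Ar C" "Dom C \<sigma> = ?R" "Cod C \<sigma> = ?R" and \<sigma>: "p1 \<cdot> \<sigma> = p2" "p2 \<cdot> \<sigma> = p1"
      by (rule pullback_lift[OF P, of p2 p1]) (use pullbackD(9)[OF P] in simp_all)
    note \<sigma>x = reassoc[OF \<sigma>(1)] reassoc[OF \<sigma>(2)]
    have \<sigma>d: "\<sigma> \<cdot> (d \<cdot> u) = d \<cdot> u" if "u \<in> Ar C" "Cod C u = ?A" for u
      by (rule pullback_eqI[OF P]) (use that in \<open>simp_all add: \<sigma>x\<close>)
    \<comment> \<open>For a related pair (a, b), the swap fixes the diagonal, so the unit identifies
      (b, a) with (a, a); applying \<open>d \<cdot> p2\<close> to the relation itself shows that it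
      identifies (a, a) with (b, b).\<close>
    have "\<eta> ?R \<cdot> (\<sigma> \<cdot> e) = \<eta> ?R \<cdot> (d \<cdot> (p1 \<cdot> e))"
      using unit_cong[of \<sigma> e "d \<cdot> (p1 \<cdot> e)"] eq by (simp add: \<sigma>d)
    also have "\<dots> = \<eta> ?R \<cdot> ((d \<cdot> p2) \<cdot> (d \<cdot> (p1 \<cdot> e)))" by simp
    also have "\<dots> = \<eta> ?R \<cdot> ((d \<cdot> p2) \<cdot> e)"
      using unit_cong[of "d \<cdot> p2" "d \<cdot> (p1 \<cdot> e)" e] eq by simp
    also have "\<dots> = \<eta> ?R \<cdot> (d \<cdot> (p1 \<cdot> (\<sigma> \<cdot> e)))" by (simp add: \<sigma>x)
    finally obtain s where "s \<in> Ar C" "Dom C s = Dom C e" "Cod C s = Dom C e" "e \<cdot> s = \<sigma> \<cdot> e"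
      using facx[of "\<sigma> \<cdot> e"] by auto
    then show "\<exists>s\<in>hom C (Dom C ?r1) (Dom C ?r1). ?r1 \<cdot> s = ?r2 \<and> ?r2 \<cdot> s = ?r1"
      by (intro bexI[of _ s]) (simp_all add: hom_iff \<sigma>x)
  next
    fix p q assume T: "pullback C ?r2 ?r1 p q"
    note [simp] = pullbackD(4-6)[OF T]
    have [simp]: "Cod C p = Dom C e" "Cod C q = Dom C e" using pullbackD(7,8)[OF T] by simp_all
    have "p2 \<cdot> (e \<cdot> p) = p1 \<cdot> (e \<cdot> q)" using pullbackD(9)[OF T] by simp
    then obtain z where z: "z \<in> Ar C" "Dom C z = Dom C (e \<cdot> p)" "Cod C z = ?R" "p1 \<cdot> z = p1 \<cdot> (e \<cdot> p)"
      "p2 \<cdot> z = p2 \<cdot> (e \<cdot> q)" "\<eta> ?R \<cdot> z = \<eta> ?R \<cdot> (d \<cdot> (p1 \<cdot> z))"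
      by - (rule unit_diagonal_relation_transitive[OF core P S pd2, of "e \<cdot> p" "e \<cdot> q"], simp_all add: eqx)
    from facx[OF z(1,3,6)] z(2) obtain t where "t \<in> Ar C" "Dom C t = Dom C p" "Cod C t = Dom C e" "e \<cdot> t = z" by auto
    with z show "\<exists>t\<in>hom C (Dom C p) (Dom C ?r1). ?r1 \<cdot> t = ?r1 \<cdot> p \<and> ?r2 \<cdot> t = ?r2 \<cdot> q"
      by (intro bexI[of _ t]) (simp_all add: hom_iff)
  qed simp_all
  then obtain g where G: "pullback C g g ?r1 ?r2"
    using semi_abelian unfolding semi_abelian_def barr_exact_def kernel_pair_def by blast
  note [simp] = pullbackD(1)[OF G]
  have [simp]: "Dom C g = ?A" using pullbackD(7)[OF G] by simp
  have gr: "g \<cdot> (p2 \<cdot> (e \<cdot> u)) = g \<cdot> (p1 \<cdot> (e \<cdot> u))" if "u \<in> Ar C" "Cod C u = Dom C e" for u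
    using reassoc[OF pullbackD(9)[OF G], of u] that by simp
  have "kernel C g (k \<cdot> \<kappa> ?K)"
  proof (rule kernelI)
    \<comment> \<open>The pair of zero and an element of [K[f]] is killed by the unit, and so is the
      diagonal at zero; hence [K[f]] lies in the zero class.\<close>
    have "\<eta> ?R \<cdot> (j \<cdot> \<kappa> ?K) = zero (fob R ?K) (fob I ?R)"
      using unit_natural_assoc[of j "\<kappa> ?K"] by simp
    moreover have pj: "p1 \<cdot> (j \<cdot> \<kappa> ?K) = zero (fob R ?K) ?A" using reassoc[OF pj1, of "\<kappa> ?K"] by simp
    ultimately obtain u where [simp]: "u \<in> Ar C" "Dom C u = fob R ?K" "Cod C u = Dom C e" and u: "e \<cdot> u = j \<cdot> \<kappa> ?K"
      using facx[of "j \<cdot> \<kappa> ?K"] by auto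
    have "p2 \<cdot> (j \<cdot> \<kappa> ?K) = k \<cdot> \<kappa> ?K" using reassoc[OF pj2, of "\<kappa> ?K"] by simp
    with gr[of u] u pj show "g \<cdot> (k \<cdot> \<kappa> ?K) = zero (Dom C (k \<cdot> \<kappa> ?K)) (Cod C g)" by simp
  next
    fix h assume [simp]: "h \<in> Ar C" "Cod C h = Dom C g" and z: "g \<cdot> h = zero (Dom C h) (Cod C g)"
    \<comment> \<open>If \<open>g\<close> kills \<open>h\<close>, then (0, h) lies in the relation.
      Its first component is zero, so it comes from K[f] along \<open>j\<close>, and the unit at the
      kernel pair kills it; the property for the sequence with kernel \<open>j\<close> places it in
      [K[f]].\<close>
    obtain u where [simp]: "u \<in> Ar C" "Dom C u = Dom C h" "Cod C u = Dom C e"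
      and u: "p1 \<cdot> (e \<cdot> u) = zero (Dom C h) ?A" "p2 \<cdot> (e \<cdot> u) = h"
      by (rule pullback_lift[OF G, of "zero (Dom C h) ?A" h]) (use z in simp_all)
    obtain y where [simp]: "y \<in> Ar C" "Dom C y = Dom C h" "Cod C y = ?K" and y: "j \<cdot> y = e \<cdot> u"
      by (rule kernel_lift[OF split_sesD(1)[OF S], of "e \<cdot> u"]) (use u in simp_all)
    have "\<eta> ?R \<cdot> (j \<cdot> y) = zero (Dom C y) (fob I ?R)" using eqx[of u] u y by simp
    then have "\<eta> ?K \<cdot> y = zero (Dom C y) (fob I ?K)"
      using reflects_split_kernelsD[OF core S, of y] by simp
    then obtain t where [simp]: "t \<in> Ar C" "Dom C t = Dom C y" "Cod C t = fob R ?K" and t: "\<kappa> ?K \<cdot> t = y"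
      by - (rule counit_lift[of ?K y], simp_all)
    have "k \<cdot> y = p2 \<cdot> (j \<cdot> y)" by (simp add: reassoc[OF pj2])
    also have "\<dots> = h" by (simp add: y u(2))
    finally have "(k \<cdot> \<kappa> ?K) \<cdot> t = h" by (simp add: t)
    then show "\<exists>t\<in>Ar C. Dom C t = Dom C h \<and> Cod C t = Dom C (k \<cdot> \<kappa> ?K) \<and> (k \<cdot> \<kappa> ?K) \<cdot> t = h"
      by (intro bexI[of _ t]) simp_all
  next
    show "mono_ar C (k \<cdot> \<kappa> ?K)"
    proof (rule mono_arI)
      fix u v assume [simp]: "u \<in> Ar C" "v \<in> Ar C" and "Cod C u = Dom C (k \<cdot> \<kappa> ?K)" "Cod C v = Dom C (k \<cdot> \<kappa> ?K)"
        and uv: "(k \<cdot> \<kappa> ?K) \<cdot> u = (k \<cdot> \<kappa> ?K) \<cdot> v"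
      then have [simp]: "Cod C u = fob R ?K" "Cod C v = fob R ?K" by simp_all
      have "\<kappa> ?K \<cdot> u = \<kappa> ?K \<cdot> v" by (rule kernel_cancel[OF K]) (use uv in simp_all)
      then show "u = v" by - (rule counit_cancel[of ?K], simp_all)
    qed simp
  qed simp_all
  then show ?thesis by (auto simp: normal_mono_def)
qed

text \<open>The map \<open>q\<close> restricts to a regular epimorphism \<open>c\<close> from K[f]
  onto the kernel of \<open>g\<close>. As \<open>c\<close> kills [K[f]], it factors through the
  unit, so that kernel is a regular quotient of the reflection of K[f].\<close>

lemma quotient_kernel_B:
  assumes K: "kernel C f k" and Q: "cokernel C (k \<cdot> \<kappa> (Dom C k)) q"
    and g: "g \<in> Ar C" "Dom C g = Cod C q" "g \<cdot> q = f" and L: "kernel C g l"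
  shows "Dom C l \<in> B"
proof -
  let ?K = "Dom C k"
  note [simp] = kernelD(1,2)[OF K] cokernelD(2)[OF Q] g(1,2) kernelD(2)[OF L]
  have [simp]: "Cod C k = Dom C q" "Dom C f = Dom C q" using kernelD(3)[OF K] cokernelD(3)[OF Q] by simp_all
  have q: "regular_epi C q" by (rule cokernel_regular_epi[OF Q])
  have qk: "q \<cdot> (k \<cdot> \<kappa> ?K) = zero (fob R ?K) (Cod C q)" using cokernelD(4)[OF Q] by simp
  have [simp]: "Cod C l = Cod C q" using kernelD(3)[OF L] by simp
  obtain c where c: "regular_epi C c" and [simp]: "Dom C c = ?K" "Cod C c = Dom C l" and lc: "l \<cdot> c = q \<cdot> k"
    by (rule kernel_comp_regular_epi[OF q _ _ L, of k]) (use K g in simp_all)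
  note [simp] = regular_epi_Ar[OF c]
  have "l \<cdot> (c \<cdot> \<kappa> ?K) = l \<cdot> zero (fob R ?K) (Dom C l)"
    using reassoc[OF lc, of "\<kappa> ?K"] qk by simp
  then have "c \<cdot> \<kappa> ?K = zero (fob R ?K) (Dom C l)" by - (rule kernel_cancel[OF L], simp_all)
  then obtain t where [simp]: "t \<in> Ar C" "Dom C t = fob I ?K" "Cod C t = Dom C l" and t: "t \<cdot> \<eta> ?K = c"
    by - (rule regular_epi_desc[OF unit_regular_epi radical_kernel, of ?K c], simp_all)
  have "regular_epi C t" by (rule regular_epi_second_factor[of "\<eta> ?K"]) (use c t in simp_all)
  from regular_epi_B[OF this] show ?thesis by simp
qed

lemma reflects_split_kernels_if_normal_extensions:
  assumes a: "\<And>f k. \<lbrakk>normal_epi C f; kernel C f k\<rbrakk> \<Longrightarrow> normal_mono C (k \<cdot> \<kappa> (Dom C k))"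
    and b: "\<And>f. \<lbrakk>normal_epi C f; \<And>k. kernel C f k \<Longrightarrow> Dom C k \<in> B\<rbrakk> \<Longrightarrow> normal_extension C I \<eta> f"
  shows reflects_split_kernels
  unfolding reflects_split_kernels_def
proof (intro allI impI, elim conjE)
  fix k f s x assume S: "split_ses C k f s" and [simp]: "x \<in> Ar C" "Cod C x = Dom C k"
    and z: "\<eta> (Dom C f) \<cdot> (k \<cdot> x) = zero (Dom C x) (fob I (Dom C f))"
  let ?K = "Dom C k"
  note K = split_sesD(1)[OF S]
  note [simp] = split_sesD(2-7)[OF S]
  have fs: "f \<cdot> (s \<cdot> u) = u" if "u \<in> Ar C" "Cod C u = Cod C f" for u
    using reassoc[OF split_sesD(8)[OF S], of u] that by simp
  have fk: "f \<cdot> (k \<cdot> u) = zero (Dom C u) (Cod C f)" if "u \<in> Ar C" "Cod C u = ?K" for u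
    using reassoc[OF split_sesD(9)[OF S], of u] that by simp
  have f: "regular_epi C f" by (rule split_epi_regular[of f s]) (simp_all add: split_sesD(8)[OF S])
  then have "normal_mono C (k \<cdot> \<kappa> ?K)" by (intro a[OF _ K]) (simp add: normal_epi_iff_regular_epi)
  \<comment> \<open>Normality makes [K[f]] the kernel of its own cokernel, so it suffices to show
    that \<open>q\<close> kills \<open>k \<cdot> x\<close>.\<close>
  then obtain q where q: "regular_epi C q" and Kq: "kernel C q (k \<cdot> \<kappa> ?K)" and Q: "cokernel C (k \<cdot> \<kappa> ?K) q"
    by (rule normal_mono_cokernel)
  note [simp] = regular_epi_Ar[OF q]
  have [simp]: "Dom C q = Dom C f" using kernelD(3)[OF Kq] by simp
  obtain g where [simp]: "g \<in> Ar C" "Dom C g = Cod C q" "Cod C g = Cod C f" and g: "g \<cdot> q = f"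
    by (rule cokernel_desc[OF Q, of f]) (simp_all add: fk)
  have gq: "g \<cdot> (q \<cdot> u) = f \<cdot> u" if "u \<in> Ar C" "Cod C u = Dom C f" for u
    using reassoc[OF g, of u] that by simp
  have "normal_extension C I \<eta> g"
  proof (rule b)
    show "normal_epi C g"
      unfolding normal_epi_iff_regular_epi
      by (rule regular_epi_second_factor[of q]) (use f g in simp_all)
  qed (rule quotient_kernel_B[OF K Q _ _ g], simp_all)
  then obtain p1 p2 where P: "pullback C g g p1 p2"
    and N: "pullback C (\<eta> (Dom C g)) (far I p1) p1 (\<eta> (Dom C p1))"
    by (auto simp: normal_extension_def kernel_pair_def)
  note [simp] = pullbackD(4-6)[OF P]
  have [simp]: "Cod C p1 = Cod C q" "Cod C p2 = Cod C q" using pullbackD(7,8)[OF P] by simp_all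
  \<comment> \<open>In the pair (s f, 1), taken on the quotient, the first component makes
    \<open>p1 \<cdot> i\<close> kill the image of K[f], while the second makes \<open>i\<close>
    monic.\<close>
  obtain i where [simp]: "i \<in> Ar C" "Dom C i = Cod C q" "Cod C i = Dom C p1"
    and i: "p1 \<cdot> i = q \<cdot> (s \<cdot> g)" "p2 \<cdot> i = Ide C (Cod C q)"
    by (rule pullback_lift[OF P, of "q \<cdot> (s \<cdot> g)" "Ide C (Cod C q)"]) (simp_all add: gq fs)
  have "p1 \<cdot> (i \<cdot> (q \<cdot> (k \<cdot> x))) = p1 \<cdot> zero (Dom C x) (Dom C p1)"
    using reassoc[OF i(1), of "q \<cdot> (k \<cdot> x)"] by (simp add: gq fk)
  \<comment> \<open>Naturality along \<open>i \<cdot> q\<close> carries the assumption from the unit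
    at the domain of \<open>f\<close> to the unit at the kernel pair, where the normal extension
    \<open>g\<close> has its pullback square.\<close>
  moreover have "\<eta> (Dom C p1) \<cdot> (i \<cdot> (q \<cdot> (k \<cdot> x))) = \<eta> (Dom C p1) \<cdot> zero (Dom C x) (Dom C p1)"
    using unit_natural_assoc[of "i \<cdot> q" "k \<cdot> x"] z by simp
  ultimately have "i \<cdot> (q \<cdot> (k \<cdot> x)) = zero (Dom C x) (Dom C p1)"
    by - (rule pullback_eqI[OF N], simp_all)
  then have "q \<cdot> (k \<cdot> x) = zero (Dom C x) (Cod C q)"
    using reassoc[OF i(2), of "q \<cdot> (k \<cdot> x)"] by simp
  then obtain y where [simp]: "y \<in> Ar C" "Dom C y = Dom C x" "Cod C y = fob R ?K" and y: "(k \<cdot> \<kappa> ?K) \<cdot> y = k \<cdot> x"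
    by - (rule kernel_lift[OF Kq, of "k \<cdot> x"], simp_all)
  have "\<kappa> ?K \<cdot> y = x" by (rule kernel_cancel[OF K]) (use y in simp_all)
  then show "\<eta> ?K \<cdot> x = zero (Dom C x) (fob I ?K)"
    using reassoc[OF counit_Ar(4)[of ?K], of y] by simp
qed

section \<open>Reflection into normal extensions\<close>

lemma normal_epi_cat_simps:
  "(f, (u, v), g) \<in> Ar (normal_epi_cat C) \<longleftrightarrow> f \<in> Ar C \<and> g \<in> Ar C \<and> normal_epi C f \<and> normal_epi C g \<and>
     u \<in> Ar C \<and> Dom C u = Dom C f \<and> Cod C u = Dom C g \<and>
     v \<in> Ar C \<and> Dom C v = Cod C f \<and> Cod C v = Cod C g \<and> g \<cdot> u = v \<cdot> f"
  "Dom (normal_epi_cat C) (f, (u, v), g) = f" "Cod (normal_epi_cat C) (f, (u, v), g) = g"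
  "(f', (u', v'), g') \<cdot>\<^bsub>normal_epi_cat C\<^esub> (f, (u, v), g) = (f, (u' \<cdot> u, v' \<cdot> v), g')"
  by (auto simp: normal_epi_cat_def full_sub_def arrow_cat_def hom_iff)

text \<open>A square from \<open>f\<close> to a normal extension sends K[f] into a kernel lying in
  \<open>B\<close>, hence kills [K[f]]; its upper arrow then factors uniquely through
  \<open>q\<close>. The lower arrow is unaffected because the reflection is the identity on
  codomains.\<close>

lemma normal_extension_reflection:
  assumes b: "\<And>f. normal_extension C I \<eta> f \<longleftrightarrow> normal_epi C f \<and> (\<forall>k. kernel C f k \<longrightarrow> Dom C k \<in> B)"
    and f: "normal_epi C f" and K: "kernel C f k" and Q: "cokernel C (k \<cdot> \<kappa> (Dom C k)) q"
    and g: "g \<in> hom C (Cod C q) (Cod C f)" "g \<cdot> q = f"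
  shows "reflection_ar (normal_epi_cat C) {g. normal_extension C I \<eta> g} f (f, (q, Ide C (Cod C f)), g)"
proof -
  let ?K = "Dom C k"
  note [simp] = kernelD(1,2)[OF K] cokernelD(2)[OF Q]
  have [simp]: "Cod C k = Dom C f" by (rule kernelD(3)[OF K])
  have [simp]: "Dom C q = Dom C f" using cokernelD(3)[OF Q] by simp
  have [simp]: "g \<in> Ar C" "Dom C g = Cod C q" "Cod C g = Cod C f" using g(1) by (simp_all add: hom_iff)
  have q: "regular_epi C q" by (rule cokernel_regular_epi[OF Q])
  have ng: "normal_epi C g"
    using f g(2) regular_epi_second_factor[of q g] by (simp add: normal_epi_iff_regular_epi)
  have eg: "normal_extension C I \<eta> g"
    using b ng quotient_kernel_B[OF K Q _ _ g(2)] by simp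
  show ?thesis
    unfolding reflection_ar_def
  proof (intro conjI ballI impI)
    fix h assume hA: "h \<in> Ar (normal_epi_cat C)"
      and hc: "Dom (normal_epi_cat C) h = f \<and> Cod (normal_epi_cat C) h \<in> {g. normal_extension C I \<eta> g}"
    obtain f0 u v g' where h0: "h = (f0, (u, v), g')" by (cases h) auto
    then have h: "h = (f, (u, v), g')" using hc by (simp add: normal_epi_cat_simps)
    have e': "normal_extension C I \<eta> g'" and n': "normal_epi C g'"
      using hc hA h by (simp_all add: normal_epi_cat_simps)
    have [simp]: "g' \<in> Ar C" "u \<in> Ar C" "Dom C u = Dom C f" "Cod C u = Dom C g'"
      "v \<in> Ar C" "Dom C v = Cod C f" "Cod C v = Cod C g'"
      and sq: "g' \<cdot> u = v \<cdot> f"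
      using hA h by (simp_all add: normal_epi_cat_simps)
    obtain l where L: "kernel C g' l" by (rule kernel_ex[of g']) simp
    note [simp] = kernelD(2,3)[OF L]
    have lB: "Dom C l \<in> B" using b e' L by blast
    have "g' \<cdot> (u \<cdot> k) = zero ?K (Cod C g')" using reassoc[OF sq, of k] kernelD(4)[OF K] by simp
    then obtain y where [simp]: "y \<in> Ar C" "Dom C y = ?K" "Cod C y = Dom C l" and y: "l \<cdot> y = u \<cdot> k"
      by - (rule kernel_lift[OF L, of "u \<cdot> k"], simp_all)
    obtain t where [simp]: "t \<in> Ar C" "Dom C t = fob I ?K" "Cod C t = Dom C l" and t: "t \<cdot> \<eta> ?K = y"
      by (rule unit_desc[of ?K y]) (use lB in simp_all)
    have "y \<cdot> \<kappa> ?K = zero (fob R ?K) (Dom C l)" using reassoc[of t "\<eta> ?K" y "\<kappa> ?K"] t by simp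
    then have "u \<cdot> (k \<cdot> \<kappa> ?K) = zero (fob R ?K) (Dom C g')" using reassoc[OF y, of "\<kappa> ?K"] by simp
    then obtain w where [simp]: "w \<in> Ar C" "Dom C w = Cod C q" "Cod C w = Dom C g'" and w: "w \<cdot> q = u"
      by - (rule cokernel_desc[OF Q, of u], simp_all)
    have sq': "g' \<cdot> w = v \<cdot> g"
      by (rule regular_epi_cancel[OF q]) (simp_all add: w sq g(2))
    show "\<exists>!m. m \<in> hom (normal_epi_cat C) (Cod (normal_epi_cat C) (f, (q, Ide C (Cod C f)), g)) (Cod (normal_epi_cat C) h) \<and>
        m \<cdot>\<^bsub>normal_epi_cat C\<^esub> (f, (q, Ide C (Cod C f)), g) = h"
    proof (rule ex1I[of _ "(g, (w, v), g')"])
      show "(g, (w, v), g') \<in> hom (normal_epi_cat C) (Cod (normal_epi_cat C) (f, (q, Ide C (Cod C f)), g)) (Cod (normal_epi_cat C) h) \<and>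
        (g, (w, v), g') \<cdot>\<^bsub>normal_epi_cat C\<^esub> (f, (q, Ide C (Cod C f)), g) = h"
        using ng n' sq' w by (simp add: hom_def h normal_epi_cat_simps)
    next
      fix m assume m: "m \<in> hom (normal_epi_cat C) (Cod (normal_epi_cat C) (f, (q, Ide C (Cod C f)), g)) (Cod (normal_epi_cat C) h) \<and>
        m \<cdot>\<^bsub>normal_epi_cat C\<^esub> (f, (q, Ide C (Cod C f)), g) = h"
      obtain a w' v' c where m0: "m = (a, (w', v'), c)" by (cases m) auto
      have ac: "a = g" "c = g'" and wv: "w' \<cdot> q = u" "v' \<cdot> Ide C (Cod C f) = v"
        and [simp]: "w' \<in> Ar C" "Dom C w' = Cod C q" "v' \<in> Ar C" "Dom C v' = Cod C f"
        using m by (auto simp: m0 hom_def h normal_epi_cat_simps)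
      have "w' = w" by (rule regular_epi_cancel[OF q]) (simp_all add: wv w)
      moreover have "v' = v" using wv(2) by simp
      ultimately show "m = (g, (w, v), g')" using ac m0 by simp
    qed
  qed (use f ng eg g(2) in \<open>simp_all add: normal_epi_cat_simps\<close>)
qed

text \<open>For K[f] in \<open>B\<close> the unit at K[f] is monic, so \<open>\<kappa>\<close> is
  zero there and the identity is a cokernel of the resulting zero arrow. The hypothesis then makes
  \<open>f\<close> its own reflection, in particular a member of the reflective subcategory.\<close>

lemma kernel_B_normal_extension_if_reflection:
  assumes c: "\<And>f k q g. \<lbrakk>normal_epi C f; kernel C f k; cokernel C (k \<cdot> \<kappa> (Dom C k)) q;
      g \<in> hom C (Cod C q) (Cod C f); g \<cdot> q = f\<rbrakk> \<Longrightarrow>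
      reflection_ar (normal_epi_cat C) {g. normal_extension C I \<eta> g} f (f, (q, Ide C (Cod C f)), g)"
    and f: "normal_epi C f" and K: "kernel C f k" and kB: "Dom C k \<in> B"
  shows "normal_extension C I \<eta> f"
proof -
  let ?K = "Dom C k"
  note [simp] = kernelD(1-3)[OF K]
  have "\<kappa> ?K = zero (fob R ?K) ?K"
    by (rule mono_arD(2)[OF iso_mono[OF unit_iso[OF kB]]]) simp_all
  then have z: "k \<cdot> \<kappa> ?K = zero (fob R ?K) (Dom C f)" by simp
  have "cokernel C (k \<cdot> \<kappa> ?K) (Ide C (Dom C f))"
  proof (rule cokernelI)
    show "regular_epi C (Ide C (Dom C f))"
      by (rule split_epi_regular[of _ "Ide C (Dom C f)"]) simp_all
    fix h assume "h \<in> Ar C" "Dom C h = Cod C (k \<cdot> \<kappa> ?K)"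
    then show "\<exists>u\<in>Ar C. Dom C u = Cod C (Ide C (Dom C f)) \<and> Cod C u = Cod C h \<and> u \<cdot> Ide C (Dom C f) = h"
      by (intro bexI[of _ h]) simp_all
  qed (simp_all add: z)
  from c[OF f K this, of f] show ?thesis
    by (simp add: reflection_ar_def hom_iff normal_epi_cat_simps)
qed

end

theorem proposition5p4:
  fixes A :: "('o, 'm) cat" and B :: "'o set"
    and I R :: "('o, 'm, 'o, 'm) func" and \<eta> \<kappa> :: "'o \<Rightarrow> 'm"
  assumes "semi_abelian A"
    and "birkhoff_subcategory A B"
    and "reflector A B I \<eta>"
    and "radical A \<eta> R \<kappa>"
  defines "cond1 \<equiv> protoadditive A (full_sub A B) I"
    and "cond2 \<equiv> protoadditive A A R"
    and "cond_a \<equiv> (\<forall>f k. normal_epi A f \<and> kernel A f k \<longrightarrow> normal_mono A (k \<cdot>\<^bsub>A\<^esub> \<kappa> (Dom A k)))"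
    and "cond3b \<equiv> (\<forall>f. normal_extension A I \<eta> f \<longleftrightarrow>
           normal_epi A f \<and> (\<forall>k. kernel A f k \<longrightarrow> Dom A k \<in> B))"
    and "cond4b \<equiv> (\<forall>f k q fbar. normal_epi A f \<and> kernel A f k \<and>
           cokernel A (k \<cdot>\<^bsub>A\<^esub> \<kappa> (Dom A k)) q \<and>
           fbar \<in> hom A (Cod A q) (Cod A f) \<and> fbar \<cdot>\<^bsub>A\<^esub> q = f \<longrightarrow>
           reflection_ar (normal_epi_cat A) {g. normal_extension A I \<eta> g}
             f (f, (q, Ide A (Cod A f)), fbar))"
  shows "(cond1 \<longleftrightarrow> cond2) \<and> (cond2 \<longleftrightarrow> cond_a \<and> cond3b) \<and> (cond_a \<and> cond3b \<longleftrightarrow> cond_a \<and> cond4b)"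
proof -
  have "category A" using assms(1) by (simp add: semi_abelian_def)
  then interpret birkhoff_reflection A B I R \<eta> \<kappa>
    using assms(1-4)
    by (simp add: birkhoff_reflection_def birkhoff_reflection_axioms_def
        semi_abelian_category_def semi_abelian_category_axioms_def)
  have kernels: "\<exists>k. kernel A f k" if "normal_epi A f" for f
    using that kernel_ex[OF regular_epi_Ar] by (auto simp: normal_epi_iff_regular_epi)
  \<comment> \<open>Condition (3b) quantifies over all kernels of \<open>f\<close>, whereas the
    constructions work with one. The implication from normal extension to kernel in \<open>B\<close>
    is already established, which leaves the other implication for a single kernel.\<close>
  have ext_iff: "cond3b \<longleftrightarrow> (\<forall>f k. normal_epi A f \<longrightarrow> kernel A f k \<longrightarrow> Dom A k \<in> B \<longrightarrow> normal_extension A I \<eta> f)"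
  proof
    assume cond3b
    \<comment> \<open>Two kernels of one arrow embed into each other, so closure under subobjects
      makes membership in \<open>B\<close> independent of the choice.\<close>
    have "Dom A k' \<in> B" if K: "kernel A f k" "Dom A k \<in> B" "kernel A f k'" for f k k'
    proof -
      note [simp] = kernelD[OF K(1)] kernelD[OF K(3)]
      obtain u where u [simp]: "u \<in> Ar A" "Dom A u = Dom A k'" "Cod A u = Dom A k" and ku: "k \<cdot>\<^bsub>A\<^esub> u = k'"
        by (rule kernel_lift[OF K(1), of k']) auto
      have "mono_ar A u"
      proof (rule mono_arI)
        fix x y assume [simp]: "x \<in> Ar A" "y \<in> Ar A" "Cod A x = Dom A u" "Cod A y = Dom A u"
          and "u \<cdot>\<^bsub>A\<^esub> x = u \<cdot>\<^bsub>A\<^esub> y"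
        then have "k' \<cdot>\<^bsub>A\<^esub> x = k' \<cdot>\<^bsub>A\<^esub> y" using reassoc[OF ku, of x] reassoc[OF ku, of y] by simp
        then show "x = y" by - (rule kernel_cancel[OF K(3)], simp_all)
      qed simp
      from mono_B[OF this] show ?thesis using K(2) by simp
    qed
    with \<open>cond3b\<close> show "\<forall>f k. normal_epi A f \<longrightarrow> kernel A f k \<longrightarrow> Dom A k \<in> B \<longrightarrow> normal_extension A I \<eta> f"
      unfolding cond3b_def by blast
  next
    assume "\<forall>f k. normal_epi A f \<longrightarrow> kernel A f k \<longrightarrow> Dom A k \<in> B \<longrightarrow> normal_extension A I \<eta> f"
    then show cond3b
      unfolding cond3b_def using kernels normal_extension_kernel_B
      by (meson normal_extension_def)
  qed
  have "cond1 \<longleftrightarrow> reflects_split_kernels"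
    unfolding cond1_def by (rule protoadditive_iff_reflects_split_kernels)
  moreover have "cond2 \<longleftrightarrow> reflects_split_kernels"
    unfolding cond2_def by (rule reflects_split_kernels_iff_radical_protoadditive[symmetric])
  moreover have "cond_a" "cond3b" if reflects_split_kernels
    using radical_kernel_normal[OF that] kernel_B_normal_extension[OF that]
    unfolding cond_a_def ext_iff by blast+
  moreover have reflects_split_kernels if cond_a cond3b
    by (rule reflects_split_kernels_if_normal_extensions) (use that in \<open>auto simp: cond_a_def cond3b_def\<close>)
  moreover have cond4b if cond3b
    using normal_extension_reflection that unfolding cond3b_def cond4b_def by blast
  moreover have cond3b if cond4b
    unfolding ext_iff
    using kernel_B_normal_extension_if_reflection that unfolding cond4b_def by blast
  ultimately show ?thesis by blast
qed

end
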